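(* Let $\overline{G}=(\overline{V},\overline{E})$ be a complete graph on $n$ vertices with a metric cost function $c$ (i.e., $c\ge 0$ and $c_{uw}\le c_{uv}+c_{vw}$ for all $u,v,w\in\overline{V}$). Let $x\in\mathbb{R}^{\overline{E}}$ be an optimal solution of the subtour elimination linear program $$\min \sum_{e\in\overline{E}} c_e x_e \quad\text{s.t.}\quad x(\delta(S))\ge 2\ \ \forall\,\emptyset\subsetneq S\subsetneq \overline{V},\qquad x(\delta(v))=2\ \ \forall v\in\overline{V},\qquad x\ge 0,$$ which is half-integral, i.e. $2x_e\in\mathbb{Z}_{\ge 0}$ for every $e\in\overline{E}$. Then there is an $O(n^2)$-time algorithm that computes a $2$-edge connected spanning multisubgraph of $\overline{G}$ whose cost is at most $\frac43 c^T x$.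
   Context: For $S\subseteq \overline{V}$, $\delta(S)$ is the set of edges with exactly one endpoint in $S$, and $x(F)=\sum_{e\in F}x_e$. A spanning multisubgraph of $\overline{G}$ is a multigraph on vertex set $\overline{V}$ each of whose edges is a copy of an edge of $\overline{G}$ (an edge of $\overline{G}$ may be used several times); its cost is the sum of the costs of its edges counted with multiplicity. It is $2$-edge connected if it remains connected after deleting any single edge (copy). *)

theory Defs
  imports Complex_Main "HOL-Library.Multiset" "HOL-Library.Landau_Symbols"
begin

text \<open>The complete graph on the vertex set \<open>{..<n}\<close>; an edge is a two-element set of vertices.\<close>

definition edges :: "nat \<Rightarrow> nat set set" where
  "edges n = {e. e \<subseteq> {..<n} \<and> card e = 2}"

definition cut :: "nat \<Rightarrow> nat set \<Rightarrow> nat set set" where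
  "cut n S = {e \<in> edges n. card (e \<inter> S) = 1}"

text \<open>The triangle inequality is only required for distinct vertices, since \<open>c\<close> has no meaning on
  loops; with \<open>c\<^sub>v\<^sub>v = 0\<close> the degenerate instances follow from nonnegativity.\<close>

definition metric_cost :: "nat \<Rightarrow> (nat set \<Rightarrow> real) \<Rightarrow> bool" where
  "metric_cost n c \<longleftrightarrow>
     (\<forall>e\<in>edges n. 0 \<le> c e) \<and>
     (\<forall>u<n. \<forall>v<n. \<forall>w<n. u \<noteq> v \<and> v \<noteq> w \<and> u \<noteq> w \<longrightarrow> c {u, w} \<le> c {u, v} + c {v, w})"

definition lp_cost :: "nat \<Rightarrow> (nat set \<Rightarrow> real) \<Rightarrow> (nat set \<Rightarrow> real) \<Rightarrow> real" where
  "lp_cost n c x = (\<Sum>e\<in>edges n. c e * x e)"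

definition subtour_feasible :: "nat \<Rightarrow> (nat set \<Rightarrow> real) \<Rightarrow> bool" where
  "subtour_feasible n x \<longleftrightarrow>
     (\<forall>S. S \<noteq> {} \<and> S \<subset> {..<n} \<longrightarrow> (\<Sum>e\<in>cut n S. x e) \<ge> 2) \<and>
     (\<forall>v<n. (\<Sum>e\<in>cut n {v}. x e) = 2) \<and>
     (\<forall>e\<in>edges n. 0 \<le> x e)"

definition subtour_optimal :: "nat \<Rightarrow> (nat set \<Rightarrow> real) \<Rightarrow> (nat set \<Rightarrow> real) \<Rightarrow> bool" where
  "subtour_optimal n c x \<longleftrightarrow>
     subtour_feasible n x \<and> (\<forall>y. subtour_feasible n y \<longrightarrow> lp_cost n c x \<le> lp_cost n c y)"

definition half_integral :: "nat \<Rightarrow> (nat set \<Rightarrow> real) \<Rightarrow> bool" where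
  "half_integral n x \<longleftrightarrow> (\<forall>e\<in>edges n. 2 * x e \<in> \<nat>)"

text \<open>A multigraph on a given vertex set is the multiset of its edges.\<close>

definition spanning_multisubgraph :: "nat \<Rightarrow> nat set multiset \<Rightarrow> bool" where
  "spanning_multisubgraph n H \<longleftrightarrow> set_mset H \<subseteq> edges n"

definition mg_connected :: "nat set \<Rightarrow> nat set multiset \<Rightarrow> bool" where
  "mg_connected V H \<longleftrightarrow> (\<forall>u\<in>V. \<forall>v\<in>V. (u, v) \<in> {(a, b). {a, b} \<in># H}\<^sup>*)"

definition two_edge_connected :: "nat set \<Rightarrow> nat set multiset \<Rightarrow> bool" where
  "two_edge_connected V H \<longleftrightarrow> mg_connected V H \<and> (\<forall>e\<in>#H. mg_connected V (H - {#e#}))"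

definition mg_cost :: "(nat set \<Rightarrow> real) \<Rightarrow> nat set multiset \<Rightarrow> real" where
  "mg_cost c H = (\<Sum>e\<in>#H. c e)"

text \<open>
  The model of computation is a uniform-cost real RAM, presented as a structured language. A
  program has finitely many unbounded arrays of natural numbers and finitely many unbounded arrays
  of reals, each numbered by a literal occurring in the program; a scalar is a cell with literal
  index. Naturals, which serve as indices, admit addition and truncated subtraction only:
  unit-cost multiplication of naturals would make the model unreasonably powerful. Reals admit
  exact field operations and comparison, but there is no rounding and no other conversion from
  reals to naturals. Real literals are integers, so that a program carries only finite information.
\<close>

datatype nexp =
    NLit nat
  | NRead nat nexp
  | NAdd nexp nexp
  | NSub nexp nexp

datatype rexp =
    RLit int
  | RRead nat nexp
  | RAdd rexp rexp
  | RSub rexp rexp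
  | RMul rexp rexp
  | RDiv rexp rexp

datatype bexp =
    NLess nexp nexp
  | RLess rexp rexp
  | BNot bexp
  | BAnd bexp bexp

datatype com =
    Skip
  | NWrite nat nexp nexp
  | RWrite nat nexp rexp
  | Seq com com
  | Cond bexp com com
  | While bexp com

record state =
  nmem :: "nat \<Rightarrow> nat \<Rightarrow> nat"
  rmem :: "nat \<Rightarrow> nat \<Rightarrow> real"

fun nval :: "nexp \<Rightarrow> state \<Rightarrow> nat" where
  "nval (NLit k) s = k"
| "nval (NRead a i) s = nmem s a (nval i s)"
| "nval (NAdd d e) s = nval d s + nval e s"
| "nval (NSub d e) s = nval d s - nval e s"

fun rval :: "rexp \<Rightarrow> state \<Rightarrow> real" where
  "rval (RLit k) s = of_int k"
| "rval (RRead a i) s = rmem s a (nval i s)"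
| "rval (RAdd d e) s = rval d s + rval e s"
| "rval (RSub d e) s = rval d s - rval e s"
| "rval (RMul d e) s = rval d s * rval e s"
| "rval (RDiv d e) s = rval d s / rval e s"

fun bval :: "bexp \<Rightarrow> state \<Rightarrow> bool" where
  "bval (NLess d e) s \<longleftrightarrow> nval d s < nval e s"
| "bval (RLess d e) s \<longleftrightarrow> rval d s < rval e s"
| "bval (BNot b) s \<longleftrightarrow> \<not> bval b s"
| "bval (BAnd b b') s \<longleftrightarrow> bval b s \<and> bval b' s"

definition nwrite :: "nat \<Rightarrow> nat \<Rightarrow> nat \<Rightarrow> state \<Rightarrow> state" where
  "nwrite a i k s = s\<lparr>nmem := (nmem s)(a := (nmem s a)(i := k))\<rparr>"

definition rwrite :: "nat \<Rightarrow> nat \<Rightarrow> real \<Rightarrow> state \<Rightarrow> state" where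
  "rwrite a i r s = s\<lparr>rmem := (rmem s)(a := (rmem s a)(i := r))\<rparr>"

text \<open>\<open>exec p s t s'\<close>: started in \<open>s\<close>, the program \<open>p\<close> halts in \<open>s'\<close> after \<open>t\<close> steps. Every
  assignment and every test is one step; as the expressions are part of the program, this differs
  from counting the individual operations by a factor depending on the program only.\<close>

inductive exec :: "com \<Rightarrow> state \<Rightarrow> nat \<Rightarrow> state \<Rightarrow> bool" where
  Skip: "exec Skip s 1 s"
| NWrite: "exec (NWrite a i e) s 1 (nwrite a (nval i s) (nval e s) s)"
| RWrite: "exec (RWrite a i e) s 1 (rwrite a (nval i s) (rval e s) s)"
| Seq: "exec p s t s' \<Longrightarrow> exec q s' t' s'' \<Longrightarrow> exec (Seq p q) s (t + t') s''"
| CondTrue: "bval b s \<Longrightarrow> exec p s t s' \<Longrightarrow> exec (Cond b p q) s (t + 1) s'"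
| CondFalse: "\<not> bval b s \<Longrightarrow> exec q s t s' \<Longrightarrow> exec (Cond b p q) s (t + 1) s'"
| WhileFalse: "\<not> bval b s \<Longrightarrow> exec (While b p) s 1 s"
| WhileTrue: "bval b s \<Longrightarrow> exec p s t s' \<Longrightarrow> exec (While b p) s' t' s'' \<Longrightarrow>
    exec (While b p) s (t + t' + 1) s''"

inductive_cases exec_SkipE: "exec Skip s t s'"
inductive_cases exec_NWriteE: "exec (NWrite a i e) s t s'"
inductive_cases exec_RWriteE: "exec (RWrite a i e) s t s'"
inductive_cases exec_SeqE: "exec (Seq p q) s t s'"
inductive_cases exec_CondE: "exec (Cond b p q) s t s'"
inductive_cases exec_WhileE: "exec (While b p) s t s'"

lemma exec_deterministic:
  "exec p s t s' \<Longrightarrow> exec p s u s'' \<Longrightarrow> t = u \<and> s' = s''"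
proof (induction arbitrary: u s'' rule: exec.induct)
  case (Seq p s t s1 q t' s2)
  from Seq.prems obtain v v' r where
    *: "exec p s v r" "exec q r v' s''" "u = v + v'"
    by (rule exec_SeqE)
  then show ?case
    using Seq.IH(1)[OF *(1)] Seq.IH(2)[of v' s''] by simp
next
  case (CondTrue b s p t s1 q)
  from CondTrue.prems obtain v where "exec p s v s''" "u = v + 1"
    by (rule exec_CondE) (use CondTrue.hyps in auto)
  then show ?case
    using CondTrue.IH[of v s''] by simp
next
  case (CondFalse b s q t s1 p)
  from CondFalse.prems obtain v where "exec q s v s''" "u = v + 1"
    by (rule exec_CondE) (use CondFalse.hyps in auto)
  then show ?case
    using CondFalse.IH[of v s''] by simp
next
  case (WhileFalse b s p)
  from WhileFalse.prems show ?case
    by (rule exec_WhileE) (use WhileFalse.hyps in simp_all)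
next
  case (WhileTrue b s p t s1 t' s2)
  from WhileTrue.prems obtain v v' r where
    *: "exec p s v r" "exec (While b p) r v' s''" "u = v + v' + 1"
    by (rule exec_WhileE) (use WhileTrue.hyps(1) in simp_all)
  then show ?case
    using WhileTrue.IH(1)[OF *(1)] WhileTrue.IH(2)[of v' s''] by simp
qed (erule exec_SkipE exec_NWriteE exec_RWriteE, simp)+

text \<open>Input: cell 0 of natural array 0 holds \<open>n\<close>; real arrays 0 and 1 hold \<open>c\<close> and \<open>x\<close> as
  symmetric \<open>n \<times> n\<close> matrices in row-major order with zero diagonal; all other cells are 0.\<close>

definition matrix :: "nat \<Rightarrow> (nat set \<Rightarrow> real) \<Rightarrow> nat \<Rightarrow> real" where
  "matrix n f k =
     (if k < n * n \<and> k div n \<noteq> k mod n then f {k div n, k mod n} else 0)"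

definition input_state :: "nat \<Rightarrow> (nat set \<Rightarrow> real) \<Rightarrow> (nat set \<Rightarrow> real) \<Rightarrow> state" where
  "input_state n c x =
     \<lparr>nmem = (\<lambda>a i. if a = 0 \<and> i = 0 then n else 0),
      rmem = (\<lambda>a. if a = 0 then matrix n c else if a = 1 then matrix n x else (\<lambda>i. 0))\<rparr>"

text \<open>Output: for \<open>i < j < n\<close>, the multiplicity of the edge \<open>{i, j}\<close> is in cell \<open>i * n + j\<close> of
  natural array 1.\<close>

definition output_multigraph :: "nat \<Rightarrow> state \<Rightarrow> nat set multiset" where
  "output_multigraph n s =
     (\<Sum>e\<in>edges n. replicate_mset (nmem s 1 (Min e * n + Max e)) e)"

lemma finite_edges: "finite (edges n)"
  unfolding edges_def by (rule finite_subset[of _ "Pow {..<n}"]) auto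

lemma count_output_multigraph:
  assumes "i < j" and "j < n"
  shows "count (output_multigraph n s) {i, j} = nmem s 1 (i * n + j)"
proof -
  have "{i, j} \<in> edges n"
    using assms by (auto simp: edges_def)
  moreover have "Min {i, j} = i" "Max {i, j} = j"
    using assms by auto
  ultimately show ?thesis
    by (simp add: output_multigraph_def count_sum finite_edges sum.delta)
qed

end

theory Submission
  imports Defs
begin

text \<open>
  Doubling a half-integral feasible solution gives a 4-regular, 4-edge-connected multigraph. For
  arbitrary edge costs and any root edge \<open>r v\<close>, such a multigraph has a 2-edge-connected spanning
  subgraph that avoids the root edge and costs at most 2/3 of the other edges. To see this, let
  \<open>b, d, e\<close> be the other three edges at \<open>v\<close>. By submodularity of cuts, at most one of the three ways
  of splitting off \<open>v\<close> destroys 4-edge-connectivity; name the edges such that this is not the pairing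
  of the root edge with \<open>b\<close> nor the one with \<open>d\<close>, and such that \<open>c d \<le> c b\<close>. Pair the root edge with
  \<open>b\<close> to form the new root edge, and \<open>d\<close> with \<open>e\<close> to form an edge of cost \<open>c e - c b\<close>. In a solution
  for the smaller graph, subdivide the new edge by \<open>v\<close> if it was selected, and otherwise attach \<open>v\<close> by
  \<open>b\<close> and \<open>d\<close>.

  The inadmissible pairing is found in linear time: the cuts of size 2 in the graph without \<open>v\<close> all
  induce the same pairing of the neighbours of \<open>v\<close>, so three rounds of flow augmentation between two
  of these neighbours decide the matter. There are \<open>n - 1\<close> such steps.

  A graph is stored by its darts (half-edges): the darts of the vertex \<open>u\<close> are \<open>4 u, \<dots>, 4 u + 3\<close>, and
  the edges are the orbits of an involution \<open>m\<close>. Splitting off then only changes values of \<open>m\<close>.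
\<close>

section \<open>Dart graphs\<close>

text \<open>The constant 2/3 comes from comparing two increments. Restoring \<open>v\<close> adds
  \<open>c b + c d\<close> to the solution, while the total cost available grows by
  \<open>(c b + c d + c e) - (c e - c b) = 2 * c b + c d\<close>; the former is at most 2/3 of the
  latter exactly when \<open>c d <= c b\<close>. As the roles of \<open>b\<close> and
  \<open>d\<close> are dictated by their costs, the root edge must be allowed to pair with either of
  them, so a single inadmissible pairing can be tolerated, but not two. The cost
  \<open>c e - c b\<close> makes the two ways of restoring \<open>v\<close> equally expensive. It
  may be negative, which forces the induction to admit arbitrary costs. Nonnegativity of the given
  costs enters at the end, when the root edge is put back into the bound. The factor 4/3 is 2/3
  times the 2 from doubling the solution. The root edge is always the edge at dart \<open>0\<close>:
  the vertex removed is its other end, and the new root edge again contains dart \<open>0\<close>.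
  Hence vertex \<open>0\<close> survives, and the induction ends with two loops at \<open>0\<close>,
  the root loop and one more, which is selected if and only if its cost is negative.\<close>

definition owner :: "nat \<Rightarrow> nat" where
  "owner d = d div 4"

definition darts :: "nat set \<Rightarrow> nat set" where
  "darts S = {d. owner d \<in> S}"

text \<open>Being 4-regular is built into the numbering of the darts. Parallel edges and loops are
  allowed; loops are needed for the one-vertex graph in which the reduction ends.\<close>

definition dart_graph :: "nat set \<Rightarrow> (nat \<Rightarrow> nat) \<Rightarrow> bool" where
  "dart_graph A m \<longleftrightarrow> finite A \<and> (\<forall>d\<in>darts A. m d \<in> darts A \<and> m (m d) = d \<and> m d \<noteq> d)"

text \<open>An edge of the cut is represented by its dart on the side of \<open>S\<close>. The
  vertex set is a parameter so that \<open>crossing (A - {v}) m\<close> describes the graph without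
  \<open>v\<close> with \<open>m\<close> unchanged: darts whose mates lie at \<open>v\<close> are
  ignored.\<close>

definition crossing :: "nat set \<Rightarrow> (nat \<Rightarrow> nat) \<Rightarrow> nat set \<Rightarrow> nat set" where
  "crossing A m S = {d \<in> darts S. m d \<in> darts (A - S)}"

definition four_edge_connected :: "nat set \<Rightarrow> (nat \<Rightarrow> nat) \<Rightarrow> bool" where
  "four_edge_connected A m \<longleftrightarrow>
     dart_graph A m \<and> (\<forall>S. S \<noteq> {} \<and> S \<subset> A \<longrightarrow> 4 \<le> card (crossing A m S))"

lemma mem_darts [simp]: "d \<in> darts S \<longleftrightarrow> owner d \<in> S"
  by (simp add: darts_def)

lemma darts_singleton: "darts {u} = {4 * u..<4 * u + 4}"
  by (auto simp: owner_def)

lemma finite_darts [simp]: "finite S \<Longrightarrow> finite (darts S)"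
proof (induction S rule: finite_induct)
  case (insert u S)
  have "darts (insert u S) = darts {u} \<union> darts S" by auto
  then show ?case using insert by (simp add: darts_singleton)
qed (simp add: darts_def)

lemma sum_darts:
  assumes "finite S"
  shows "sum f (darts S) = (\<Sum>u\<in>S. sum f (darts {u}))"
  using assms
proof (induction S rule: finite_induct)
  case (insert u S)
  have "darts (insert u S) = darts {u} \<union> darts S" "darts {u} \<inter> darts S = {}"
    using insert.hyps by auto
  then show ?case using insert by (simp add: sum.union_disjoint)
qed (simp add: darts_def)

lemma card_darts: "finite S \<Longrightarrow> card (darts S) = 4 * card S"
  using sum_darts[of S "\<lambda>_. 1::nat"] by (simp add: darts_singleton)

lemma even_card_involution:
  assumes "finite X" "\<And>d. d \<in> X \<Longrightarrow> m d \<in> X \<and> m (m d) = d \<and> m d \<noteq> d"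
  shows "even (card X)"
  using assms
proof (induction X rule: finite_psubset_induct)
  case (psubset X)
  show ?case
  proof (cases "X = {}")
    case False
    then obtain d where d: "d \<in> X" by auto
    let ?Y = "X - {d, m d}"
    have "even (card ?Y)"
    proof (rule psubset.IH)
      show "?Y \<subset> X" using d by auto
      fix z assume "z \<in> ?Y"
      then show "m z \<in> ?Y \<and> m (m z) = z \<and> m z \<noteq> z"
        using psubset.prems[of z] psubset.prems[OF d] by auto
    qed
    moreover have "card X = card ?Y + 2"
    proof -
      have "card ?Y = card X - card {d, m d}"
        using d psubset.prems[OF d] psubset.hyps by (intro card_Diff_subset) auto
      moreover have "card {d, m d} = 2" using psubset.prems[OF d] by (metis card_2_iff)
      moreover have "card {d, m d} \<le> card X"
        using d psubset.prems[OF d] psubset.hyps by (intro card_mono) auto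
      ultimately show ?thesis by simp
    qed
    ultimately show ?thesis by simp
  qed simp
qed

lemma even_ge_3: "even k \<Longrightarrow> 3 \<le> k \<Longrightarrow> 4 \<le> (k :: nat)"
  by presburger

lemma sum_antisymmetric_involution:
  fixes g :: "'a \<Rightarrow> 'b :: {linordered_ab_group_add}"
  assumes "\<And>d. d \<in> X \<Longrightarrow> m d \<in> X \<and> m (m d) = d \<and> g (m d) = - g d"
  shows "sum g X = 0"
proof -
  have "bij_betw m X X" by (rule bij_betw_byWitness[where f' = m]) (use assms in auto)
  then have "sum g X = (\<Sum>d\<in>X. g (m d))" by (rule sum.reindex_bij_betw[symmetric])
  also have "\<dots> = (\<Sum>d\<in>X. - g d)" by (rule sum.cong) (use assms in auto)
  finally have "sum g X = - sum g X" by (simp add: sum_negf)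
  then show ?thesis by simp
qed

context
  fixes A :: "nat set" and m :: "nat \<Rightarrow> nat"
  assumes graph: "dart_graph A m"
begin

lemma finite_vertices: "finite A"
  using graph by (simp add: dart_graph_def)

lemma mate_mate: "owner d \<in> A \<Longrightarrow> m (m d) = d"
  using graph by (simp add: dart_graph_def)

lemma mate_ne: "owner d \<in> A \<Longrightarrow> m d \<noteq> d"
  using graph by (simp add: dart_graph_def)

lemma mate_vertex: "owner d \<in> A \<Longrightarrow> owner (m d) \<in> A"
  using graph by (simp add: dart_graph_def)

lemma finite_crossing: "S \<subseteq> A \<Longrightarrow> finite (crossing B m S)"
  by (rule finite_subset[of _ "darts A"]) (auto simp: crossing_def finite_vertices)

text \<open>The number of darts of \<open>S\<close> is a multiple of 4, and those whose mates also
  lie in \<open>S\<close> are matched in pairs by \<open>m\<close>.\<close>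

lemma even_crossing:
  assumes "S \<subseteq> A"
  shows "even (card (crossing A m S))"
proof -
  let ?I = "{d \<in> darts S. m d \<in> darts S}"
  have fin: "finite (darts S)" using finite_subset[OF assms finite_vertices] by simp
  have "even (card ?I)"
    by (rule even_card_involution[of _ m]) (use fin assms mate_mate mate_ne in \<open>auto intro: finite_subset[OF _ fin]\<close>)
  moreover have "darts S = ?I \<union> crossing A m S" "?I \<inter> crossing A m S = {}"
    using assms mate_vertex by (auto simp: crossing_def)
  then have "card (darts S) = card ?I + card (crossing A m S)"
    using fin by (metis card_Un_disjoint finite_Un)
  ultimately show ?thesis
    using card_darts[of S] assms finite_vertices finite_subset
    by (metis dvd_add_right_iff dvd_triv_left even_mult_iff even_numeral)
qed

lemma card_crossing_complement:
  assumes "B \<subseteq> A" "S \<subseteq> B"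
  shows "card (crossing B m (B - S)) = card (crossing B m S)"
proof (rule bij_betw_same_card)
  show "bij_betw m (crossing B m (B - S)) (crossing B m S)"
    by (rule bij_betw_byWitness[where f' = m])
      (use assms mate_mate in \<open>auto simp: crossing_def double_diff subset_iff\<close>)
qed

text \<open>Both the union and the intersection of the two dart sets on the left are contained in
  the union and the intersection, respectively, of those on the right.\<close>

lemma crossing_submodular:
  assumes "S \<subseteq> A" "T \<subseteq> A"
  shows "card (crossing B m (S \<inter> T)) + card (crossing B m (S \<union> T))
      \<le> card (crossing B m S) + card (crossing B m T)"
proof -
  have fin: "finite (crossing B m U)" if "U \<subseteq> A" for U using finite_crossing that .
  have "card (crossing B m (S \<inter> T)) + card (crossing B m (S \<union> T)) =
     card (crossing B m (S \<inter> T) \<union> crossing B m (S \<union> T)) +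
     card (crossing B m (S \<inter> T) \<inter> crossing B m (S \<union> T))"
    using assms by (intro card_Un_Int fin) auto
  also have "\<dots> \<le> card (crossing B m S \<union> crossing B m T) + card (crossing B m S \<inter> crossing B m T)"
    using assms fin by (intro add_mono card_mono) (auto simp: crossing_def)
  also have "\<dots> = card (crossing B m S) + card (crossing B m T)"
    using assms by (intro card_Un_Int[symmetric] fin) auto
  finally show ?thesis .
qed

lemma card_crossing_delete_vertex:
  assumes "v \<in> A" "S \<subseteq> A - {v}"
  shows "card (crossing A m S) =
    card (crossing (A - {v}) m S) + card {d \<in> darts {v}. m d \<in> darts S}"
proof -
  let ?V = "{d \<in> darts S. m d \<in> darts {v}}"
  have "crossing A m S = crossing (A - {v}) m S \<union> ?V" "crossing (A - {v}) m S \<inter> ?V = {}"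
    using assms by (auto simp: crossing_def)
  moreover have "finite (crossing A m S)" using assms by (intro finite_crossing) auto
  ultimately have "card (crossing A m S) = card (crossing (A - {v}) m S) + card ?V"
    by (metis card_Un_disjoint finite_Un)
  moreover have "bij_betw m ?V {d \<in> darts {v}. m d \<in> darts S}"
    by (rule bij_betw_byWitness[where f' = m]) (use assms mate_mate in auto)
  ultimately show ?thesis by (simp add: bij_betw_same_card)
qed

end

text \<open>The cut around \<open>v\<close> needs four darts, and \<open>v\<close> has no more than
  four.\<close>

lemma four_edge_connected_no_loop:
  assumes "four_edge_connected A m" "v \<in> A" "A \<noteq> {v}" "owner d = v"
  shows "owner (m d) \<in> A - {v}"
proof -
  have "4 \<le> card (crossing A m {v})"
    using assms by (auto simp: four_edge_connected_def)
  moreover have "crossing A m {v} \<subseteq> darts {v}" by (auto simp: crossing_def)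
  moreover have "card (darts {v}) = 4" "finite (darts {v})" by (simp_all add: card_darts)
  ultimately have "crossing A m {v} = darts {v}" by (metis card_seteq)
  then have "d \<in> crossing A m {v}" using assms by simp
  then show ?thesis by (simp add: crossing_def)
qed

text \<open>The second bound is the first one for the complement of \<open>S\<close>.\<close>

lemma crossing_delete_vertex_bounds:
  assumes fec: "four_edge_connected A m" and v: "v \<in> A"
    and S: "S \<subset> A - {v}" "S \<noteq> {}"
  shows "4 \<le> card (crossing (A - {v}) m S) + card {d \<in> darts {v}. m d \<in> darts S}"
    and "card {d \<in> darts {v}. m d \<in> darts S} \<le> card (crossing (A - {v}) m S)"
proof -
  let ?B = "A - {v}"
  have graph: "dart_graph A m" using fec by (simp add: four_edge_connected_def)
  have ne: "A \<noteq> {v}" using S by auto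
  have low: "4 \<le> card (crossing ?B m U) + card {d \<in> darts {v}. m d \<in> darts U}"
    if "U \<subseteq> ?B" "U \<noteq> {}" for U
  proof -
    have "U \<subset> A" using that v by auto
    then have "4 \<le> card (crossing A m U)"
      using fec that unfolding four_edge_connected_def by blast
    then show ?thesis using card_crossing_delete_vertex[OF graph v that(1)] by simp
  qed
  show "4 \<le> card (crossing ?B m S) + card {d \<in> darts {v}. m d \<in> darts S}"
    by (rule low) (use S in auto)
  have "darts {v} = {d \<in> darts {v}. m d \<in> darts S} \<union> {d \<in> darts {v}. m d \<in> darts (?B - S)}"
  proof -
    have "m z \<in> darts ?B" if "z \<in> darts {v}" for z
      using four_edge_connected_no_loop[OF fec v ne] that by simp
    moreover have "darts ?B = darts S \<union> darts (?B - S)" using S by auto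
    ultimately show ?thesis by blast
  qed
  moreover have "{d \<in> darts {v}. m d \<in> darts S} \<inter> {d \<in> darts {v}. m d \<in> darts (?B - S)} = {}"
    by auto
  moreover have "finite (darts {v})" by simp
  ultimately have "card (darts {v}) = card {d \<in> darts {v}. m d \<in> darts S} +
      card {d \<in> darts {v}. m d \<in> darts (?B - S)}"
    using card_Un_disjoint finite_Un by (metis (no_types, lifting))
  then have "4 = card {d \<in> darts {v}. m d \<in> darts S} + card {d \<in> darts {v}. m d \<in> darts (?B - S)}"
    by (simp add: card_darts)
  moreover have "4 \<le> card (crossing ?B m (?B - S)) + card {d \<in> darts {v}. m d \<in> darts (?B - S)}"
    by (rule low) (use S in auto)
  moreover have "card (crossing ?B m (?B - S)) = card (crossing ?B m S)"
    by (rule card_crossing_complement[OF graph]) (use S in auto)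
  ultimately show "card {d \<in> darts {v}. m d \<in> darts S} \<le> card (crossing ?B m S)" by simp
qed

text \<open>Here \<open>a, b, d, e\<close> are the darts of the vertex that is removed; the values at these darts become
  stale.\<close>

definition split_off :: "(nat \<Rightarrow> nat) \<Rightarrow> nat \<Rightarrow> nat \<Rightarrow> nat \<Rightarrow> nat \<Rightarrow> nat \<Rightarrow> nat" where
  "split_off m a b d e = m(m a := m b, m b := m a, m d := m e, m e := m d)"

text \<open>Splitting off decreases only the cuts that separate the ends of the two new edges from each other
  without crossing either; by parity it is enough to exclude that they have size 2.\<close>

definition admissible :: "nat set \<Rightarrow> (nat \<Rightarrow> nat) \<Rightarrow> nat \<Rightarrow> nat \<Rightarrow> nat \<Rightarrow> nat \<Rightarrow> bool" where
  "admissible B m a b d e \<longleftrightarrow> (\<forall>S \<subseteq> B. owner (m a) \<in> S \<and> owner (m b) \<in> S \<and> owner (m d) \<notin> S \<and> owner (m e) \<notin> S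
     \<longrightarrow> 3 \<le> card (crossing B m S))"

text \<open>Here \<open>k\<close> and \<open>k'\<close> stand for the size of a cut without
  \<open>v\<close> and after splitting off; the booleans tell which of the four neighbours lie
  inside. If both new edges cross, two neighbours are inside and \<open>k\<close> is at least 2. If
  one crosses, one or three are inside and \<open>k\<close> is at least 3. If none crosses, either
  zero or four are inside and \<open>k\<close> is at least 4, or two are inside and the last three
  assumptions, which stand for admissibility and parity, apply.\<close>

lemma split_off_cut_bound:
  fixes k k' :: nat and a b d e :: bool
  assumes "4 \<le> k + (of_bool a + of_bool b + of_bool d + of_bool e)"
    and "of_bool a + of_bool b + of_bool d + of_bool e \<le> k"
    and "k \<le> k'" and "a \<noteq> b \<Longrightarrow> k + 1 \<le> k'" and "d \<noteq> e \<Longrightarrow> k + 1 \<le> k'"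
    and "a \<noteq> b \<Longrightarrow> d \<noteq> e \<Longrightarrow> k + 2 \<le> k'" and "3 \<le> k \<Longrightarrow> 4 \<le> k'"
    and "a \<Longrightarrow> b \<Longrightarrow> \<not> d \<Longrightarrow> \<not> e \<Longrightarrow> 3 \<le> k" and "\<not> a \<Longrightarrow> \<not> b \<Longrightarrow> d \<Longrightarrow> e \<Longrightarrow> 3 \<le> k"
  shows "4 \<le> k'"
proof -
  have two: "4 \<le> k'" if "a \<noteq> b" "d \<noteq> e" using assms(1-6) that by (auto split: if_splits)
  have one: "4 \<le> k'" if "(a \<noteq> b) \<noteq> (d \<noteq> e)"
    using assms(1,2,4,5) that by (cases a; cases b) auto
  have zero: "4 \<le> k'" if "a = b" "d = e" using assms(1,2,3,7,8,9) that by (cases a; cases d) auto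
  show ?thesis using zero one two by blast
qed

section \<open>Splitting off a vertex of degree four\<close>

locale degree_four_vertex =
  fixes A m v a b d e
  assumes fec: "four_edge_connected A m" and v: "v \<in> A" "A \<noteq> {v}"
    and darts_v: "darts {v} = {a, b, d, e}" and dist: "distinct [a, b, d, e]"
begin

abbreviation "B \<equiv> A - {v}"
abbreviation "m' \<equiv> split_off m a b d e"

lemma graph: "dart_graph A m"
  using fec by (simp add: four_edge_connected_def)

lemma dart_v: "z \<in> {a, b, d, e} \<Longrightarrow> owner z = v"
  using darts_v by (metis mem_darts singleton_iff)

lemma mates: "owner (m a) \<in> B" "owner (m b) \<in> B" "owner (m d) \<in> B" "owner (m e) \<in> B"
  using four_edge_connected_no_loop[OF fec v] dart_v by blast+

lemma mate_mates: "m (m a) = a" "m (m b) = b" "m (m d) = d" "m (m e) = e"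
  using mate_mate[OF graph] dart_v v by blast+

lemma mates_distinct: "distinct [m a, m b, m d, m e]"
  using dist mate_mates by (metis distinct_length_2_or_more distinct_singleton)

lemma mates_ne: "m a \<noteq> m b" "m b \<noteq> m a" "m d \<noteq> m e" "m e \<noteq> m d"
  using mates_distinct by simp_all

lemma split_off_mates: "m' (m a) = m b" "m' (m b) = m a" "m' (m d) = m e" "m' (m e) = m d"
  using mates_distinct by (auto simp: split_off_def)

lemma split_off_other: "z \<notin> {m a, m b, m d, m e} \<Longrightarrow> m' z = m z"
  by (auto simp: split_off_def)

lemma other_mate:
  assumes "owner z \<in> B" "z \<notin> {m a, m b, m d, m e}"
  shows "owner (m z) \<in> B" "m z \<notin> {m a, m b, m d, m e}"
proof -
  have z: "owner z \<in> A" "m (m z) = z" "owner (m z) \<in> A"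
    using assms mate_mate[OF graph] mate_vertex[OF graph] by auto
  have "owner (m z) \<noteq> v"
  proof
    assume "owner (m z) = v"
    then have "m z \<in> {a, b, d, e}" using darts_v by (metis mem_darts singleton_iff)
    then have "m (m z) \<in> {m a, m b, m d, m e}" by blast
    then show False using assms z by simp
  qed
  then show "owner (m z) \<in> B" using z by simp
  show "m z \<notin> {m a, m b, m d, m e}"
  proof
    assume "m z \<in> {m a, m b, m d, m e}"
    then have "m (m z) \<in> {m (m a), m (m b), m (m d), m (m e)}" by fastforce
    then have "z \<in> {a, b, d, e}" unfolding z(2) mate_mates .
    then show False using dart_v assms by blast
  qed
qed

lemma dart_graph_split_off: "dart_graph B m'"
  unfolding dart_graph_def
proof (intro conjI ballI)
  show "finite B" using finite_vertices[OF graph] by simp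
  fix z assume "z \<in> darts B"
  then have z: "owner z \<in> B" by simp
  have "owner (m' z) \<in> B \<and> m' (m' z) = z \<and> m' z \<noteq> z"
  proof (cases "z \<in> {m a, m b, m d, m e}")
    case True
    then consider "z = m a" | "z = m b" | "z = m d" | "z = m e" by blast
    then show ?thesis
      by cases (simp_all only: split_off_mates mates mates_ne simp_thms)
  next
    case False
    then show ?thesis
      using z other_mate[OF z False] split_off_other mate_mate[OF graph] mate_ne[OF graph] by simp
  qed
  then show "m' z \<in> darts B" "m' (m' z) = z" "m' z \<noteq> z" by auto
qed

lemma crossing_split_off:
  assumes "S \<subseteq> B"
  shows "crossing B m S \<subseteq> crossing B m' S" and "crossing B m S \<inter> {m a, m b, m d, m e} = {}"
proof -
  show disj: "crossing B m S \<inter> {m a, m b, m d, m e} = {}"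
  proof (rule ccontr)
    assume "\<not> ?thesis"
    then obtain z where "z \<in> {m a, m b, m d, m e}" "owner (m z) \<in> B" by (auto simp: crossing_def)
    then have "m z \<in> {a, b, d, e}" "owner (m z) \<noteq> v" using mate_mates by auto
    then show False using dart_v by blast
  qed
  show "crossing B m S \<subseteq> crossing B m' S"
  proof
    fix z assume z: "z \<in> crossing B m S"
    then have "m' z = m z" using disj by (intro split_off_other) blast
    then show "z \<in> crossing B m' S" using z by (simp add: crossing_def)
  qed
qed

lemma card_neighbours:
  "card {z \<in> darts {v}. m z \<in> darts S} = of_bool (owner (m a) \<in> S) + of_bool (owner (m b) \<in> S) +
     of_bool (owner (m d) \<in> S) + of_bool (owner (m e) \<in> S)"
proof -
  have "card {z \<in> darts {v}. m z \<in> darts S} = (\<Sum>z\<in>darts {v}. of_bool (owner (m z) \<in> S))"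
    by (simp add: sum.If_cases of_bool_def Int_def)
  also have "\<dots> = of_bool (owner (m a) \<in> S) + of_bool (owner (m b) \<in> S) +
     of_bool (owner (m d) \<in> S) + of_bool (owner (m e) \<in> S)"
    unfolding darts_v using dist by simp
  finally show ?thesis .
qed

lemmas crossing_bounds = crossing_delete_vertex_bounds[OF fec v(1), unfolded card_neighbours]

lemma four_edge_connected_split_off:
  assumes adm: "admissible B m a b d e"
  shows "four_edge_connected B m'"
  unfolding four_edge_connected_def
proof (intro conjI allI impI dart_graph_split_off)
  fix S assume "S \<noteq> {} \<and> S \<subset> B"
  then have S: "S \<noteq> {}" "S \<subset> B" by auto
  let ?a = "owner (m a) \<in> S" and ?b = "owner (m b) \<in> S" and ?d = "owner (m d) \<in> S" and ?e = "owner (m e) \<in> S"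
  let ?k = "card (crossing B m S)" and ?k' = "card (crossing B m' S)"
  have fin: "finite (crossing B m' S)"
    by (rule finite_crossing[OF dart_graph_split_off]) (use S in auto)
  \<comment> \<open>The four darts that get new mates do not occur in the old cut, so those of them
    that cross now are counted on top of it.\<close>
  have add: "?k + card Z \<le> ?k'" if "Z \<subseteq> crossing B m' S" "Z \<subseteq> {m a, m b, m d, m e}" for Z
  proof -
    have *: "crossing B m S \<inter> {m a, m b, m d, m e} = {}" "crossing B m S \<subseteq> crossing B m' S"
      using crossing_split_off S by auto
    have "?k + card Z = card (crossing B m S \<union> Z)"
      by (rule card_Un_disjoint[symmetric]) (use that * fin finite_subset in \<open>auto\<close>)
    also have "\<dots> \<le> ?k'" using that * fin by (intro card_mono) auto
    finally show ?thesis .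
  qed
  have le: "?k \<le> ?k'" using add[of "{}"] by simp
  have ab: "?k + 1 \<le> ?k'" if "?a \<noteq> ?b"
    using add[of "{if ?a then m a else m b}"] that mates split_off_mates
    by (auto simp: crossing_def split: if_splits)
  have de: "?k + 1 \<le> ?k'" if "?d \<noteq> ?e"
    using add[of "{if ?d then m d else m e}"] that mates split_off_mates
    by (auto simp: crossing_def split: if_splits)
  have abde: "?k + 2 \<le> ?k'" if "?a \<noteq> ?b" "?d \<noteq> ?e"
  proof -
    let ?Z = "{if ?a then m a else m b, if ?d then m d else m e}"
    have "card ?Z = 2" using mates_distinct by auto
    moreover have "?Z \<subseteq> crossing B m' S"
      using that mates split_off_mates by (auto simp: crossing_def)
    moreover have "?Z \<subseteq> {m a, m b, m d, m e}" by auto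
    ultimately show ?thesis using add[of ?Z] by simp
  qed
  have even: "even ?k'" by (rule even_crossing[OF dart_graph_split_off]) (use S in auto)
  have three: "4 \<le> ?k'" if "3 \<le> ?k"
    using that even le even_ge_3[of ?k'] by simp
  have "3 \<le> ?k" if "?a" "?b" "\<not> ?d" "\<not> ?e"
    using adm that S by (auto simp: admissible_def)
  \<comment> \<open>\<open>admissible\<close> speaks only of the side containing the ends of
    \<open>a\<close> and \<open>b\<close>; the other side is its complement.\<close>
  moreover have "3 \<le> ?k" if "\<not> ?a" "\<not> ?b" "?d" "?e"
  proof -
    have "3 \<le> card (crossing B m (B - S))"
      using adm that mates unfolding admissible_def by (metis Diff_iff Diff_subset)
    then show ?thesis using card_crossing_complement[OF graph, of B S] S by auto
  qed
  ultimately show "4 \<le> ?k'"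
    using split_off_cut_bound[OF crossing_bounds[OF S(2,1)] le ab de abde three] by blast
qed

text \<open>Uncrossing: of the four ends, \<open>S\<close> and \<open>T\<close> have one in their
  intersection and three in their union, so both of these cuts have size at least 3. Submodularity
  then makes \<open>T\<close> large because \<open>S\<close> is small. Hence a cut of size 2 that
  pairs \<open>a\<close> with \<open>d\<close> rules out small cuts for the other pairings, and at
  most one pairing is inadmissible.\<close>

lemma admissible_of_cut:
  assumes S: "S \<subseteq> B" "card (crossing B m S) \<le> 2"
    and side: "owner (m a) \<in> S" "owner (m d) \<in> S" "owner (m b) \<notin> S" "owner (m e) \<notin> S"
  shows "admissible B m a b d e"
  unfolding admissible_def
proof (intro allI impI)
  fix T assume T: "T \<subseteq> B"
    and sideT: "owner (m a) \<in> T \<and> owner (m b) \<in> T \<and> owner (m d) \<notin> T \<and> owner (m e) \<notin> T"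
  have "card (crossing B m (S \<inter> T)) + card (crossing B m (S \<union> T))
      \<le> card (crossing B m S) + card (crossing B m T)"
    by (rule crossing_submodular[OF graph]) (use S T in auto)
  moreover have "S \<inter> T \<subset> B" "S \<inter> T \<noteq> {}" "S \<union> T \<subset> B" "S \<union> T \<noteq> {}"
    using S T side sideT mates by auto
  then have "3 \<le> card (crossing B m (S \<inter> T))" "3 \<le> card (crossing B m (S \<union> T))"
    using crossing_bounds(1)[of "S \<inter> T"] crossing_bounds(2)[of "S \<union> T"] side sideT by simp_all
  ultimately show "3 \<le> card (crossing B m T)" using S by linarith
qed

end

section \<open>Selecting edges of a split graph\<close>

text \<open>The edge at dart \<open>0\<close> is the root edge: it is never selected and its cost does not count. Costs
  may be negative, and every edge is counted twice, once for each of its darts.\<close>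

definition selection :: "nat set \<Rightarrow> (nat \<Rightarrow> nat) \<Rightarrow> (nat \<Rightarrow> real) \<Rightarrow> nat set \<Rightarrow> bool" where
  "selection A m c X \<longleftrightarrow> X \<subseteq> darts A \<and> (\<forall>z\<in>X. m z \<in> X) \<and> 0 \<notin> X \<and> m 0 \<notin> X \<and>
     (\<forall>S. S \<noteq> {} \<and> S \<subset> A \<longrightarrow> 2 \<le> card (crossing A m S \<inter> X)) \<and>
     sum c X \<le> 2 / 3 * sum c (darts A - {0, m 0})"

definition symmetric_cost :: "nat set \<Rightarrow> (nat \<Rightarrow> nat) \<Rightarrow> (nat \<Rightarrow> real) \<Rightarrow> bool" where
  "symmetric_cost A m c \<longleftrightarrow> (\<forall>z\<in>darts A - {0, m 0}. c (m z) = c z)"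

text \<open>The removed vertex is put back either in the middle of the selected edge at \<open>d'\<close>, or with the two
  edges at \<open>b\<close> and \<open>d\<close>. With cost \<open>c e - c b\<close> for the new edge, the cost grows by \<open>c b + c d\<close> in
  both cases.\<close>

definition lift_selection :: "nat \<Rightarrow> nat \<Rightarrow> nat \<Rightarrow> nat \<Rightarrow> nat \<Rightarrow> nat set \<Rightarrow> nat set" where
  "lift_selection b d e b' d' X = (if d' \<in> X then X \<union> {d, e} else X \<union> {b, b', d, d'})"

lemma card_crossing_Int_complement:
  assumes graph: "dart_graph A m" and S: "S \<subseteq> A" and X: "X \<subseteq> darts A" "\<And>z. z \<in> X \<Longrightarrow> m z \<in> X"
  shows "card (crossing A m (A - S) \<inter> X) = card (crossing A m S \<inter> X)"
proof (rule bij_betw_same_card)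
  have mm: "m (m z) = z" if "z \<in> X" for z using mate_mate[OF graph] X that by auto
  show "bij_betw m (crossing A m (A - S) \<inter> X) (crossing A m S \<inter> X)"
    by (rule bij_betw_byWitness[where f' = m])
      (use S X mm in \<open>auto simp: crossing_def double_diff subset_iff\<close>)
qed

context degree_four_vertex
begin

context
  fixes c :: "nat \<Rightarrow> real"
  assumes root: "m a = 0" and sym: "symmetric_cost A m c"
begin

abbreviation "c' \<equiv> c(m d := c e - c b, m e := c e - c b)"

lemma root_mates: "m 0 = a" "m' 0 = m b"
  using mate_mates(1) split_off_mates(1) root by simp_all

lemma dart_v_not_B: "z \<in> {a, b, d, e} \<Longrightarrow> z \<notin> darts B"
  using dart_v by simp

lemma cost_mates: "c (m b) = c b" "c (m d) = c d" "c (m e) = c e"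
proof -
  have "c (m z) = c z" if "z \<in> {b, d, e}" for z
  proof -
    have "owner z = v" using dart_v that by blast
    moreover have "z \<noteq> a" using that dist by auto
    moreover have "z \<noteq> 0" using mates(1) root \<open>owner z = v\<close> by (metis DiffD2 singletonI)
    ultimately show ?thesis using sym v unfolding symmetric_cost_def root_mates by simp
  qed
  then show "c (m b) = c b" "c (m d) = c d" "c (m e) = c e" by simp_all
qed

lemma symmetric_cost_split_off: "symmetric_cost B m' c'"
  unfolding symmetric_cost_def
proof
  fix z assume z: "z \<in> darts B - {0, m' 0}"
  show "c' (m' z) = c' z"
  proof (cases "z \<in> {m a, m b, m d, m e}")
    case True
    then have "z = m d \<or> z = m e" using z root root_mates by auto
    then show ?thesis using split_off_mates mates_ne by auto
  next
    case False
    then have "m z \<notin> {m a, m b, m d, m e}" using other_mate(2) z by auto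
    moreover have "c (m z) = c z"
    proof -
      have "z \<noteq> a" using z dart_v by auto
      then show ?thesis using sym z unfolding symmetric_cost_def root_mates by simp
    qed
    ultimately show ?thesis using split_off_other[OF False] False by simp
  qed
qed

text \<open>A set containing \<open>v\<close> is replaced by its complement. For a set
  \<open>S\<close> without \<open>v\<close>, the old cut survives: if the new edge at
  \<open>m d\<close> was selected and crosses, its half on the side of \<open>S\<close> now leads to
  \<open>v\<close>, which is outside. Only the cut around \<open>v\<close> has no counterpart in the
  smaller graph.\<close>

lemma selection_lift:
  assumes X: "selection B m' c' X" and cost: "c d \<le> c b"
  shows "selection A m c (lift_selection b d e (m b) (m d) X)"
proof -
  define Y where "Y = lift_selection b d e (m b) (m d) X"
  note Y = Y_def[unfolded lift_selection_def]
  have XB: "X \<subseteq> darts B" and Xm: "\<And>z. z \<in> X \<Longrightarrow> m' z \<in> X" and X0: "m a \<notin> X" "m b \<notin> X"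
    and Xcut: "\<And>S. S \<noteq> {} \<Longrightarrow> S \<subset> B \<Longrightarrow> 2 \<le> card (crossing B m' S \<inter> X)"
    and Xcost: "sum c' X \<le> 2 / 3 * sum c' (darts B - {m a, m b})"
    using X unfolding selection_def root_mates root by auto
  have fin: "finite (darts A)" using finite_vertices[OF graph] by simp
  have mB: "m a \<in> darts B" "m b \<in> darts B" "m d \<in> darts B" "m e \<in> darts B"
    using mates by auto
  have notB: "a \<notin> darts B" "b \<notin> darts B" "d \<notin> darts B" "e \<notin> darts B"
    using dart_v_not_B by auto
  have vA: "{a, b, d, e} \<subseteq> darts A" using dart_v v by auto
  have BA: "darts B \<subseteq> darts A" by auto
  have notX: "a \<notin> X" "b \<notin> X" "d \<notin> X" "e \<notin> X" using notB XB by auto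
  have neq: "a \<noteq> b" "a \<noteq> d" "a \<noteq> e" "b \<noteq> d" "b \<noteq> e" "d \<noteq> e" using dist by auto
  have mneq: "m a \<noteq> m b" "m a \<noteq> m d" "m a \<noteq> m e" "m b \<noteq> m d" "m b \<noteq> m e" "m d \<noteq> m e"
    using mates_distinct by auto
  have mix: "z \<noteq> m w" if "z \<in> {a, b, d, e}" "w \<in> {a, b, d, e}" for z w
    using that mB notB by auto
  have mix': "b \<noteq> m b" "b \<noteq> m d" "b \<noteq> m e" "d \<noteq> m b" "d \<noteq> m d" "d \<noteq> m e" "e \<noteq> m b" "e \<noteq> m d" "e \<noteq> m e"
    by (rule mix; simp)+
  have de: "m d \<in> X \<longleftrightarrow> m e \<in> X" using Xm split_off_mates by metis
  have YA: "Y \<subseteq> darts A" unfolding Y using XB BA vA mB by auto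
  have XY: "X \<subseteq> Y" unfolding Y by auto
  have Ym: "m z \<in> Y" if "z \<in> Y" for z
  proof (cases "z \<in> X")
    case True
    show ?thesis
    proof (cases "z \<in> {m a, m b, m d, m e}")
      case True
      with \<open>z \<in> X\<close> X0 have "z = m d \<or> z = m e" by auto
      then have "m d \<in> X" "m z \<in> {d, e}" using \<open>z \<in> X\<close> de mate_mates by auto
      then show ?thesis unfolding Y by auto
    next
      case False
      then have "m z \<in> X" using Xm[OF \<open>z \<in> X\<close>] split_off_other[OF False] by simp
      then show ?thesis using XY by auto
    qed
  next
    case False
    then show ?thesis using that de mate_mates unfolding Y by (auto split: if_splits)
  qed
  have "m a \<notin> Y"
    unfolding Y using X0 mneq mix[of b a] mix[of d a] mix[of e a] by auto
  moreover have "a \<notin> Y"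
    unfolding Y using notX neq mix[of a b] mix[of a d] by auto
  ultimately have Y0: "0 \<notin> Y" "m 0 \<notin> Y" unfolding root_mates root by auto
  have low: "2 \<le> card (crossing A m S \<inter> Y)" if S: "S \<subseteq> B" "S \<noteq> {}" for S
  proof -
    have fS: "finite (crossing A m S \<inter> Y)"
      using finite_crossing[OF graph, of S A] S by auto
    have at_v: "z \<in> crossing A m S" if "z \<in> {m a, m b, m d, m e}" "z \<in> darts S" for z
    proof -
      have "m z \<in> {a, b, d, e}" using that(1) mate_mates by auto
      then have "owner (m z) = v" using dart_v by blast
      then show ?thesis using that(2) S v by (auto simp: crossing_def)
    qed
    show ?thesis
    proof (cases "S = B")
      case True
      \<comment> \<open>The cut around \<open>v\<close> is crossed by the edge at \<open>d\<close>
        in both cases, and in addition by the one at \<open>e\<close> or the one at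
        \<open>b\<close>.\<close>
      let ?Z = "{m d, if m d \<in> X then m e else m b}"
      have "?Z \<subseteq> crossing A m S" using at_v mB True by auto
      moreover have "?Z \<subseteq> Y" using de unfolding Y by auto
      moreover have "card ?Z = 2" using mneq by auto
      ultimately show ?thesis using card_mono[OF fS, of ?Z] by auto
    next
      case False
      then have "2 \<le> card (crossing B m' S \<inter> X)" using Xcut S by auto
      moreover have "crossing B m' S \<inter> X \<subseteq> crossing A m S \<inter> Y"
      proof
        fix z assume z: "z \<in> crossing B m' S \<inter> X"
        have "z \<in> crossing A m S"
        proof (cases "z \<in> {m a, m b, m d, m e}")
          case True
          then show ?thesis using at_v z by (auto simp: crossing_def)
        next
          case False
          then show ?thesis using z split_off_other[OF False] by (auto simp: crossing_def)
        qed
        then show "z \<in> crossing A m S \<inter> Y" using z XY by auto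
      qed
      ultimately show ?thesis using card_mono[OF fS] le_trans by blast
    qed
  qed
  have cut: "2 \<le> card (crossing A m S \<inter> Y)" if S: "S \<noteq> {}" "S \<subset> A" for S
  proof (cases "v \<in> S")
    case True
    have "2 \<le> card (crossing A m (A - S) \<inter> Y)" using True S by (intro low) auto
    then show ?thesis using card_crossing_Int_complement[OF graph _ YA Ym, of S] S by auto
  next
    case False
    then show ?thesis using low S by auto
  qed
  have finX: "finite X" using finite_subset[OF XB] finite_subset[OF BA fin] by auto
  define R where "R = darts B - {m a, m b, m d, m e}"
  have finR: "finite R" unfolding R_def using finite_subset[OF BA fin] by auto
  have RA: "sum c (darts A - {m a, a}) = sum c R + 2 * (c b + c d + c e)"
  proof -
    have "darts A = darts B \<union> {a, b, d, e}" using darts_v v by (auto simp: darts_def)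
    then have "darts A - {m a, a} = R \<union> {m b, m d, m e, b, d, e}"
      unfolding R_def using mB notB mneq neq by auto
    moreover have "sum c (R \<union> {m b, m d, m e, b, d, e}) = sum c R + sum c {m b, m d, m e, b, d, e}"
      by (rule sum.union_disjoint) (use finR notB in \<open>auto simp: R_def\<close>)
    moreover have "sum c {m b, m d, m e, b, d, e} = 2 * (c b + c d + c e)"
      using mneq neq mix' cost_mates by simp
    ultimately show ?thesis by simp
  qed
  have RB: "sum c' (darts B - {m a, m b}) = sum c R + 2 * (c e - c b)"
  proof -
    have "darts B - {m a, m b} = R \<union> {m d, m e}" unfolding R_def using mB mneq by auto
    moreover have "sum c' (R \<union> {m d, m e}) = sum c' R + sum c' {m d, m e}"
      by (rule sum.union_disjoint) (use finR in \<open>auto simp: R_def\<close>)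
    moreover have "sum c' R = sum c R" by (rule sum.cong) (auto simp: R_def)
    moreover have "sum c' {m d, m e} = 2 * (c e - c b)" using mneq by auto
    ultimately show ?thesis by simp
  qed
  have "sum c Y = sum c' X + 2 * (c b + c d)"
  proof (cases "m d \<in> X")
    case True
    define X' where "X' = X - {m d, m e}"
    have X': "X = X' \<union> {m d, m e}" "X' \<inter> {m d, m e} = {}" "finite X'"
      using True de finX by (auto simp: X'_def)
    have "sum c' X = sum c' X' + sum c' {m d, m e}" using X' sum.union_disjoint by (metis finite.intros finite_Un finX)
    moreover have "sum c' X' = sum c X'" by (rule sum.cong) (auto simp: X'_def)
    moreover have "sum c' {m d, m e} = 2 * (c e - c b)" using mneq by auto
    moreover have "sum c X = sum c X' + sum c {m d, m e}" using X' sum.union_disjoint by (metis finite.intros finite_Un finX)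
    moreover have "sum c {m d, m e} = c d + c e" using mneq cost_mates by auto
    moreover have "sum c Y = sum c X + sum c {d, e}"
      unfolding Y using True finX notX neq by simp
    moreover have "sum c {d, e} = c d + c e" using neq by simp
    ultimately show ?thesis by simp
  next
    case False
    have "sum c Y = sum c X + sum c {b, m b, d, m d}"
      unfolding Y using False finX notX X0 neq mneq mix' by simp
    moreover have "sum c {b, m b, d, m d} = 2 * (c b + c d)"
      using mneq neq mix' cost_mates by simp
    moreover have "sum c' X = sum c X" by (rule sum.cong) (use False de in auto)
    ultimately show ?thesis by simp
  qed
  \<comment> \<open>With every edge counted twice, the left side grows by
    \<open>2 * (c b + c d)\<close> and the right side by \<open>4 / 3 * (2 * c b + c d)\<close>;
    \<open>cost\<close> says that the latter is no smaller.\<close>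
  then have "sum c Y \<le> 2 / 3 * sum c (darts A - {m a, a})"
    using Xcost cost unfolding RA RB by simp
  then show ?thesis
    using YA Ym Y0 cut unfolding selection_def Y_def[symmetric] root_mates root by auto
qed

end

end

section \<open>Unit flows\<close>

text \<open>A function \<open>F\<close> on darts with values in \<open>{0, 1, 2}\<close> encodes the unit flow that sends \<open>F z - 1\<close>
  units along the dart \<open>z\<close>.\<close>

definition flow :: "nat set \<Rightarrow> (nat \<Rightarrow> nat) \<Rightarrow> nat \<Rightarrow> nat \<Rightarrow> int \<Rightarrow> (nat \<Rightarrow> nat) \<Rightarrow> bool" where
  "flow A m v t k F \<longleftrightarrow>
     (\<forall>z\<in>darts A. F z + F (m z) = 2 \<and> (owner (m z) = v \<longrightarrow> F z = 1)) \<and>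
     (\<forall>u\<in>A - {v}. (\<Sum>z\<in>darts {u}. int (F z) - 1) = k * (of_bool (u = 0) - of_bool (u = t)))"

text \<open>Sum the net outflow over the vertices of \<open>S\<close>. Edges inside \<open>S\<close>
  cancel by antisymmetry, edges to \<open>v\<close> carry nothing, and by conservation only the
  source contributes.\<close>

lemma flow_cut:
  assumes graph: "dart_graph A m" and flow: "flow A m v t k F"
    and S: "S \<subseteq> A - {v}" "0 \<in> S" "t \<notin> S"
  shows "k = (\<Sum>z\<in>crossing (A - {v}) m S. int (F z) - 1)"
proof -
  let ?g = "\<lambda>z. int (F z) - 1"
  let ?I = "{z \<in> darts S. m z \<in> darts S}" and ?V = "{z \<in> darts S. m z \<in> darts {v}}"
    and ?C = "crossing (A - {v}) m S"
  have finS: "finite S" using S finite_vertices[OF graph] finite_subset by blast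
  then have fin: "finite (darts S)" by simp
  have sum2: "F z + F (m z) = 2" "owner (m z) = v \<Longrightarrow> F z = 1" if "owner z \<in> A" for z
    using flow that by (auto simp: flow_def)
  have "darts S = ?I \<union> ?V \<union> ?C" using S mate_vertex[OF graph] by (auto simp: crossing_def)
  moreover have "finite ?I" "finite ?V" "finite ?C"
    using fin by (auto simp: crossing_def intro: finite_subset[OF _ fin])
  moreover have "?I \<inter> ?V = {}" "(?I \<union> ?V) \<inter> ?C = {}" using S by (auto simp: crossing_def)
  ultimately have "sum ?g (darts S) = sum ?g ?I + sum ?g ?V + sum ?g ?C"
    by (metis (no_types, lifting) sum.union_disjoint finite_UnI)
  moreover have "sum ?g ?I = 0"
  proof (rule sum_antisymmetric_involution[where m = m])
    fix z assume z: "z \<in> ?I"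
    then have "owner z \<in> A" using S by auto
    then show "m z \<in> ?I \<and> m (m z) = z \<and> ?g (m z) = - ?g z"
      using z sum2(1)[of z] mate_mate[OF graph, of z] by auto
  qed
  moreover have "sum ?g ?V = 0"
    by (rule sum.neutral) (use S sum2(2) in auto)
  moreover have "sum ?g (darts S) = k"
  proof -
    have "sum ?g (darts S) = (\<Sum>u\<in>S. k * (of_bool (u = 0) - of_bool (u = t)))"
      unfolding sum_darts[OF finS]
    proof (rule sum.cong)
      fix u assume "u \<in> S"
      then have "u \<in> A - {v}" using S by auto
      then show "sum ?g (darts {u}) = k * (of_bool (u = 0) - of_bool (u = t))"
        using flow unfolding flow_def by blast
    qed simp
    also have "\<dots> = (\<Sum>u\<in>S. if u = 0 then k else 0)"
      by (rule sum.cong) (use S in auto)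
    also have "\<dots> = k" using finS S by simp
    finally show ?thesis .
  qed
  ultimately show ?thesis by simp
qed

lemma flow_le_cut:
  assumes graph: "dart_graph A m" and flow: "flow A m v t k F"
    and S: "S \<subseteq> A - {v}" "0 \<in> S" "t \<notin> S"
  shows "k \<le> int (card (crossing (A - {v}) m S))"
proof -
  have "k = (\<Sum>z\<in>crossing (A - {v}) m S. int (F z) - 1)" by (rule flow_cut[OF assms])
  also have "\<dots> \<le> (\<Sum>z\<in>crossing (A - {v}) m S. 1)"
  proof (rule sum_mono)
    fix z assume "z \<in> crossing (A - {v}) m S"
    then have "F z + F (m z) = 2" using flow S by (auto simp: flow_def crossing_def)
    then show "int (F z) - 1 \<le> 1" by simp
  qed
  finally show ?thesis by simp
qed

lemma saturated_cut_eq_flow: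
  assumes graph: "dart_graph A m" and flow: "flow A m v t k F"
    and S: "S \<subseteq> A - {v}" "0 \<in> S" "t \<notin> S"
    and sat: "\<And>z. z \<in> crossing (A - {v}) m S \<Longrightarrow> 2 \<le> F z"
  shows "int (card (crossing (A - {v}) m S)) = k"
proof -
  have "k = (\<Sum>z\<in>crossing (A - {v}) m S. int (F z) - 1)" by (rule flow_cut[OF graph flow S])
  also have "\<dots> = (\<Sum>z\<in>crossing (A - {v}) m S. 1)"
  proof (rule sum.cong)
    fix z assume z: "z \<in> crossing (A - {v}) m S"
    then have "F z + F (m z) = 2" using flow S by (auto simp: flow_def crossing_def)
    then show "int (F z) - 1 = 1" using sat[OF z] by simp
  qed simp
  finally show ?thesis by simp
qed

text \<open>The flow obtained from a flow of value \<open>k\<close> by sending one more unit from \<open>w\<close> to \<open>t\<close>.\<close>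

definition partial_flow :: "nat set \<Rightarrow> (nat \<Rightarrow> nat) \<Rightarrow> nat \<Rightarrow> nat \<Rightarrow> int \<Rightarrow> nat \<Rightarrow> (nat \<Rightarrow> nat) \<Rightarrow> bool" where
  "partial_flow A m v t k w F \<longleftrightarrow>
     (\<forall>z\<in>darts A. F z + F (m z) = 2 \<and> (owner (m z) = v \<longrightarrow> F z = 1)) \<and>
     (\<forall>u\<in>A - {v}. (\<Sum>z\<in>darts {u}. int (F z) - 1) =
        k * (of_bool (u = 0) - of_bool (u = t)) + (of_bool (u = w) - of_bool (u = t)))"

lemma partial_flow_start: "flow A m v t k F \<Longrightarrow> partial_flow A m v t k t F"
  by (simp add: flow_def partial_flow_def)

lemma partial_flow_finish: "partial_flow A m v t k 0 F \<Longrightarrow> flow A m v t (k + 1) F"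
  by (simp add: flow_def partial_flow_def algebra_simps)

lemma flow_zero: "flow A m v t 0 (\<lambda>_. 1)"
  by (simp add: flow_def)

lemma flow_cong:
  assumes graph: "dart_graph A m" and "\<And>z. z \<in> darts A \<Longrightarrow> F z = F' z"
  shows "flow A m v t k F \<longleftrightarrow> flow A m v t k F'"
proof -
  have "(\<Sum>z\<in>darts {u}. int (F z) - 1) = (\<Sum>z\<in>darts {u}. int (F' z) - 1)" if "u \<in> A" for u
    by (rule sum.cong) (use assms that in auto)
  moreover have "F z = F' z" "F (m z) = F' (m z)" if "z \<in> darts A" for z
    using assms mate_vertex[OF graph] that by auto
  ultimately show ?thesis unfolding flow_def by auto
qed

text \<open>One more unit along \<open>z\<close> settles the balance at \<open>w\<close> and leaves
  it missing at the tail of \<open>z\<close>. This permits augmentation backwards along parent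
  darts, without knowing the whole path.\<close>

lemma partial_flow_step:
  assumes graph: "dart_graph A m" and pf: "partial_flow A m v t k w F"
    and z: "owner z \<in> A - {v}" "owner (m z) = w" "w \<in> A - {v}" "F z < 2"
  shows "partial_flow A m v t k (owner z) (F(z := F z + 1, m z := F (m z) - 1))"
proof -
  let ?F = "F(z := F z + 1, m z := F (m z) - 1)"
  have zA: "owner z \<in> A" "owner (m z) \<in> A" using z by auto
  have ne: "m z \<noteq> z" using mate_ne[OF graph zA(1)] .
  have mm: "m (m z) = z" using mate_mate[OF graph zA(1)] .
  have F2: "F y + F (m y) = 2" if "y \<in> darts A" for y using pf that by (auto simp: partial_flow_def)
  have Fz: "F z + F (m z) = 2" using F2 zA by simp
  have 1: "?F y + ?F (m y) = 2 \<and> (owner (m y) = v \<longrightarrow> ?F y = 1)" if y: "y \<in> darts A" for y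
  proof (cases "y = z \<or> y = m z")
    case True
    then show ?thesis using ne mm Fz z by auto
  next
    case False
    have "m y \<noteq> z \<and> m y \<noteq> m z" using False mate_mate[OF graph, of y] y mm by auto
    then show ?thesis using False pf y by (auto simp: partial_flow_def)
  qed
  have 2: "(\<Sum>y\<in>darts {u}. int (?F y) - 1) =
     (\<Sum>y\<in>darts {u}. int (F y) - 1) + (of_bool (u = owner z) - of_bool (u = w))" for u
  proof -
    \<comment> \<open>As \<open>F z < 2\<close>, the mate has a positive value, so the truncated
      subtraction is exact.\<close>
    have "int (?F y) - 1 = (int (F y) - 1) + ((if y = z then 1 else 0) - (if y = m z then 1 else 0))" for y
      using ne Fz z(4) by auto
    then have "(\<Sum>y\<in>darts {u}. int (?F y) - 1) = (\<Sum>y\<in>darts {u}. int (F y) - 1) +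
       ((\<Sum>y\<in>darts {u}. if y = z then 1 else 0) - (\<Sum>y\<in>darts {u}. if y = m z then 1 else 0))"
      by (simp add: sum.distrib sum_subtractf)
    also have "(\<Sum>y\<in>darts {u}. if y = z then 1 else 0) = (of_bool (u = owner z) :: int)" by auto
    also have "(\<Sum>y\<in>darts {u}. if y = m z then 1 else 0) = (of_bool (u = w) :: int)" using z(2) by auto
    finally show ?thesis .
  qed
  show ?thesis unfolding partial_flow_def 2 using 1 pf by (auto simp: partial_flow_def)
qed

text \<open>The vertices \<open>q 0, \<dots>, q (l - 1)\<close> have been found, in this order, by a search from \<open>0\<close> along
  unsaturated darts of the graph without \<open>v\<close>; \<open>par u\<close> is the dart through which \<open>u\<close> was entered.\<close>

definition search_tree :: "nat set \<Rightarrow> (nat \<Rightarrow> nat) \<Rightarrow> nat \<Rightarrow> (nat \<Rightarrow> nat) \<Rightarrow> nat \<Rightarrow> (nat \<Rightarrow> nat) \<Rightarrow>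
    (nat \<Rightarrow> nat) \<Rightarrow> (nat \<Rightarrow> nat) \<Rightarrow> nat \<Rightarrow> bool" where
  "search_tree A m v F st mark par q l \<longleftrightarrow>
     0 < l \<and> q 0 = 0 \<and> inj_on q {..<l} \<and> q ` {..<l} \<subseteq> A - {v} \<and>
     (\<forall>u\<in>A. mark u = st \<longleftrightarrow> u = v \<or> u \<in> q ` {..<l}) \<and> (\<forall>u. mark u \<le> st) \<and>
     (\<forall>i. 0 < i \<and> i < l \<longrightarrow> owner (m (par (q i))) = q i \<and> F (par (q i)) < 2 \<and>
        (\<exists>i'<i. owner (par (q i)) = q i'))"

text \<open>Marking \<open>v\<close> keeps the search from entering it, which amounts to deleting
  \<open>v\<close>. Marks below \<open>st\<close> are left over from earlier searches and count as
  absent.\<close>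

lemma search_tree_start:
  assumes "0 \<in> A" "v \<noteq> 0" "\<And>u. mark u < st"
  shows "search_tree A m v F st (mark(v := st, 0 := st)) par (q(0 := 0)) (Suc 0)"
  unfolding search_tree_def using assms by (auto simp: less_imp_le less_imp_neq inj_on_def)

lemma search_tree_extend:
  assumes graph: "dart_graph A m" and tree: "search_tree A m v F st mark par q l"
    and v: "v \<in> A" and z: "owner z = q i" "i < l" "F z < 2" "owner (m z) = w" "mark w < st"
  shows "search_tree A m v F st (mark(w := st)) (par(w := z)) (q(l := w)) (Suc l)"
proof -
  have q: "0 < l" "q 0 = 0" "inj_on q {..<l}" "q ` {..<l} \<subseteq> A - {v}"
    and mark: "\<And>u. u \<in> A \<Longrightarrow> mark u = st \<longleftrightarrow> u = v \<or> u \<in> q ` {..<l}" "\<And>u. mark u \<le> st"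
    and par: "\<And>i. 0 < i \<Longrightarrow> i < l \<Longrightarrow> owner (m (par (q i))) = q i \<and> F (par (q i)) < 2 \<and>
        (\<exists>i'<i. owner (par (q i)) = q i')"
    using tree unfolding search_tree_def by auto
  have "owner z \<in> A" using q z by auto
  then have wA: "w \<in> A" using mate_vertex[OF graph] z by auto
  then have w: "w \<noteq> v" "w \<notin> q ` {..<l}" using mark(1)[OF wA] z by auto
  have qn: "q j \<noteq> w" if "j < l" for j using w that by auto
  have im: "(q(l := w)) ` {..<Suc l} = insert w (q ` {..<l})"
    by (auto simp: lessThan_Suc)
  have inj: "inj_on (q(l := w)) {..<Suc l}"
    unfolding lessThan_Suc using q(3) qn by (auto simp: inj_on_def)
  show ?thesis unfolding search_tree_def
  proof (intro conjI)
    show "0 < Suc l" "(q(l := w)) 0 = 0" using q by auto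
    show "inj_on (q(l := w)) {..<Suc l}" by (rule inj)
    show "(q(l := w)) ` {..<Suc l} \<subseteq> A - {v}" unfolding im using q wA w by auto
    show "\<forall>u\<in>A. (mark(w := st)) u = st \<longleftrightarrow> u = v \<or> u \<in> (q(l := w)) ` {..<Suc l}"
      unfolding im using mark by auto
    show "\<forall>u. (mark(w := st)) u \<le> st" using mark by auto
    show "\<forall>i. 0 < i \<and> i < Suc l \<longrightarrow> owner (m ((par(w := z)) ((q(l := w)) i))) = (q(l := w)) i \<and>
      F ((par(w := z)) ((q(l := w)) i)) < 2 \<and> (\<exists>i'<i. owner ((par(w := z)) ((q(l := w)) i)) = (q(l := w)) i')"
    proof (intro allI impI)
      fix j assume j: "0 < j \<and> j < Suc l"
      show "owner (m ((par(w := z)) ((q(l := w)) j))) = (q(l := w)) j \<and>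
        F ((par(w := z)) ((q(l := w)) j)) < 2 \<and> (\<exists>i'<j. owner ((par(w := z)) ((q(l := w)) j)) = (q(l := w)) i')"
      proof (cases "j = l")
        case True
        then show ?thesis using z by (auto intro!: exI[of _ i])
      next
        case False
        then have jl: "j < l" using j by auto
        then obtain i' where "i' < j" "owner (par (q j)) = q i'" using par[of j] j by auto
        then show ?thesis using False jl par[of j] j qn[OF jl] by (auto intro!: exI[of _ i'])
      qed
    qed
  qed
qed

lemma search_tree_length:
  assumes "search_tree A m v F st mark par q l" "finite A"
  shows "l \<le> card A"
proof -
  have "l = card (q ` {..<l})" using assms by (simp add: search_tree_def card_image)
  also have "\<dots> \<le> card A" by (rule card_mono) (use assms in \<open>auto simp: search_tree_def\<close>)
  finally show ?thesis .
qed

text \<open>Augmentation proceeds from \<open>t\<close> back to \<open>0\<close>; \<open>q i\<close> is the vertex reached.\<close>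

definition augmenting where
  "augmenting A m v t k q par i F \<longleftrightarrow>
     partial_flow A m v t k (q i) F \<and> (\<forall>j. 0 < j \<and> j \<le> i \<longrightarrow> F (par (q j)) < 2)"

text \<open>Tree darts entering different vertices are different, so raising
  \<open>par (q i)\<close> does not saturate a tree dart still to come, and lowering its mate only
  frees capacity. The queue index drops strictly and thereby bounds the length of the path.\<close>

lemma augmenting_step:
  assumes graph: "dart_graph A m" and tree: "search_tree A m v F\<^sub>0 st mark par q l"
    and aug: "augmenting A m v t k q par i F" and i: "0 < i" "i < l"
  shows "\<exists>j<i. owner (par (q i)) = q j \<and>
    augmenting A m v t k q par j (F(par (q i) := F (par (q i)) + 1, m (par (q i)) := F (m (par (q i))) - 1))"
proof -
  have q: "inj_on q {..<l}" "\<And>j. j < l \<Longrightarrow> q j \<in> A - {v}"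
    and par: "\<And>i. 0 < i \<Longrightarrow> i < l \<Longrightarrow> owner (m (par (q i))) = q i \<and> (\<exists>i'<i. owner (par (q i)) = q i')"
    using tree unfolding search_tree_def by auto
  let ?z = "par (q i)"
  let ?F = "F(?z := F ?z + 1, m ?z := F (m ?z) - 1)"
  obtain j where j: "j < i" "owner ?z = q j" using par[OF i] by auto
  have "partial_flow A m v t k (owner ?z) ?F"
    by (rule partial_flow_step[OF graph, where w = "q i"]) (use aug j q par[OF i] i in \<open>auto simp: augmenting_def\<close>)
  moreover have "?F (par (q x)) < 2" if x: "0 < x" "x \<le> j" for x
  proof -
    have "q x \<noteq> q i" using inj_onD[OF q(1), of x i] x j i by auto
    then have "par (q x) \<noteq> ?z" using par[of x] par[of i] x i j by (metis le_trans less_imp_le_nat not_le)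
    moreover have "F (par (q x)) < 2" using aug x j by (auto simp: augmenting_def)
    ultimately show ?thesis by auto
  qed
  ultimately have "augmenting A m v t k q par j ?F" unfolding augmenting_def j(2) by blast
  then show ?thesis using j by blast
qed

section \<open>Running programs\<close>

definition runs :: "com \<Rightarrow> state \<Rightarrow> nat \<Rightarrow> (state \<Rightarrow> bool) \<Rightarrow> bool" where
  "runs p s k Q \<longleftrightarrow> (\<exists>t s'. exec p s t s' \<and> t \<le> k \<and> Q s')"

fun nwritten :: "com \<Rightarrow> nat set" where
  "nwritten Skip = {}"
| "nwritten (NWrite a i e) = {a}"
| "nwritten (RWrite a i e) = {}"
| "nwritten (Seq p q) = nwritten p \<union> nwritten q"
| "nwritten (Cond b p q) = nwritten p \<union> nwritten q"
| "nwritten (While b p) = nwritten p"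

fun rwritten :: "com \<Rightarrow> nat set" where
  "rwritten Skip = {}"
| "rwritten (NWrite a i e) = {}"
| "rwritten (RWrite a i e) = {a}"
| "rwritten (Seq p q) = rwritten p \<union> rwritten q"
| "rwritten (Cond b p q) = rwritten p \<union> rwritten q"
| "rwritten (While b p) = rwritten p"

lemma nmem_nwrite [simp]:
  "nmem (nwrite a i k s) b = (if b = a then (nmem s a)(i := k) else nmem s b)"
  by (simp add: nwrite_def)

lemma rmem_nwrite [simp]: "rmem (nwrite a i k s) = rmem s"
  by (simp add: nwrite_def)

lemma rmem_rwrite [simp]:
  "rmem (rwrite a i r s) b = (if b = a then (rmem s a)(i := r) else rmem s b)"
  by (simp add: rwrite_def)

lemma nmem_rwrite [simp]: "nmem (rwrite a i r s) = nmem s"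
  by (simp add: rwrite_def)

lemma exec_frame:
  "exec p s t s' \<Longrightarrow> (\<forall>a. a \<notin> nwritten p \<longrightarrow> nmem s' a = nmem s a) \<and> (\<forall>a. a \<notin> rwritten p \<longrightarrow> rmem s' a = rmem s a)"
  by (induction rule: exec.induct) auto

text \<open>Specifications mention only what changes; everything else is recovered from the
  syntactically determined set of written arrays.\<close>

lemma runs_frame:
  assumes "runs p s k Q"
  shows "runs p s k (\<lambda>s'. Q s' \<and> (\<forall>a. a \<notin> nwritten p \<longrightarrow> nmem s' a = nmem s a) \<and>
    (\<forall>a. a \<notin> rwritten p \<longrightarrow> rmem s' a = rmem s a))"
  using assms exec_frame unfolding runs_def by blast

lemma runs_weaken: "runs p s k Q \<Longrightarrow> k \<le> k' \<Longrightarrow> (\<And>s'. Q s' \<Longrightarrow> Q' s') \<Longrightarrow> runs p s k' Q'"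
  unfolding runs_def using le_trans by blast

lemma runs_Seq: "runs p s k (\<lambda>s'. runs q s' l Q) \<Longrightarrow> runs (Seq p q) s (k + l) Q"
  unfolding runs_def by (meson add_mono exec.Seq)

lemma runs_Cond:
  assumes "bval b s \<Longrightarrow> runs p s k Q" "\<not> bval b s \<Longrightarrow> runs q s k Q"
  shows "runs (Cond b p q) s (k + 1) Q"
  using assms unfolding runs_def by (meson add_le_cancel_right exec.CondTrue exec.CondFalse)

text \<open>\<open>\<mu>\<close> bounds the number of rounds. Each round costs the body and one
  test; the final 1 is the failing test.\<close>

lemma runs_While:
  fixes \<mu> :: "state \<Rightarrow> nat"
  assumes "I s"
    and body: "\<And>s. I s \<Longrightarrow> bval b s \<Longrightarrow> runs p s k (\<lambda>s'. I s' \<and> \<mu> s' < \<mu> s)"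
  shows "runs (While b p) s (\<mu> s * (k + 1) + 1) (\<lambda>s'. I s' \<and> \<not> bval b s')"
  using assms(1)
proof (induction "\<mu> s" arbitrary: s rule: less_induct)
  case less
  show ?case
  proof (cases "bval b s")
    case True
    obtain t s1 where 1: "exec p s t s1" "t \<le> k" "I s1" "\<mu> s1 < \<mu> s"
      using body[OF less.prems True] unfolding runs_def by auto
    obtain t' s2 where 2: "exec (While b p) s1 t' s2" "t' \<le> \<mu> s1 * (k + 1) + 1" "I s2" "\<not> bval b s2"
      using less.hyps[OF 1(4,3)] unfolding runs_def by auto
    have "exec (While b p) s (t + t' + 1) s2" by (rule exec.WhileTrue[OF True 1(1) 2(1)])
    moreover have "(\<mu> s1 + 1) * (k + 1) \<le> \<mu> s * (k + 1)" using 1(4) by (intro mult_right_mono) auto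
    then have "t + t' + 1 \<le> \<mu> s * (k + 1) + 1" using 1(2) 2(2) by (simp add: algebra_simps)
    ultimately show ?thesis using 2 unfolding runs_def by blast
  next
    case False
    then show ?thesis using less.prems exec.WhileFalse[OF False, of p] unfolding runs_def
      by (meson le_add2)
  qed
qed

fun loop_free :: "com \<Rightarrow> bool" where
  "loop_free (Seq p q) \<longleftrightarrow> loop_free p \<and> loop_free q"
| "loop_free (Cond b p q) \<longleftrightarrow> loop_free p \<and> loop_free q"
| "loop_free (While b p) \<longleftrightarrow> False"
| "loop_free _ \<longleftrightarrow> True"

text \<open>Loop-free code is run symbolically by simplification with these equations; the one for
  \<open>While\<close> is a placeholder.\<close>

fun result :: "com \<Rightarrow> state \<Rightarrow> state" where
  "result Skip s = s"
| "result (NWrite a i e) s = nwrite a (nval i s) (nval e s) s"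
| "result (RWrite a i e) s = rwrite a (nval i s) (rval e s) s"
| "result (Seq p q) s = result q (result p s)"
| "result (Cond b p q) s = (if bval b s then result p s else result q s)"
| "result (While b p) s = s"

text \<open>Adding both branches of a conditional instead of taking their maximum affects only
  constant factors.\<close>

fun steps :: "com \<Rightarrow> nat" where
  "steps (Seq p q) = steps p + steps q"
| "steps (Cond b p q) = steps p + steps q + 1"
| "steps _ = 1"

lemma exec_result: "loop_free p \<Longrightarrow> \<exists>t\<le>steps p. exec p s t (result p s)"
proof (induction p arbitrary: s)
  case (Seq p q)
  then obtain t t' where "t \<le> steps p" "exec p s t (result p s)"
    "t' \<le> steps q" "exec q (result p s) t' (result q (result p s))" by (metis loop_free.simps(1))
  then show ?case using exec.Seq by (metis add_mono result.simps(4) steps.simps(1))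
next
  case (Cond b p q)
  obtain t t' where t: "t \<le> steps p" "exec p s t (result p s)" "t' \<le> steps q" "exec q s t' (result q s)"
    using Cond by (metis loop_free.simps(2))
  show ?case
  proof (cases "bval b s")
    case True
    then show ?thesis using t exec.CondTrue[OF True t(2), of q] by (auto intro!: exI[of _ "t + 1"])
  next
    case False
    then show ?thesis using t exec.CondFalse[OF False t(4), of p] by (auto intro!: exI[of _ "t' + 1"])
  qed
next
  case (While b p)
  then show ?case by simp
next
  case Skip
  then show ?case using exec.Skip by (auto intro!: exI[of _ 1])
next
  case (NWrite a i e)
  then show ?case using exec.NWrite by (auto intro!: exI[of _ 1])
next
  case (RWrite a i e)
  then show ?case using exec.RWrite by (auto intro!: exI[of _ 1])
qed

lemma runs_result: "loop_free p \<Longrightarrow> Q (result p s) \<Longrightarrow> runs p s (steps p) Q"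
  using exec_result unfolding runs_def by blast

fun block :: "com list \<Rightarrow> com" where
  "block [] = Skip"
| "block (p # ps) = Seq p (block ps)"

section \<open>The program\<close>

text \<open>Numbers of the arrays of naturals; those named \<open>v\<dots>\<close> are used as scalars (cell 0 only).\<close>

abbreviation (input) "vN \<equiv> 0 :: nat"
abbreviation (input) "aOut \<equiv> 1 :: nat"
abbreviation (input) "aOwn \<equiv> 2 :: nat"
abbreviation (input) "aMate \<equiv> 3 :: nat"
abbreviation (input) "aDeg \<equiv> 4 :: nat"
abbreviation (input) "aFlow \<equiv> 5 :: nat"
abbreviation (input) "aMark \<equiv> 6 :: nat"
abbreviation (input) "aPar \<equiv> 7 :: nat"
abbreviation (input) "aQueue \<equiv> 8 :: nat"
abbreviation (input) "aB \<equiv> 9 :: nat"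
abbreviation (input) "aD \<equiv> 10 :: nat"
abbreviation (input) "aE \<equiv> 11 :: nat"
abbreviation (input) "aB' \<equiv> 12 :: nat"
abbreviation (input) "aD' \<equiv> 13 :: nat"
abbreviation (input) "aSel \<equiv> 14 :: nat"
abbreviation (input) "aPos \<equiv> 15 :: nat"
abbreviation (input) "vI \<equiv> 20 :: nat"
abbreviation (input) "vJ \<equiv> 21 :: nat"
abbreviation (input) "vIdx \<equiv> 22 :: nat"
abbreviation (input) "vK \<equiv> 23 :: nat"
abbreviation (input) "vA0 \<equiv> 24 :: nat"
abbreviation (input) "vA1 \<equiv> 25 :: nat"
abbreviation (input) "vA2 \<equiv> 26 :: nat"
abbreviation (input) "vA3 \<equiv> 27 :: nat"
abbreviation (input) "vV \<equiv> 28 :: nat"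
abbreviation (input) "vT \<equiv> 29 :: nat"
abbreviation (input) "vStamp \<equiv> 30 :: nat"
abbreviation (input) "vHead \<equiv> 31 :: nat"
abbreviation (input) "vTail \<equiv> 32 :: nat"
abbreviation (input) "vU \<equiv> 33 :: nat"
abbreviation (input) "vZ \<equiv> 34 :: nat"
abbreviation (input) "vW \<equiv> 35 :: nat"
abbreviation (input) "vB \<equiv> 36 :: nat"
abbreviation (input) "vD \<equiv> 37 :: nat"
abbreviation (input) "vE \<equiv> 38 :: nat"
abbreviation (input) "vX \<equiv> 39 :: nat"
abbreviation (input) "vY \<equiv> 40 :: nat"
abbreviation (input) "rCost \<equiv> 2 :: nat"

abbreviation var :: "nat \<Rightarrow> nexp" where "var a \<equiv> NRead a (NLit 0)"
abbreviation assign :: "nat \<Rightarrow> nexp \<Rightarrow> com" where "assign a e \<equiv> NWrite a (NLit 0) e"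
abbreviation quad :: "nexp \<Rightarrow> nexp" where "quad e \<equiv> NAdd (NAdd e e) (NAdd e e)"
abbreviation (input) val :: "nat \<Rightarrow> state \<Rightarrow> nat" where "val a s \<equiv> nmem s a 0"

definition scan :: "nat \<Rightarrow> com" where
  "scan k = block [
     assign vZ (NAdd (quad (var vU)) (NLit k)),
     Cond (NLess (NRead aFlow (var vZ)) (NLit 2))
       (block [
          assign vW (NRead aOwn (NRead aMate (var vZ))),
          Cond (NLess (NRead aMark (var vW)) (var vStamp))
            (block [
               NWrite aMark (var vW) (var vStamp),
               NWrite aPar (var vW) (var vZ),
               NWrite aQueue (var vTail) (var vW),
               assign vTail (NAdd (var vTail) (NLit 1))])
            Skip])
       Skip]"

definition search_body :: com where
  "search_body = Seq (Seq (assign vU (NRead aQueue (var vHead))) (assign vHead (NAdd (var vHead) (NLit 1))))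
     (Seq (scan 0) (Seq (scan 1) (Seq (scan 2) (scan 3))))"

text \<open>Raising the stamp invalidates all earlier marks in constant time.\<close>

definition search_init :: com where
  "search_init = block [
     assign vStamp (NAdd (var vStamp) (NLit 1)),
     NWrite aMark (var vV) (var vStamp),
     NWrite aMark (NLit 0) (var vStamp),
     NWrite aQueue (NLit 0) (NLit 0),
     assign vHead (NLit 0),
     assign vTail (NLit 1)]"

definition search :: com where
  "search = Seq search_init (While (NLess (var vHead) (var vTail)) search_body)"

definition augment_body :: com where
  "augment_body = block [
     assign vZ (NRead aPar (var vW)),
     NWrite aFlow (var vZ) (NAdd (NRead aFlow (var vZ)) (NLit 1)),
     NWrite aFlow (NRead aMate (var vZ)) (NSub (NRead aFlow (NRead aMate (var vZ))) (NLit 1)),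
     assign vW (NRead aOwn (var vZ))]"

definition augment :: com where
  "augment = Seq (assign vW (var vT)) (While (NLess (NLit 0) (var vW)) augment_body)"

definition flow_round :: com where
  "flow_round = Seq search (Cond (NLess (NRead aMark (var vT)) (var vStamp)) Skip augment)"

definition reset_body :: com where
  "reset_body = Seq (NWrite aFlow (var vZ) (NLit 1)) (assign vZ (NAdd (var vZ) (NLit 1)))"

definition reset_flow :: com where
  "reset_flow = Seq (assign vZ (NLit 0)) (While (NLess (var vZ) (quad (var vN))) reset_body)"

definition max_flow :: com where
  "max_flow = Seq reset_flow (Seq flow_round (Seq flow_round flow_round))"

lemma quadruple [simp]: "x + x + (x + x) = 4 * (x :: nat)"
  by simp

lemma owner_quad [simp]: "k < 4 \<Longrightarrow> owner (4 * u + k) = u"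
  by (simp add: owner_def)

lemma owner_eq_iff: "owner z = u \<longleftrightarrow> z = 4 * u \<or> z = 4 * u + 1 \<or> z = 4 * u + 2 \<or> z = 4 * u + 3"
  by (auto simp: owner_def)

section \<open>Correctness and running time of the flow computation\<close>

definition round_time :: "nat \<Rightarrow> nat" where
  "round_time n = steps search_init + (n * (steps search_body + 1) + 1) +
     (1 + (n * (steps augment_body + 1) + 1) + 1)"

definition flow_time :: "nat \<Rightarrow> nat" where
  "flow_time n = 1 + (4 * n * (steps reset_body + 1) + 1) + (round_time n + (round_time n + round_time n))"

text \<open>The case \<open>t = 0\<close> is included, since several edges at \<open>v\<close> may
  lead to vertex \<open>0\<close>. Then the balance conditions in \<open>flow\<close> are
  independent of the value, every round succeeds without changing the flow, and the claim about cuts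
  between \<open>0\<close> and \<open>t\<close> is vacuous.\<close>

locale flow_network =
  fixes n A m v t
  assumes graph: "dart_graph A m" and An: "A \<subseteq> {..<n}" and zero: "0 \<in> A" and v: "v \<in> A" "v \<noteq> 0"
    and t: "t \<in> A - {v}"
begin

definition stored :: "state \<Rightarrow> bool" where
  "stored s \<longleftrightarrow> val vN s = n \<and> nmem s aMate = m \<and> (\<forall>z\<in>darts {..<n}. nmem s aOwn z = owner z) \<and>
     val vV s = v \<and> val vT s = t"

definition tree :: "state \<Rightarrow> bool" where
  "tree s \<longleftrightarrow> search_tree A m v (nmem s aFlow) (val vStamp s) (nmem s aMark) (nmem s aPar)
     (nmem s aQueue) (val vTail s)"

definition scanned :: "state \<Rightarrow> nat \<Rightarrow> bool" where
  "scanned s z \<longleftrightarrow> (nmem s aFlow z < 2 \<longrightarrow> nmem s aMark (owner (m z)) = val vStamp s)"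

definition extends :: "state \<Rightarrow> state \<Rightarrow> bool" where
  "extends s s' \<longleftrightarrow> nmem s' aFlow = nmem s aFlow \<and> val vStamp s' = val vStamp s \<and>
     val vHead s' = val vHead s \<and> val vU s' = val vU s \<and> val vTail s \<le> val vTail s' \<and>
     (\<forall>i<val vTail s. nmem s' aQueue i = nmem s aQueue i) \<and>
     (\<forall>u. nmem s aMark u = val vStamp s \<longrightarrow> nmem s' aMark u = val vStamp s)"

lemma extends_trans: "extends s s' \<Longrightarrow> extends s' s'' \<Longrightarrow> extends s s''"
  unfolding extends_def by auto

lemma extends_scanned: "extends s s' \<Longrightarrow> scanned s z \<Longrightarrow> scanned s' z"
  unfolding extends_def scanned_def by auto

lemma stored_own:
  assumes "stored s" "owner z \<in> A"
  shows "nmem s aOwn z = owner z" "nmem s aOwn (m z) = owner (m z)"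
proof -
  have "owner z \<in> {..<n}" "owner (m z) \<in> {..<n}" using assms An mate_vertex[OF graph] by auto
  then show "nmem s aOwn z = owner z" "nmem s aOwn (m z) = owner (m z)"
    using assms unfolding stored_def by (simp_all only: mem_darts Ball_def)
qed

definition scanning :: "state \<Rightarrow> bool" where
  "scanning s \<longleftrightarrow> stored s \<and> tree s \<and> (\<exists>i<val vTail s. val vU s = nmem s aQueue i)"

lemma scan_result:
  assumes s: "scanning s" and k: "k < 4"
  defines "s' \<equiv> result (scan k) s"
  shows "scanning s' \<and> extends s s' \<and> scanned s' (4 * val vU s + k)"
proof -
  let ?z = "4 * val vU s + k"
  let ?w = "owner (m ?z)"
  have st: "stored s" "tree s" using s by (auto simp: scanning_def)
  obtain i where i: "i < val vTail s" "val vU s = nmem s aQueue i" using s by (auto simp: scanning_def)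
  have oz: "owner ?z = nmem s aQueue i" using k i by simp
  have "nmem s aQueue i \<in> A" using st(2) i unfolding tree_def search_tree_def by auto
  then have own: "nmem s aOwn (m ?z) = ?w" using stored_own[OF st(1), of ?z] oz by simp
  have mate: "nmem s aMate = m" using st by (simp add: stored_def)
  consider "\<not> nmem s aFlow ?z < 2" | "nmem s aFlow ?z < 2" "\<not> nmem s aMark ?w < val vStamp s"
    | "nmem s aFlow ?z < 2" "nmem s aMark ?w < val vStamp s" by blast
  then show ?thesis
  proof cases
    case 1
    then have "s' = nwrite vZ 0 ?z s" unfolding s'_def scan_def by simp
    then show ?thesis using s 1 by (auto simp: scanning_def stored_def tree_def extends_def scanned_def)
  next
    case 2
    then have s': "s' = nwrite vW 0 ?w (nwrite vZ 0 ?z s)" unfolding s'_def scan_def using own mate by simp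
    have "nmem s aMark ?w = val vStamp s" using 2 st(2) unfolding tree_def search_tree_def
      by (meson le_neq_implies_less)
    then show ?thesis using s 2 unfolding s' by (auto simp: scanning_def stored_def tree_def extends_def scanned_def)
  next
    case 3
    let ?s = "nwrite vW 0 ?w (nwrite vZ 0 ?z s)"
    have s': "s' = nwrite vTail 0 (Suc (val vTail s)) (nwrite aQueue (val vTail s) ?w
        (nwrite aPar ?w ?z (nwrite aMark ?w (val vStamp s) ?s)))"
      unfolding s'_def scan_def using own mate 3 by simp
    have "search_tree A m v (nmem s aFlow) (val vStamp s) ((nmem s aMark)(?w := val vStamp s))
      ((nmem s aPar)(?w := ?z)) ((nmem s aQueue)(val vTail s := ?w)) (Suc (val vTail s))"
      by (rule search_tree_extend[OF graph st(2)[unfolded tree_def] v(1), where i = i]) (use 3 oz i in auto)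
    then have "tree s'" unfolding s' tree_def by simp
    moreover have "stored s'" using st(1) unfolding s' stored_def by simp
    moreover have "\<exists>i<val vTail s'. val vU s' = nmem s' aQueue i"
      using i unfolding s' by (auto intro!: exI[of _ i])
    moreover have "extends s s'" unfolding s' extends_def by auto
    moreover have "scanned s' ?z" unfolding s' scanned_def by auto
    ultimately show ?thesis unfolding scanning_def by blast
  qed
qed

definition searching :: "state \<Rightarrow> bool" where
  "searching s \<longleftrightarrow> stored s \<and> tree s \<and> val vHead s \<le> val vTail s \<and>
     (\<forall>i<val vHead s. \<forall>z. owner z = nmem s aQueue i \<longrightarrow> scanned s z)"

lemma search_body_result:
  assumes s: "searching s" "val vHead s < val vTail s"
  defines "s' \<equiv> result search_body s"
  shows "searching s' \<and> val vHead s' = Suc (val vHead s) \<and> nmem s' aFlow = nmem s aFlow \<and>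
    val vStamp s' = val vStamp s"
proof -
  let ?u = "nmem s aQueue (val vHead s)"
  define s0 where "s0 = nwrite vHead 0 (Suc (val vHead s)) (nwrite vU 0 ?u s)"
  define s1 where "s1 = result (scan 0) s0"
  define s2 where "s2 = result (scan 1) s1"
  define s3 where "s3 = result (scan 2) s2"
  have s': "s' = result (scan 3) s3"
    unfolding s'_def search_body_def s3_def s2_def s1_def s0_def by simp
  have "stored s0" "tree s0" using s unfolding s0_def searching_def stored_def tree_def by simp_all
  moreover have "\<exists>i<val vTail s0. val vU s0 = nmem s0 aQueue i" using s(2) unfolding s0_def by auto
  ultimately have 0: "scanning s0" unfolding scanning_def by blast
  have 1: "scanning s1" "extends s0 s1" "scanned s1 (4 * val vU s0 + 0)"
    using scan_result[OF 0, of 0] unfolding s1_def by auto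
  have 2: "scanning s2" "extends s1 s2" "scanned s2 (4 * val vU s1 + 1)"
    using scan_result[OF 1(1), of 1] unfolding s2_def by auto
  have 3: "scanning s3" "extends s2 s3" "scanned s3 (4 * val vU s2 + 2)"
    using scan_result[OF 2(1), of 2] unfolding s3_def by auto
  have 4: "scanning s'" "extends s3 s'" "scanned s' (4 * val vU s3 + 3)"
    using scan_result[OF 3(1), of 3] unfolding s' by auto
  have e2: "extends s2 s'" using extends_trans 3 4 by blast
  have e1: "extends s1 s'" using extends_trans 2 e2 by blast
  have e0: "extends s0 s'" using extends_trans 1 e1 by blast
  have u: "val vU s0 = ?u" "val vU s1 = ?u" "val vU s2 = ?u" "val vU s3 = ?u"
    using 1(2) 2(2) 3(2) unfolding extends_def by (auto simp: s0_def)
  have new: "scanned s' z" if "owner z = ?u" for z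
  proof -
    have "scanned s' (4 * ?u + 0)" using extends_scanned[OF e1 1(3)] u by simp
    moreover have "scanned s' (4 * ?u + 1)" using extends_scanned[OF e2 2(3)] u by simp
    moreover have "scanned s' (4 * ?u + 2)" using extends_scanned[OF 4(2) 3(3)] u by simp
    moreover have "scanned s' (4 * ?u + 3)" using 4(3) u by simp
    ultimately show ?thesis using that unfolding owner_eq_iff by auto
  qed
  have old: "scanned s0 z" if "owner z = nmem s aQueue i" "i < val vHead s" for z i
    using s(1) that unfolding searching_def scanned_def s0_def by simp
  have q: "nmem s' aQueue i = nmem s aQueue i" if "i < val vTail s" for i
    using e0 that unfolding extends_def by (simp add: s0_def)
  have hd: "val vHead s' = Suc (val vHead s)" "val vTail s \<le> val vTail s'"
    "nmem s' aFlow = nmem s aFlow" "val vStamp s' = val vStamp s"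
    using e0 unfolding extends_def by (simp_all add: s0_def)
  have "scanned s' z" if "i < val vHead s'" "owner z = nmem s' aQueue i" for i z
  proof (cases "i = val vHead s")
    case True
    then show ?thesis using new that q s(2) by auto
  next
    case False
    then have "i < val vHead s" using that hd by simp
    then show ?thesis using extends_scanned[OF e0] old that(2) q s(2) by auto
  qed
  then have "searching s'" unfolding searching_def
    using 4(1) hd s(2) unfolding scanning_def by auto
  then show ?thesis using hd by auto
qed

definition marked :: "state \<Rightarrow> nat set" where
  "marked s = {u \<in> A - {v}. nmem s aMark u = val vStamp s}"

definition fresh_stamp :: "state \<Rightarrow> bool" where
  "fresh_stamp s \<longleftrightarrow> (\<forall>u. nmem s aMark u \<le> val vStamp s)"

lemma tree_fresh: "tree s \<Longrightarrow> fresh_stamp s"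
  by (simp add: tree_def search_tree_def fresh_stamp_def)

lemma loop_free_scan [simp]: "loop_free (scan k)"
  by (simp add: scan_def)

text \<open>Vertices in the queue are distinct, so at most \<open>n\<close> of them are ever
  scanned, at constant cost each. On exit head and tail agree, hence every marked vertex has been
  scanned.\<close>

lemma runs_search:
  assumes s: "stored s" "fresh_stamp s"
  shows "runs search s (steps search_init + (n * (steps search_body + 1) + 1))
    (\<lambda>s' :: state. stored s' \<and> tree s' \<and> nmem s' aFlow = nmem s aFlow \<and>
       (\<forall>z. owner z \<in> marked s' \<longrightarrow> scanned s' z))"
proof -
  let ?s = "result search_init s"
  let ?I = "\<lambda>s'. searching s' \<and> nmem s' aFlow = nmem s aFlow"
  have val_s: "val vV s = v" using s by (simp add: stored_def)
  have mark: "\<And>u. nmem s aMark u < Suc (val vStamp s)"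
    using s(2) by (auto simp: fresh_stamp_def less_Suc_eq_le)
  have init: "?I ?s" "val vHead ?s = 0"
  proof -
    have "tree ?s" unfolding tree_def search_init_def
      using search_tree_start[OF zero v(2), of "nmem s aMark", OF mark, of m "nmem s aFlow" "nmem s aPar" "nmem s aQueue"]
      by (simp add: val_s)
    moreover have "stored ?s" using s(1) unfolding stored_def search_init_def by simp
    ultimately show "?I ?s" "val vHead ?s = 0"
      unfolding searching_def by (auto simp: search_init_def)
  qed
  have len: "val vTail s' \<le> n" if "tree s'" for s'
  proof -
    have "val vTail s' \<le> card A"
      using search_tree_length[OF _ finite_vertices[OF graph]] that unfolding tree_def by blast
    also have "\<dots> \<le> n" using card_mono[OF _ An] by simp
    finally show ?thesis .
  qed
  have "runs (While (NLess (var vHead) (var vTail)) search_body) ?s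
      ((n - val vHead ?s) * (steps search_body + 1) + 1) (\<lambda>s'. ?I s' \<and> \<not> bval (NLess (var vHead) (var vTail)) s')"
  proof (rule runs_While[where \<mu> = "\<lambda>s. n - val vHead s"])
    show "?I ?s" by (rule init)
    fix s1 assume I: "?I s1" and "bval (NLess (var vHead) (var vTail)) s1"
    then have lt: "val vHead s1 < val vTail s1" by simp
    have r: "searching (result search_body s1)" "val vHead (result search_body s1) = Suc (val vHead s1)"
      "nmem (result search_body s1) aFlow = nmem s aFlow"
      using search_body_result[OF _ lt] I by auto
    have "val vTail s1 \<le> n" using I len by (auto simp: searching_def)
    then show "runs search_body s1 (steps search_body)
      (\<lambda>s'. ?I s' \<and> n - val vHead s' < n - val vHead s1)"
      using lt r by (intro runs_result) (auto simp: search_body_def)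
  qed
  then have loop: "runs (While (NLess (var vHead) (var vTail)) search_body) ?s (n * (steps search_body + 1) + 1)
     (\<lambda>s' :: state. stored s' \<and> tree s' \<and> nmem s' aFlow = nmem s aFlow \<and>
       (\<forall>z. owner z \<in> marked s' \<longrightarrow> scanned s' z))"
  proof (rule runs_weaken)
    fix s' :: state assume I: "?I s' \<and> \<not> bval (NLess (var vHead) (var vTail)) s'"
    then have s': "searching s'" "val vHead s' = val vTail s'" by (auto simp: searching_def)
    have tr: "tree s'" using s' by (simp add: searching_def)
    have "scanned s' z" if "owner z \<in> marked s'" for z
    proof -
      have "owner z \<in> nmem s' aQueue ` {..<val vTail s'}"
        using that tr unfolding marked_def tree_def search_tree_def by auto
      then show ?thesis using s' unfolding searching_def by auto
    qed
    then show "stored s' \<and> tree s' \<and> nmem s' aFlow = nmem s aFlow \<and>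
       (\<forall>z. owner z \<in> marked s' \<longrightarrow> scanned s' z)" using I by (auto simp: searching_def)
  qed (use init(2) in auto)
  show ?thesis unfolding search_def
    by (rule runs_Seq, rule runs_result) (use loop in \<open>simp_all add: search_init_def\<close>)
qed

text \<open>The measure is the queue position of the current vertex, which each step lowers.
  Position 0 holds the source, vertex \<open>0\<close>, where the loop test fails.\<close>

lemma runs_augment:
  assumes s: "stored s" "tree s" "flow A m v t k (nmem s aFlow)" "nmem s aMark t = val vStamp s"
  shows "runs augment s (1 + (n * (steps augment_body + 1) + 1))
    (\<lambda>s' :: state. stored s' \<and> flow A m v t (k + 1) (nmem s' aFlow))"
proof -
  let ?q = "nmem s aQueue" and ?l = "val vTail s" and ?par = "nmem s aPar"
  let ?\<mu> = "\<lambda>s'. inv_into {..<?l} ?q (val vW s')"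
  let ?I = "\<lambda>s'. stored s' \<and> nmem s' aPar = ?par \<and>
     (\<exists>i<?l. val vW s' = ?q i \<and> augmenting A m v t k ?q ?par i (nmem s' aFlow))"
  let ?s = "nwrite vW 0 t s"
  note tr = s(2)[unfolded tree_def]
  have q: "inj_on ?q {..<?l}" "\<And>i. i < ?l \<Longrightarrow> ?q i \<in> A - {v}" "?q 0 = 0" "0 < ?l"
    and F: "\<And>i. 0 < i \<Longrightarrow> i < ?l \<Longrightarrow> nmem s aFlow (?par (?q i)) < 2"
    using tr unfolding search_tree_def by auto
  have inv: "inv_into {..<?l} ?q (?q i) = i" if "i < ?l" for i
    using q(1) that by (simp add: inv_into_f_f)
  obtain i where i: "i < ?l" "t = ?q i"
    using tr s(4) t unfolding search_tree_def by auto
  have "?l \<le> card A" using search_tree_length[OF tr finite_vertices[OF graph]] .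
  also have "\<dots> \<le> n" using card_mono[OF _ An] by simp
  finally have ln: "?l \<le> n" .
  have aug: "augmenting A m v t k ?q ?par i (nmem s aFlow)"
    using partial_flow_start[OF s(3)] F i unfolding augmenting_def by auto
  have "stored ?s" using s(1) by (simp add: stored_def)
  then have I: "?I ?s" using i aug by auto
  have "runs (While (NLess (NLit 0) (var vW)) augment_body) ?s (?\<mu> ?s * (steps augment_body + 1) + 1)
     (\<lambda>s'. ?I s' \<and> \<not> bval (NLess (NLit 0) (var vW)) s')"
  proof (rule runs_While[where \<mu> = ?\<mu>])
    show "?I ?s" by (rule I)
    fix s1 assume "?I s1" and b: "bval (NLess (NLit 0) (var vW)) s1"
    then obtain i where st: "stored s1" "nmem s1 aPar = ?par" and i: "i < ?l" "val vW s1 = ?q i"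
      and aug: "augmenting A m v t k ?q ?par i (nmem s1 aFlow)" by auto
    let ?s1 = "result augment_body s1" and ?F = "nmem s1 aFlow" and ?z = "?par (?q i)"
    have i0: "0 < i" using b i q(3) by (cases i) auto
    obtain j where j: "j < i" "owner ?z = ?q j"
      and augj: "augmenting A m v t k ?q ?par j (?F(?z := ?F ?z + 1, m ?z := ?F (m ?z) - 1))"
      using augmenting_step[OF graph tr aug i0 i(1)] by blast
    have oz: "owner ?z \<in> A" using j i q(2)[of j] by auto
    have mate: "nmem s1 aMate = m" using st by (simp add: stored_def)
    have ne: "m ?z \<noteq> ?z" using mate_ne[OF graph oz] .
    have s1: "?s1 = nwrite vW 0 (owner ?z) (nwrite aFlow (m ?z) (?F (m ?z) - 1)
        (nwrite aFlow ?z (?F ?z + 1) (nwrite vZ 0 ?z s1)))"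
      unfolding augment_body_def using st(2) i(2) mate stored_own[OF st(1) oz] ne by simp
    have "?I ?s1"
    proof (intro conjI exI[of _ j])
      show "stored ?s1" using st(1) unfolding s1 stored_def by simp
      show "nmem ?s1 aPar = ?par" "j < ?l" "val vW ?s1 = ?q j"
        using st(2) j i unfolding s1 by simp_all
      show "augmenting A m v t k ?q ?par j (nmem ?s1 aFlow)" using augj unfolding s1 by simp
    qed
    moreover have "?\<mu> ?s1 < ?\<mu> s1" unfolding i(2) using j i inv unfolding s1 by simp
    ultimately show "runs augment_body s1 (steps augment_body) (\<lambda>s'. ?I s' \<and> ?\<mu> s' < ?\<mu> s1)"
      by (intro runs_result) (auto simp: augment_body_def)
  qed
  then have loop: "runs (While (NLess (NLit 0) (var vW)) augment_body) ?s (n * (steps augment_body + 1) + 1)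
    (\<lambda>s' :: state. stored s' \<and> flow A m v t (k + 1) (nmem s' aFlow))"
  proof (rule runs_weaken)
    have "?\<mu> ?s \<le> n" using inv[OF i(1)] i ln by simp
    then show "?\<mu> ?s * (steps augment_body + 1) + 1 \<le> n * (steps augment_body + 1) + 1"
      by (intro add_mono mult_right_mono) auto
    fix s' :: state assume "?I s' \<and> \<not> bval (NLess (NLit 0) (var vW)) s'"
    then obtain i where "stored s'" "?q i = 0" "augmenting A m v t k ?q ?par i (nmem s' aFlow)" by auto
    then show "stored s' \<and> flow A m v t (k + 1) (nmem s' aFlow)"
      using partial_flow_finish unfolding augmenting_def by metis
  qed
  have vt: "val vT s = t" using s(1) by (simp add: stored_def)
  have "runs (assign vW (var vT)) s (steps (assign vW (var vT))) (\<lambda>s'.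
     runs (While (NLess (NLit 0) (var vW)) augment_body) s' (n * (steps augment_body + 1) + 1)
    (\<lambda>s' :: state. stored s' \<and> flow A m v t (k + 1) (nmem s' aFlow)))"
    by (rule runs_result) (use loop vt in simp_all)
  then show ?thesis unfolding augment_def by (intro runs_Seq) simp
qed

lemma runs_flow_round:
  assumes s: "stored s" "fresh_stamp s" "flow A m v t k (nmem s aFlow)"
  shows "runs flow_round s (round_time n) (\<lambda>s' :: state. stored s' \<and> fresh_stamp s' \<and>
     (if nmem s' aMark t < val vStamp s'
      then 0 \<in> marked s' \<and> int (card (crossing (A - {v}) m (marked s'))) = k
      else flow A m v t (k + 1) (nmem s' aFlow)))"
  unfolding flow_round_def round_time_def
proof (rule runs_Seq, rule runs_weaken[OF runs_search[OF s(1,2)]])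
  fix s1 assume "stored s1 \<and> tree s1 \<and> nmem s1 aFlow = nmem s aFlow \<and>
       (\<forall>z. owner z \<in> marked s1 \<longrightarrow> scanned s1 z)"
  then have s1: "stored s1" "tree s1" "flow A m v t k (nmem s1 aFlow)"
    and sc: "\<And>z. owner z \<in> marked s1 \<Longrightarrow> scanned s1 z" using s by auto
  have vt: "val vT s1 = t" using s1(1) by (simp add: stored_def)
  have fr: "fresh_stamp s1" using tree_fresh s1 by blast
  let ?Q = "\<lambda>s'. stored s' \<and> fresh_stamp s' \<and>
     (if nmem s' aMark t < val vStamp s'
      then 0 \<in> marked s' \<and> int (card (crossing (A - {v}) m (marked s'))) = k
      else flow A m v t (k + 1) (nmem s' aFlow))"
  show "runs (Cond (NLess (NRead aMark (var vT)) (var vStamp)) Skip augment) s1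
     (1 + (n * (steps augment_body + 1) + 1) + 1) ?Q"
  proof (rule runs_Cond)
    assume "bval (NLess (NRead aMark (var vT)) (var vStamp)) s1"
    then have lt: "nmem s1 aMark t < val vStamp s1" using vt by simp
    have "int (card (crossing (A - {v}) m (marked s1))) = k"
    proof (rule saturated_cut_eq_flow[OF graph s1(3)])
      show "marked s1 \<subseteq> A - {v}" by (auto simp: marked_def)
      show "t \<notin> marked s1" using lt by (simp add: marked_def)
      show "0 \<in> marked s1"
        using s1(2) zero v unfolding tree_def search_tree_def marked_def by (auto intro!: image_eqI[of _ _ 0])
      \<comment> \<open>A dart leaving the marked set must be saturated: its tail has been scanned,
        so otherwise its head would be marked.\<close>
      fix z assume z: "z \<in> crossing (A - {v}) m (marked s1)"
      then have "owner (m z) \<notin> marked s1" "owner (m z) \<in> A - {v}" by (auto simp: crossing_def)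
      then have "nmem s1 aMark (owner (m z)) \<noteq> val vStamp s1" by (auto simp: marked_def)
      then show "2 \<le> nmem s1 aFlow z" using sc[of z] z by (auto simp: crossing_def scanned_def)
    qed
    moreover have "0 \<in> marked s1"
        using s1(2) zero v unfolding tree_def search_tree_def marked_def by (auto intro!: image_eqI[of _ _ 0])
    ultimately have "?Q s1" using lt s1(1) fr by simp
    then have "runs Skip s1 1 ?Q" using runs_result[of Skip ?Q s1] by simp
    then show "runs Skip s1 (1 + (n * (steps augment_body + 1) + 1)) ?Q" by (rule runs_weaken) auto
  next
    assume "\<not> bval (NLess (NRead aMark (var vT)) (var vStamp)) s1"
    then have ge: "\<not> nmem s1 aMark t < val vStamp s1" using vt by simp
    then have "nmem s1 aMark t = val vStamp s1" using fr unfolding fresh_stamp_def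
      by (meson le_neq_implies_less)
    from runs_frame[OF runs_augment[OF s1 this]]
    show "runs augment s1 (1 + (n * (steps augment_body + 1) + 1)) ?Q"
    proof (rule runs_weaken)
      fix s' :: state assume "(stored s' \<and> flow A m v t (k + 1) (nmem s' aFlow)) \<and>
        (\<forall>a. a \<notin> nwritten augment \<longrightarrow> nmem s' a = nmem s1 a) \<and>
        (\<forall>a. a \<notin> rwritten augment \<longrightarrow> rmem s' a = rmem s1 a)"
      then have *: "stored s'" "flow A m v t (k + 1) (nmem s' aFlow)"
        "nmem s' aMark = nmem s1 aMark" "nmem s' vStamp = nmem s1 vStamp"
        by (auto simp: augment_def augment_body_def)
      then show "?Q s'" using ge fr by (simp add: fresh_stamp_def)
    qed simp
  qed
qed simp

lemma runs_reset_flow: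
  assumes "stored s"
  shows "runs reset_flow s (1 + (4 * n * (steps reset_body + 1) + 1)) (\<lambda>s'. \<forall>z\<in>darts {..<n}. nmem s' aFlow z = 1)"
proof -
  let ?s = "nwrite vZ 0 0 s"
  let ?b = "NLess (var vZ) (quad (var vN))"
  let ?I = "\<lambda>s'. val vN s' = n \<and> (\<forall>z<val vZ s'. nmem s' aFlow z = 1)"
  have "runs (While ?b reset_body) ?s ((4 * n - val vZ ?s) * (steps reset_body + 1) + 1) (\<lambda>s'. ?I s' \<and> \<not> bval ?b s')"
  proof (rule runs_While[where \<mu> = "\<lambda>s. 4 * n - val vZ s"])
    show "?I ?s" using assms by (simp add: stored_def)
    fix s1 assume "?I s1" "bval ?b s1"
    then show "runs reset_body s1 (steps reset_body) (\<lambda>s'. ?I s' \<and> 4 * n - val vZ s' < 4 * n - val vZ s1)"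
      by (intro runs_result) (auto simp: reset_body_def less_Suc_eq)
  qed
  then have loop: "runs (While ?b reset_body) ?s (4 * n * (steps reset_body + 1) + 1)
     (\<lambda>s'. \<forall>z\<in>darts {..<n}. nmem s' aFlow z = 1)"
    by (rule runs_weaken) (auto simp: owner_def)
  have "runs (assign vZ (NLit 0)) s (steps (assign vZ (NLit 0))) (\<lambda>s'. runs (While ?b reset_body) s' (4 * n * (steps reset_body + 1) + 1)
     (\<lambda>s'. \<forall>z\<in>darts {..<n}. nmem s' aFlow z = 1))"
    by (rule runs_result) (use loop in simp_all)
  then show ?thesis unfolding reset_flow_def by (intro runs_Seq) simp
qed

text \<open>Getting stuck at value \<open>k\<close> exhibits a cut of size \<open>k\<close> between
  \<open>0\<close> and \<open>t\<close>, so by \<open>two\<close> it cannot happen in the first two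
  rounds. The third round either reaches value 3, which excludes cuts of size 2, or gets stuck at
  such a cut.\<close>

lemma runs_max_flow:
  assumes s: "stored s" "fresh_stamp s"
    and two: "\<And>S. S \<subseteq> A - {v} \<Longrightarrow> 0 \<in> S \<Longrightarrow> t \<notin> S \<Longrightarrow> 2 \<le> card (crossing (A - {v}) m S)"
  shows "runs max_flow s (flow_time n) (\<lambda>s'. fresh_stamp s' \<and>
     (if nmem s' aMark t < val vStamp s'
      then 0 \<in> marked s' \<and> card (crossing (A - {v}) m (marked s')) = 2
      else \<forall>S. S \<subseteq> A - {v} \<and> 0 \<in> S \<and> t \<notin> S \<longrightarrow> 3 \<le> card (crossing (A - {v}) m S)))"
proof -
  let ?G = "\<lambda>k s. stored s \<and> fresh_stamp s \<and> flow A m v t k (nmem s aFlow)"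
  have step: "runs flow_round s (round_time n) (?G (k + 1))" if "?G k s" "k < 2" for k s
  proof (rule runs_weaken[OF runs_flow_round[of s k]])
    fix s' :: state assume *: "stored s' \<and> fresh_stamp s' \<and>
     (if nmem s' aMark t < val vStamp s'
      then 0 \<in> marked s' \<and> int (card (crossing (A - {v}) m (marked s'))) = k
      else flow A m v t (k + 1) (nmem s' aFlow))"
    show "?G (k + 1) s'"
    proof (cases "nmem s' aMark t < val vStamp s'")
      case True
      then have "t \<notin> marked s'" "marked s' \<subseteq> A - {v}" by (auto simp: marked_def)
      then have "2 \<le> card (crossing (A - {v}) m (marked s'))" using * True by (intro two) auto
      then show ?thesis using * True \<open>k < 2\<close> by simp
    next
      case False
      then show ?thesis using * by simp
    qed
  qed (use that in auto)
  have reset: "runs reset_flow s (1 + (4 * n * (steps reset_body + 1) + 1)) (?G 0)"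
  proof (rule runs_weaken[OF runs_frame[OF runs_reset_flow[OF s(1)]]])
    fix s' :: state assume *: "(\<forall>z\<in>darts {..<n}. nmem s' aFlow z = 1) \<and>
        (\<forall>a. a \<notin> nwritten reset_flow \<longrightarrow> nmem s' a = nmem s a) \<and>
        (\<forall>a. a \<notin> rwritten reset_flow \<longrightarrow> rmem s' a = rmem s a)"
    have "flow A m v t 0 (nmem s' aFlow)"
      by (subst flow_cong[OF graph, where F' = "\<lambda>_. 1"]) (use * An flow_zero in auto)
    moreover have "nmem s' a = nmem s a" if "a \<notin> {aFlow, vZ}" for a
      using * that by (auto simp: reset_flow_def reset_body_def)
    then have "stored s'" "fresh_stamp s'" using s by (simp_all add: stored_def fresh_stamp_def)
    ultimately show "?G 0 s'" by simp
  qed simp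
  have last: "runs flow_round s (round_time n) (\<lambda>s'. fresh_stamp s' \<and>
     (if nmem s' aMark t < val vStamp s'
      then 0 \<in> marked s' \<and> card (crossing (A - {v}) m (marked s')) = 2
      else \<forall>S. S \<subseteq> A - {v} \<and> 0 \<in> S \<and> t \<notin> S \<longrightarrow> 3 \<le> card (crossing (A - {v}) m S)))"
    if "?G 2 s" for s
  proof (rule runs_weaken[OF runs_flow_round[of s 2]])
    fix s' :: state assume *: "stored s' \<and> fresh_stamp s' \<and>
     (if nmem s' aMark t < val vStamp s'
      then 0 \<in> marked s' \<and> int (card (crossing (A - {v}) m (marked s'))) = 2
      else flow A m v t (2 + 1) (nmem s' aFlow))"
    have "3 \<le> card (crossing (A - {v}) m S)" if "flow A m v t (2 + 1) (nmem s' aFlow)"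
      "S \<subseteq> A - {v}" "0 \<in> S" "t \<notin> S" for S
      using flow_le_cut[OF graph that] by simp
    then show "fresh_stamp s' \<and> (if nmem s' aMark t < val vStamp s'
      then 0 \<in> marked s' \<and> card (crossing (A - {v}) m (marked s')) = 2
      else \<forall>S. S \<subseteq> A - {v} \<and> 0 \<in> S \<and> t \<notin> S \<longrightarrow> 3 \<le> card (crossing (A - {v}) m S))"
      using * by auto
  qed (use that in auto)
  show ?thesis unfolding max_flow_def flow_time_def
  proof (rule runs_Seq, rule runs_weaken[OF reset order_refl])
    fix s0 assume G0: "?G 0 s0"
    show "runs (Seq flow_round (Seq flow_round flow_round)) s0 (round_time n + (round_time n + round_time n))
      (\<lambda>s'. fresh_stamp s' \<and> (if nmem s' aMark t < val vStamp s'
      then 0 \<in> marked s' \<and> card (crossing (A - {v}) m (marked s')) = 2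
      else \<forall>S. S \<subseteq> A - {v} \<and> 0 \<in> S \<and> t \<notin> S \<longrightarrow> 3 \<le> card (crossing (A - {v}) m S)))"
    proof (rule runs_Seq, rule runs_weaken[OF step[OF G0] order_refl])
      fix s1 assume G1: "?G (0 + 1) s1"
      show "runs (Seq flow_round flow_round) s1 (round_time n + round_time n)
        (\<lambda>s'. fresh_stamp s' \<and> (if nmem s' aMark t < val vStamp s'
        then 0 \<in> marked s' \<and> card (crossing (A - {v}) m (marked s')) = 2
        else \<forall>S. S \<subseteq> A - {v} \<and> 0 \<in> S \<and> t \<notin> S \<longrightarrow> 3 \<le> card (crossing (A - {v}) m S)))"
        by (rule runs_Seq, rule runs_weaken[OF step[OF G1] order_refl], simp, rule last, simp)
    qed simp
  qed
qed

end

section \<open>One reduction step, the base case and the way back, as programs\<close>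

definition equal :: "nexp \<Rightarrow> nexp \<Rightarrow> bexp" where
  "equal d e = BAnd (BNot (NLess d e)) (BNot (NLess e d))"

lemma bval_equal [simp]: "bval (equal d e) s \<longleftrightarrow> nval d s = nval e s"
  by (auto simp: equal_def)

text \<open>With \<open>k = 0, 1, 2\<close> this lists the darts of \<open>v\<close> other than the
  one in \<open>vA0\<close>: a candidate equal to it is replaced by the fourth dart.\<close>

definition other_dart :: "nat \<Rightarrow> nat \<Rightarrow> com" where
  "other_dart a k = block [
     assign a (NAdd (quad (var vV)) (NLit k)),
     Cond (equal (var vA0) (var a)) (assign a (NAdd (quad (var vV)) (NLit 3))) Skip]"

definition find_darts :: com where
  "find_darts = block [
     assign vA0 (NRead aMate (NLit 0)),
     assign vV (NRead aOwn (var vA0)),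
     other_dart vA1 0, other_dart vA2 1, other_dart vA3 2,
     assign vT (NRead aOwn (NRead aMate (var vA3)))]"

definition choose_pairing :: com where
  "choose_pairing = block [
     assign vB (var vA1), assign vD (var vA2), assign vE (var vA3),
     Cond (NLess (NRead aMark (var vT)) (var vStamp))
       (Cond (NLess (NRead aMark (NRead aOwn (NRead aMate (var vA1)))) (var vStamp))
         (block [assign vE (var vA2), assign vD (var vA3)])
         (block [assign vE (var vA1), assign vB (var vA3)]))
       Skip]"

text \<open>Both pairings of the root edge, with \<open>b\<close> and with \<open>d\<close>, are
  admissible at this point, so the costs may decide between them.\<close>

definition order_pairing :: com where
  "order_pairing =
     Cond (RLess (RRead rCost (var vB)) (RRead rCost (var vD)))
       (block [assign vZ (var vB), assign vB (var vD), assign vD (var vZ)])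
       Skip"

text \<open>Cell \<open>vK\<close> of five arrays serves as the top of a stack and records the darts
  that \<open>lift_selection\<close> needs. Dart \<open>0\<close> stays on the root edge and gets
  the former mate of \<open>b\<close> as its mate.\<close>

definition split_vertex :: com where
  "split_vertex = block [
     assign vX (NRead aMate (var vB)), assign vY (NRead aMate (var vD)), assign vZ (NRead aMate (var vE)),
     NWrite aB (var vK) (var vB), NWrite aD (var vK) (var vD), NWrite aE (var vK) (var vE),
     NWrite aB' (var vK) (var vX), NWrite aD' (var vK) (var vY),
     RWrite rCost (var vY) (RSub (RRead rCost (var vE)) (RRead rCost (var vB))),
     RWrite rCost (var vZ) (RRead rCost (var vY)),
     NWrite aMate (NLit 0) (var vX), NWrite aMate (var vX) (NLit 0),
     NWrite aMate (var vY) (var vZ), NWrite aMate (var vZ) (var vY),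
     assign vK (NAdd (var vK) (NLit 1))]"

definition reduce_body :: com where
  "reduce_body = Seq find_darts (Seq max_flow (Seq choose_pairing (Seq order_pairing split_vertex)))"

definition reduce :: com where
  "reduce = While (NLess (NAdd (var vK) (NLit 1)) (var vN)) reduce_body"

text \<open>Dart 1 belongs to the loop that is not the root, unless it is the mate of dart
  \<open>0\<close>; in that case dart 2 does.\<close>

definition select_loop :: com where
  "select_loop = block [
     assign vZ (NLit 1),
     Cond (equal (NRead aMate (NLit 0)) (NLit 1)) (assign vZ (NLit 2)) Skip,
     Cond (RLess (RRead rCost (var vZ)) (RLit 0))
       (block [NWrite aSel (var vZ) (NLit 1), NWrite aSel (NRead aMate (var vZ)) (NLit 1)])
       Skip]"

definition unwind_body :: com where
  "unwind_body = block [
     assign vK (NSub (var vK) (NLit 1)),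
     Cond (NLess (NLit 0) (NRead aSel (NRead aD' (var vK))))
       (block [NWrite aSel (NRead aD (var vK)) (NLit 1), NWrite aSel (NRead aE (var vK)) (NLit 1)])
       (block [NWrite aSel (NRead aB (var vK)) (NLit 1), NWrite aSel (NRead aB' (var vK)) (NLit 1),
          NWrite aSel (NRead aD (var vK)) (NLit 1), NWrite aSel (NRead aD' (var vK)) (NLit 1)])]"

definition unwind_loop :: com where
  "unwind_loop = While (NLess (NLit 0) (var vK)) unwind_body"

lemma degree_four_vertex_swap:
  assumes "degree_four_vertex A m v a b d e"
  shows "degree_four_vertex A m v a d b e" "degree_four_vertex A m v a b e d"
  using assms unfolding degree_four_vertex_def by auto

lemma admissible_swap: "admissible B m a b d e \<Longrightarrow> admissible B m a b e d"
  unfolding admissible_def by blast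

text \<open>A small cut that forbids pairing the root edge with \<open>a\<^sub>1\<close> or
  \<open>a\<^sub>2\<close> separates vertex \<open>0\<close> from the end of
  \<open>a\<^sub>3\<close>. If no cut of size 2 does so, both pairings are admissible. Otherwise the
  marked set \<open>S\<close> is such a cut; it contains the end of exactly one of
  \<open>a\<^sub>1\<close>, \<open>a\<^sub>2\<close> and reveals the forbidden partner, whose place
  is taken by \<open>a\<^sub>3\<close>.\<close>

lemma pairing_choice:
  fixes mark :: "nat \<Rightarrow> nat"
  assumes dfv: "degree_four_vertex A m v a a\<^sub>1 a\<^sub>2 a\<^sub>3" and root: "m a = 0" and mark: "\<And>u. mark u \<le> st"
    and S: "S = {u \<in> A - {v}. mark u = st}"
    and outcome: "if mark (owner (m a\<^sub>3)) < st then 0 \<in> S \<and> card (crossing (A - {v}) m S) = 2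
      else \<forall>S. S \<subseteq> A - {v} \<and> 0 \<in> S \<and> owner (m a\<^sub>3) \<notin> S \<longrightarrow> 3 \<le> card (crossing (A - {v}) m S)"
    and b: "b = (if mark (owner (m a\<^sub>3)) < st \<and> \<not> mark (owner (m a\<^sub>1)) < st then a\<^sub>3 else a\<^sub>1)"
    and d: "d = (if mark (owner (m a\<^sub>3)) < st \<and> mark (owner (m a\<^sub>1)) < st then a\<^sub>3 else a\<^sub>2)"
    and e: "e = (if mark (owner (m a\<^sub>3)) < st then if mark (owner (m a\<^sub>1)) < st then a\<^sub>2 else a\<^sub>1 else a\<^sub>3)"
  shows "degree_four_vertex A m v a b d e \<and> admissible (A - {v}) m a b d e \<and> admissible (A - {v}) m a d b e"
proof -
  let ?B = "A - {v}"
  interpret degree_four_vertex A m v a a\<^sub>1 a\<^sub>2 a\<^sub>3 by (rule dfv)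
  have o0: "owner (m a) = 0" by (simp add: root owner_def)
  have inS: "owner (m z) \<in> S \<longleftrightarrow> \<not> mark (owner (m z)) < st" if "z \<in> {a, a\<^sub>1, a\<^sub>2, a\<^sub>3}" for z
  proof -
    have "owner (m z) \<in> ?B" using that mates by auto
    then show ?thesis unfolding S using mark[of "owner (m z)"] by auto
  qed
  show ?thesis
  proof (cases "mark (owner (m a\<^sub>3)) < st")
    case False
    then have three: "3 \<le> card (crossing ?B m S)" if "S \<subseteq> ?B" "0 \<in> S" "owner (m a\<^sub>3) \<notin> S" for S
      using outcome that by auto
    then have "admissible ?B m a a\<^sub>1 a\<^sub>2 a\<^sub>3" "admissible ?B m a a\<^sub>2 a\<^sub>1 a\<^sub>3"
      unfolding admissible_def o0 by auto
    then show ?thesis using False dfv b d e by simp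
  next
    case True
    have S2: "S \<subseteq> ?B" "0 \<in> S" "card (crossing ?B m S) = 2" using outcome True S by auto
    have pa: "owner (m a) \<in> S" using S2 o0 by simp
    have p3: "owner (m a\<^sub>3) \<notin> S" using inS[of a\<^sub>3] True by simp
    have "S \<subset> ?B" "S \<noteq> {}" using S2 p3 mates by auto
    \<comment> \<open>With both ends inside, \<open>S\<close> would contain three neighbours, and
      with none only one; either way the cut would have size at least 3.\<close>
    from crossing_bounds[OF this] have p12: "owner (m a\<^sub>1) \<in> S \<longleftrightarrow> owner (m a\<^sub>2) \<notin> S"
      using pa p3 S2(3) by (cases "owner (m a\<^sub>1) \<in> S"; cases "owner (m a\<^sub>2) \<in> S") simp_all
    note cut = degree_four_vertex.admissible_of_cut[OF _ S2(1) eq_imp_le[OF S2(3)]]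
    note s1 = degree_four_vertex_swap(1) and s2 = degree_four_vertex_swap(2)
    show ?thesis
    proof (cases "mark (owner (m a\<^sub>1)) < st")
      case 1: True
      then have p: "owner (m a\<^sub>1) \<notin> S" "owner (m a\<^sub>2) \<in> S" using inS[of a\<^sub>1] p12 by auto
      have "admissible ?B m a a\<^sub>1 a\<^sub>2 a\<^sub>3" by (rule cut[OF dfv]) (use pa p p3 in auto)
      moreover have "admissible ?B m a a\<^sub>3 a\<^sub>2 a\<^sub>1"
        by (rule cut[OF s1[OF s2[OF s1[OF dfv]]]]) (use pa p p3 in auto)
      ultimately show ?thesis
        using True 1 b d e admissible_swap s2[OF dfv] by auto
    next
      case 1: False
      then have p: "owner (m a\<^sub>1) \<in> S" "owner (m a\<^sub>2) \<notin> S" using inS[of a\<^sub>1] p12 by auto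
      have "admissible ?B m a a\<^sub>3 a\<^sub>1 a\<^sub>2"
        by (rule cut[OF s1[OF s2[OF dfv]]]) (use pa p p3 in auto)
      moreover have "admissible ?B m a a\<^sub>2 a\<^sub>1 a\<^sub>3"
        by (rule cut[OF s1[OF dfv]]) (use pa p p3 in auto)
      ultimately show ?thesis
        using True 1 b d e admissible_swap s1[OF s2[OF s1[OF dfv]]] by auto
    qed
  qed
qed

fun unwind :: "(nat \<Rightarrow> nat \<Rightarrow> nat) \<Rightarrow> nat \<Rightarrow> nat set \<Rightarrow> nat set" where
  "unwind M 0 X = X"
| "unwind M (Suc k) X = unwind M k (lift_selection (M aB k) (M aD k) (M aE k) (M aB' k) (M aD' k) X)"

lemma unwind_cong:
  assumes "\<And>a i. a \<in> {aB, aD, aE, aB', aD'} \<Longrightarrow> i < k \<Longrightarrow> M a i = M' a i"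
  shows "unwind M k X = unwind M' k X"
  using assms by (induction k arbitrary: X) simp_all

text \<open>The last conjunct replaces a record of the intermediate graphs: whatever selection is
  found for the present graph, the stacked darts turn it into one for the original graph
  \<open>m\<^sub>0\<close> with costs \<open>c\<^sub>0\<close>.\<close>

definition reduced :: "nat \<Rightarrow> (nat \<Rightarrow> nat) \<Rightarrow> (nat \<Rightarrow> real) \<Rightarrow> nat set \<Rightarrow> state \<Rightarrow> bool" where
  "reduced n m\<^sub>0 c\<^sub>0 A s \<longleftrightarrow> val vN s = n \<and> A \<subseteq> {..<n} \<and> 0 \<in> A \<and> card A + val vK s = n \<and>
     four_edge_connected A (nmem s aMate) \<and> symmetric_cost A (nmem s aMate) (rmem s rCost) \<and>
     (\<forall>z\<in>darts {..<n}. nmem s aOwn z = owner z) \<and> (\<forall>u. nmem s aMark u \<le> val vStamp s) \<and>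
     (\<forall>X. selection A (nmem s aMate) (rmem s rCost) X \<longrightarrow>
        selection {..<n} m\<^sub>0 c\<^sub>0 (unwind (nmem s) (val vK s) X))"

lemma find_darts_result:
  assumes mate: "m = nmem s aMate" and own: "\<And>z. z \<in> darts {..<n} \<Longrightarrow> nmem s aOwn z = owner z"
    and A: "A \<subseteq> {..<n}" "0 \<in> A" "A \<noteq> {0}" and fec: "four_edge_connected A m"
  defines "s' \<equiv> result find_darts s"
  shows "val vA0 s' = m 0 \<and> val vV s' = owner (m 0) \<and> val vT s' = owner (m (val vA3 s')) \<and>
    degree_four_vertex A m (owner (m 0)) (m 0) (val vA1 s') (val vA2 s') (val vA3 s')"
proof -
  let ?a = "m 0"
  let ?v = "owner ?a"
  have graph: "dart_graph A m" using fec by (simp add: four_edge_connected_def)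
  have v: "?v \<in> A - {0}" using four_edge_connected_no_loop[OF fec A(2,3), of 0] by (simp add: owner_def)
  have vA: "A \<noteq> {?v}" using v A by auto
  have own': "nmem s aOwn z = owner z" if "owner z \<in> A" for z using own A that by auto
  obtain r where r: "?a = 4 * ?v + r" "r < 4" unfolding owner_def by (metis mod_less_divisor mult_div_mod_eq zero_less_numeral)
  define f where "f k = (if ?a = 4 * ?v + k then 4 * ?v + 3 else 4 * ?v + k)" for k
  have f: "f k = (if k = r then 4 * ?v + 3 else 4 * ?v + k)" for k
    unfolding f_def using r by (metis add_left_cancel)
  have "owner (f 2) = ?v" using owner_quad[of 2 ?v] owner_quad[of 3 ?v] unfolding f by presburger
  then have ownf: "nmem s aOwn (m (f 2)) = owner (m (f 2))"
    using v mate_vertex[OF graph, of "f 2"] by (intro own') auto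
  have s': "val vA0 s' = ?a \<and> val vV s' = ?v \<and> val vA1 s' = f 0 \<and> val vA2 s' = f 1 \<and> val vA3 s' = f 2 \<and>
    val vT s' = owner (m (f 2))"
  proof -
    have *: "nmem s aOwn ?a = ?v" using own' v by auto
    have "val vA0 s' = ?a \<and> val vV s' = ?v \<and> val vA1 s' = f 0 \<and> val vA2 s' = f 1 \<and> val vA3 s' = f 2 \<and>
      val vT s' = nmem s aOwn (m (f 2))"
      unfolding s'_def find_darts_def other_dart_def by (simp add: mate[symmetric] * f_def)
    then show ?thesis using ownf by simp
  qed
  have "darts {?v} = {?a, f 0, f 1, f 2}"
  proof -
    have "r \<in> {0, 1, 2, 3}" using r by auto
    then have "{4 * ?v + r, f 0, f 1, f 2} = {4 * ?v, 4 * ?v + 1, 4 * ?v + 2, 4 * ?v + 3}"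
      by (auto simp: f)
    moreover have "darts {?v} = {4 * ?v, 4 * ?v + 1, 4 * ?v + 2, 4 * ?v + 3}"
      using owner_eq_iff by auto
    ultimately show ?thesis using r by simp
  qed
  moreover have "distinct [?a, f 0, f 1, f 2]"
  proof -
    have "r \<in> {0, 1, 2, 3}" using r by auto
    then have "distinct [4 * ?v + r, f 0, f 1, f 2]" by (auto simp: f)
    then show ?thesis using r(1) by simp
  qed
  ultimately have "degree_four_vertex A m ?v ?a (f 0) (f 1) (f 2)"
    using fec v vA by unfold_locales auto
  then show ?thesis using s' by simp
qed

definition reduce_time :: "nat \<Rightarrow> nat" where
  "reduce_time n = steps find_darts + (flow_time n +
     (steps choose_pairing + (steps order_pairing + steps split_vertex)))"

lemma split_vertex_result:
  assumes red: "reduced n m\<^sub>0 c\<^sub>0 A s" and dfv: "degree_four_vertex A (nmem s aMate) v a b d e"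
    and adm: "admissible (A - {v}) (nmem s aMate) a b d e" and root: "nmem s aMate a = 0"
    and v0: "v \<noteq> 0" and cost: "rmem s rCost d \<le> rmem s rCost b"
    and val: "val vB s = b" "val vD s = d" "val vE s = e"
  shows "reduced n m\<^sub>0 c\<^sub>0 (A - {v}) (result split_vertex s) \<and> val vK (result split_vertex s) = Suc (val vK s)"
proof -
  let ?s = "result split_vertex s" and ?m = "nmem s aMate" and ?c = "rmem s rCost" and ?k = "val vK s"
  interpret degree_four_vertex A ?m v a b d e by (rule dfv)
  let ?c' = "?c(?m d := ?c e - ?c b, ?m e := ?c e - ?c b)"
  have A: "A \<subseteq> {..<n}" "0 \<in> A" "card A + ?k = n" "symmetric_cost A ?m ?c"
    and un: "\<And>X. selection A ?m ?c X \<Longrightarrow> selection {..<n} m\<^sub>0 c\<^sub>0 (unwind (nmem s) ?k X)"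
    using red by (auto simp: reduced_def)
  have mate: "nmem ?s aMate = split_off ?m a b d e"
    unfolding split_vertex_def split_off_def root by (simp add: val)
  have cst: "rmem ?s rCost = ?c'" unfolding split_vertex_def by (simp add: val)
  have k: "val vK ?s = Suc ?k" unfolding split_vertex_def by simp
  have stack: "nmem ?s aB ?k = b" "nmem ?s aD ?k = d" "nmem ?s aE ?k = e"
    "nmem ?s aB' ?k = ?m b" "nmem ?s aD' ?k = ?m d"
    unfolding split_vertex_def by (simp_all add: val)
  have below: "nmem ?s x i = nmem s x i" if "x \<in> {aB, aD, aE, aB', aD'}" "i < ?k" for x i
    using that unfolding split_vertex_def by auto
  have rest: "nmem ?s x = nmem s x" if "x \<in> {vN, aOwn, aMark, vStamp}" for x
    using that unfolding split_vertex_def by auto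
  have "card (A - {v}) + Suc ?k = n"
    using A(3) card_Suc_Diff1[OF finite_vertices[OF graph] v(1)] by simp
  moreover have "four_edge_connected (A - {v}) (nmem ?s aMate)"
    unfolding mate by (rule four_edge_connected_split_off[OF adm])
  moreover have "symmetric_cost (A - {v}) (nmem ?s aMate) (rmem ?s rCost)"
    unfolding mate cst by (rule symmetric_cost_split_off[OF root A(4)])
  moreover have "selection {..<n} m\<^sub>0 c\<^sub>0 (unwind (nmem ?s) (Suc ?k) X)"
    if "selection (A - {v}) (nmem ?s aMate) (rmem ?s rCost) X" for X
  proof -
    have "selection A ?m ?c (lift_selection b d e (?m b) (?m d) X)"
      using that unfolding mate cst by (rule selection_lift[OF root A(4) _ cost])
    then have "selection {..<n} m\<^sub>0 c\<^sub>0 (unwind (nmem s) ?k (lift_selection b d e (?m b) (?m d) X))"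
      by (rule un)
    moreover have "unwind (nmem s) ?k Y = unwind (nmem ?s) ?k Y" for Y
      by (rule unwind_cong) (simp add: below)
    ultimately show ?thesis by (simp add: stack)
  qed
  moreover have "val vN ?s = n" "\<forall>z\<in>darts {..<n}. nmem ?s aOwn z = owner z"
    "\<forall>u. nmem ?s aMark u \<le> val vStamp ?s"
    using red rest by (auto simp: reduced_def)
  ultimately show ?thesis unfolding reduced_def k using A v0 by auto
qed

lemma runs_reduce_body:
  assumes red: "reduced n m\<^sub>0 c\<^sub>0 A s" and k: "val vK s + 1 < n"
  shows "runs reduce_body s (reduce_time n)
    (\<lambda>s'. (\<exists>A. reduced n m\<^sub>0 c\<^sub>0 A s') \<and> val vK s' = Suc (val vK s))"
proof -
  define m where "m = nmem s aMate"
  define v where "v = owner (m 0)"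
  define s1 where "s1 = result find_darts s"
  let ?a1 = "val vA1 s1" and ?a2 = "val vA2 s1" and ?a3 = "val vA3 s1"
  define t where "t = owner (m ?a3)"
  have A: "A \<subseteq> {..<n}" "0 \<in> A" "card A + val vK s = n" and fec: "four_edge_connected A m"
    and own: "\<And>z. z \<in> darts {..<n} \<Longrightarrow> nmem s aOwn z = owner z"
    using red by (auto simp: reduced_def m_def)
  have graph: "dart_graph A m" using fec by (simp add: four_edge_connected_def)
  have A0: "A \<noteq> {0}" using A k by auto
  have fd: "val vA0 s1 = m 0" "val vV s1 = v" "val vT s1 = t" "degree_four_vertex A m v (m 0) ?a1 ?a2 ?a3"
    using find_darts_result[OF m_def own A(1,2) A0 fec] unfolding s1_def v_def t_def by auto
  interpret degree_four_vertex A m v "m 0" ?a1 ?a2 ?a3 by (rule fd(4))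
  have vA: "v \<in> A" by (rule v(1))
  have root: "m (m 0) = 0" using mate_mate[OF graph, of 0] A by (simp add: owner_def)
  have v0: "v \<noteq> 0"
    using four_edge_connected_no_loop[OF fec A(2) A0, of 0] by (simp add: owner_def v_def)
  have tB: "t \<in> A - {v}" unfolding t_def using mates by simp
  interpret flow_network n A m v t
    using graph A v0 tB vA by unfold_locales auto
  have fr1: "nmem s1 x = nmem s x" if "x \<notin> {vA0, vA1, vA2, vA3, vV, vT}" for x
    using that unfolding s1_def find_darts_def other_dart_def by auto
  have rm1: "rmem s1 = rmem s"
    unfolding s1_def find_darts_def other_dart_def by auto
  have red1: "reduced n m\<^sub>0 c\<^sub>0 A s1"
  proof -
    have "unwind (nmem s1) k X = unwind (nmem s) k X" for k X
      by (rule unwind_cong) (auto simp: fr1)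
    then show ?thesis using red unfolding reduced_def by (simp add: fr1 rm1)
  qed
  have stored1: "stored s1" and fresh1: "fresh_stamp s1"
    using red1 fd fr1[of aMate] by (simp_all add: stored_def fresh_stamp_def reduced_def m_def[symmetric])
  \<comment> \<open>With \<open>k\<close> the size of the cut and \<open>j\<close> the number of
    edges from \<open>v\<close> into \<open>S\<close>, the bounds \<open>4 <= k + j\<close> and
    \<open>j <= k\<close> give \<open>2 <= k\<close>.\<close>
  have two: "2 \<le> card (crossing (A - {v}) m S)" if "S \<subseteq> A - {v}" "0 \<in> S" "t \<notin> S" for S
  proof -
    have "S \<subset> A - {v}" "S \<noteq> {}" using that tB by auto
    from crossing_delete_vertex_bounds[OF fec vA this] show ?thesis by linarith
  qed
  have last: "runs (Seq choose_pairing (Seq order_pairing split_vertex)) s2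
     (steps choose_pairing + (steps order_pairing + steps split_vertex))
     (\<lambda>s'. (\<exists>A. reduced n m\<^sub>0 c\<^sub>0 A s') \<and> val vK s' = Suc (val vK s))"
    if fresh2: "fresh_stamp s2" and out: "if nmem s2 aMark t < val vStamp s2
      then 0 \<in> marked s2 \<and> card (crossing (A - {v}) m (marked s2)) = 2
      else \<forall>S. S \<subseteq> A - {v} \<and> 0 \<in> S \<and> t \<notin> S \<longrightarrow> 3 \<le> card (crossing (A - {v}) m S)"
    and fr2: "\<And>x. x \<notin> {aFlow, aMark, aPar, aQueue, vStamp, vHead, vTail, vU, vZ, vW} \<Longrightarrow> nmem s2 x = nmem s1 x"
    and rm2: "rmem s2 = rmem s1" for s2
  proof -
    let ?mark = "nmem s2 aMark" and ?st = "val vStamp s2"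
    define b where "b = (if ?mark t < ?st \<and> \<not> ?mark (owner (m ?a1)) < ?st then ?a3 else ?a1)"
    define d where "d = (if ?mark t < ?st \<and> ?mark (owner (m ?a1)) < ?st then ?a3 else ?a2)"
    define e where "e = (if ?mark t < ?st then if ?mark (owner (m ?a1)) < ?st then ?a2 else ?a1 else ?a3)"
    have pc: "degree_four_vertex A m v (m 0) b d e \<and> admissible (A - {v}) m (m 0) b d e \<and> admissible (A - {v}) m (m 0) d b e"
      by (rule pairing_choice[OF fd(4) root fresh2[unfolded fresh_stamp_def, rule_format]
          marked_def out[unfolded t_def] b_def[unfolded t_def] d_def[unfolded t_def] e_def[unfolded t_def]])
    have red2: "reduced n m\<^sub>0 c\<^sub>0 A s2"
    proof -
      have "unwind (nmem s2) k X = unwind (nmem s1) k X" for k X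
        by (rule unwind_cong) (auto simp: fr2)
      then show ?thesis using red1 fresh2 unfolding reduced_def fresh_stamp_def by (simp add: fr2 rm2)
    qed
    define s3 where "s3 = result choose_pairing s2"
    have own1: "nmem s2 aOwn (nmem s2 aMate ?a1) = owner (m ?a1)"
    proof -
      have "owner (m ?a1) \<in> {..<n}" using mates A by auto
      then show ?thesis using own by (simp add: fr2 fr1 m_def)
    qed
    have s3: "val vB s3 = b" "val vD s3 = d" "val vE s3 = e"
      unfolding s3_def choose_pairing_def b_def d_def e_def using own1 by (simp_all add: fr2 fd)
    define s4 where "s4 = result order_pairing s3"
    let ?c = "rmem s2 rCost"
    define b' where "b' = (if ?c b < ?c d then d else b)"
    define d' where "d' = (if ?c b < ?c d then b else d)"
    have rm3: "rmem s3 = rmem s2" unfolding s3_def choose_pairing_def by simp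
    have s4: "val vB s4 = b'" "val vD s4 = d'" "val vE s4 = e"
      unfolding s4_def order_pairing_def b'_def d'_def using s3 rm3 by simp_all
    have rm4: "rmem s4 = rmem s2" unfolding s4_def order_pairing_def using rm3 by simp
    have fr4: "nmem s4 x = nmem s2 x" if "x \<notin> {vB, vD, vE, vZ}" for x
      using that unfolding s4_def order_pairing_def s3_def choose_pairing_def by simp
    have red4: "reduced n m\<^sub>0 c\<^sub>0 A s4"
    proof -
      have "unwind (nmem s4) k X = unwind (nmem s2) k X" for k X
        by (rule unwind_cong) (auto simp: fr4)
      then show ?thesis using red2 unfolding reduced_def by (simp add: fr4 rm4)
    qed
    have mate4: "nmem s4 aMate = m" by (simp add: fr4 fr2 fr1 m_def)
    have "reduced n m\<^sub>0 c\<^sub>0 (A - {v}) (result split_vertex s4) \<and> val vK (result split_vertex s4) = Suc (val vK s4)"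
      by (rule split_vertex_result[OF red4, where a = "m 0" and b = b' and d = d' and e = e, unfolded mate4])
        (use pc degree_four_vertex_swap(1) root v0 s4 rm4 in \<open>auto simp: b'_def d'_def\<close>)
    moreover have "val vK s4 = val vK s" by (simp add: fr4 fr2 fr1)
    ultimately have final: "(\<exists>A. reduced n m\<^sub>0 c\<^sub>0 A (result split_vertex s4)) \<and> val vK (result split_vertex s4) = Suc (val vK s)"
      by auto
    have lf: "loop_free (Seq choose_pairing (Seq order_pairing split_vertex))"
      by (simp add: choose_pairing_def order_pairing_def split_vertex_def)
    show ?thesis
      using runs_result[OF lf, of "\<lambda>s'. (\<exists>A. reduced n m\<^sub>0 c\<^sub>0 A s') \<and> val vK s' = Suc (val vK s)" s2] final
      by (simp add: s4_def s3_def)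
  qed
  show ?thesis unfolding reduce_body_def reduce_time_def
  proof (rule runs_Seq, rule runs_result)
    show "loop_free find_darts" by (simp add: find_darts_def other_dart_def)
    show "runs (Seq max_flow (Seq choose_pairing (Seq order_pairing split_vertex))) (result find_darts s)
     (flow_time n + (steps choose_pairing + (steps order_pairing + steps split_vertex)))
     (\<lambda>s'. (\<exists>A. reduced n m\<^sub>0 c\<^sub>0 A s') \<and> val vK s' = Suc (val vK s))"
      unfolding s1_def[symmetric]
    proof (rule runs_Seq, rule runs_weaken[OF runs_frame[OF runs_max_flow[OF stored1 fresh1 two]] order_refl])
      fix s2 :: state
      assume *: "(fresh_stamp s2 \<and> (if nmem s2 aMark t < val vStamp s2
        then 0 \<in> marked s2 \<and> card (crossing (A - {v}) m (marked s2)) = 2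
        else \<forall>S. S \<subseteq> A - {v} \<and> 0 \<in> S \<and> t \<notin> S \<longrightarrow> 3 \<le> card (crossing (A - {v}) m S))) \<and>
        (\<forall>a. a \<notin> nwritten max_flow \<longrightarrow> nmem s2 a = nmem s1 a) \<and>
        (\<forall>a. a \<notin> rwritten max_flow \<longrightarrow> rmem s2 a = rmem s1 a)"
      have wr: "nwritten max_flow \<subseteq> {aFlow, aMark, aPar, aQueue, vStamp, vHead, vTail, vU, vZ, vW}" "rwritten max_flow = {}"
        by (simp_all add: max_flow_def flow_round_def search_def search_init_def search_body_def scan_def
            augment_def augment_body_def reset_flow_def reset_body_def)
      show "runs (Seq choose_pairing (Seq order_pairing split_vertex)) s2
       (steps choose_pairing + (steps order_pairing + steps split_vertex))
       (\<lambda>s'. (\<exists>A. reduced n m\<^sub>0 c\<^sub>0 A s') \<and> val vK s' = Suc (val vK s))"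
        by (rule last) (use * wr in auto)
    qed
  qed
qed

lemma runs_reduce:
  assumes "reduced n m\<^sub>0 c\<^sub>0 A s"
  shows "runs reduce s (n * (reduce_time n + 1) + 1) (\<lambda>s'. reduced n m\<^sub>0 c\<^sub>0 {0} s')"
proof -
  let ?b = "NLess (NAdd (var vK) (NLit 1)) (var vN)"
  have "runs reduce s ((n - val vK s) * (reduce_time n + 1) + 1)
    (\<lambda>s'. (\<exists>A. reduced n m\<^sub>0 c\<^sub>0 A s') \<and> \<not> bval ?b s')"
    unfolding reduce_def
  proof (rule runs_While[where \<mu> = "\<lambda>s. n - val vK s"])
    show "\<exists>A. reduced n m\<^sub>0 c\<^sub>0 A s" using assms by blast
    fix s1 assume "\<exists>A. reduced n m\<^sub>0 c\<^sub>0 A s1" and b: "bval ?b s1"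
    then obtain A1 where A1: "reduced n m\<^sub>0 c\<^sub>0 A1 s1" by blast
    then have k: "val vK s1 + 1 < n" using b by (simp add: reduced_def)
    show "runs reduce_body s1 (reduce_time n) (\<lambda>s'. (\<exists>A. reduced n m\<^sub>0 c\<^sub>0 A s') \<and> n - val vK s' < n - val vK s1)"
      by (rule runs_weaken[OF runs_reduce_body[OF A1 k]]) (use k in auto)
  qed
  then show ?thesis
  proof (rule runs_weaken)
    fix s' assume "(\<exists>A. reduced n m\<^sub>0 c\<^sub>0 A s') \<and> \<not> bval ?b s'"
    then obtain A where A: "reduced n m\<^sub>0 c\<^sub>0 A s'" "\<not> bval ?b s'" by blast
    have fin: "finite A" "0 \<in> A" using A(1) finite_subset by (auto simp: reduced_def)
    have "card A \<le> 1" using A by (simp add: reduced_def)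
    then have "A = {0}" using fin card_le_Suc0_iff_eq[of A] by auto
    then show "reduced n m\<^sub>0 c\<^sub>0 {0} s'" using A by simp
  qed (intro add_mono mult_right_mono, auto)
qed

text \<open>A single vertex has no proper cuts, so only the cost matters: the empty selection
  suffices if the loop has nonnegative cost, and a negative cost is at most 2/3 of itself.\<close>

lemma select_loop_result:
  assumes red: "reduced n m\<^sub>0 c\<^sub>0 {0} s" and sel: "\<And>z. nmem s aSel z = 0"
  defines "s' \<equiv> result select_loop s"
  shows "selection {0} (nmem s aMate) (rmem s rCost) {z. 0 < nmem s' aSel z}"
proof -
  let ?m = "nmem s aMate" and ?c = "rmem s rCost"
  define p where "p = (if ?m 0 = 1 then 2 else 1 :: nat)"
  have graph: "dart_graph {0} ?m" using red by (simp add: reduced_def four_edge_connected_def)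
  have d0: "darts {0} = {0, 1, 2, 3}" unfolding darts_singleton by auto
  have g': "?m z \<in> darts {0} \<and> ?m (?m z) = z \<and> ?m z \<noteq> z" if "z \<in> darts {0}" for z
    using graph that unfolding dart_graph_def by blast
  note g = g'[unfolded d0]
  have p: "p \<in> {0, 1, 2, 3}" "p \<noteq> 0" "p \<noteq> ?m 0" by (auto simp: p_def)
  have mp: "?m p \<in> {0, 1, 2, 3}" "?m (?m p) = p" "?m p \<noteq> p" using g[OF p(1)] by auto
  have m0: "?m 0 \<in> {0, 1, 2, 3}" "?m (?m 0) = 0" "?m 0 \<noteq> 0" using g[of 0] by auto
  have mp0: "?m p \<noteq> 0" "?m p \<noteq> ?m 0" using p mp m0 by metis+
  have rest: "darts {0} - {0, ?m 0} = {p, ?m p}"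
  proof -
    have "card {0, ?m 0, p, ?m p} = 4" using p mp m0 mp0 by simp
    moreover have "{0, ?m 0, p, ?m p} \<subseteq> {0, 1, 2, 3}" using p(1) mp(1) m0(1) by simp
    ultimately have "{0, ?m 0, p, ?m p} = {0, 1, 2, 3}" by (intro card_subset_eq) auto
    then have "darts {0} - {0, ?m 0} = {0, ?m 0, p, ?m p} - {0, ?m 0}" by (simp only: d0)
    also have "\<dots> = {p, ?m p}" using p(2,3) mp0 by auto
    finally show ?thesis .
  qed
  have csym: "?c (?m p) = ?c p"
    using red rest unfolding reduced_def symmetric_cost_def by blast
  have sum: "sum ?c {p, ?m p} = 2 * ?c p" using mp csym by simp
  have X: "{z. 0 < nmem s' aSel z} = (if ?c p < 0 then {p, ?m p} else {})"
    unfolding s'_def select_loop_def p_def using sel by (auto split: if_splits)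
  have cut: "\<not> (S \<noteq> {} \<and> S \<subset> {0 :: nat})" for S by auto
  show ?thesis
  proof (cases "?c p < 0")
    case True
    have "{p, ?m p} \<subseteq> darts {0}" unfolding d0 using p(1) mp(1) by simp
    then show ?thesis unfolding X selection_def rest sum using True p mp mp0 cut sum by auto
  next
    case False
    then show ?thesis unfolding X selection_def rest sum using cut by auto
  qed
qed

lemma runs_unwind_loop:
  "runs unwind_loop s (val vK s * (steps unwind_body + 1) + 1)
    (\<lambda>s'. {z. 0 < nmem s' aSel z} = unwind (nmem s) (val vK s) {z. 0 < nmem s aSel z})"
proof -
  let ?I = "\<lambda>s'. (\<forall>a\<in>{aB, aD, aE, aB', aD'}. nmem s' a = nmem s a) \<and>
    unwind (nmem s) (val vK s') {z. 0 < nmem s' aSel z} = unwind (nmem s) (val vK s) {z. 0 < nmem s aSel z}"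
  have "runs unwind_loop s (val vK s * (steps unwind_body + 1) + 1)
    (\<lambda>s'. ?I s' \<and> \<not> bval (NLess (NLit 0) (var vK)) s')"
    unfolding unwind_loop_def
  proof (rule runs_While[where \<mu> = "\<lambda>s. val vK s"])
    show "?I s" by simp
    fix s1 assume I: "?I s1" and "bval (NLess (NLit 0) (var vK)) s1"
    then obtain k where k: "val vK s1 = Suc k" by (cases "val vK s1") auto
    let ?s = "result unwind_body s1"
    have "val vK ?s = k" "\<forall>a\<in>{aB, aD, aE, aB', aD'}. nmem ?s a = nmem s a"
      using I k unfolding unwind_body_def by auto
    moreover have "{z. 0 < nmem ?s aSel z} = lift_selection (nmem s aB k) (nmem s aD k) (nmem s aE k)
        (nmem s aB' k) (nmem s aD' k) {z. 0 < nmem s1 aSel z}"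
      using I k unfolding unwind_body_def lift_selection_def by auto
    ultimately have "?I ?s \<and> val vK ?s < val vK s1" using I k by simp
    then show "runs unwind_body s1 (steps unwind_body) (\<lambda>s'. ?I s' \<and> val vK s' < val vK s1)"
      by (intro runs_result) (simp_all add: unwind_body_def)
  qed
  then show ?thesis
  proof (rule runs_weaken)
    fix s' :: state assume *: "?I s' \<and> \<not> bval (NLess (NLit 0) (var vK)) s'"
    then have "val vK s' = 0" by simp
    with conjunct2[OF conjunct1[OF *]]
    show "{z. 0 < nmem s' aSel z} = unwind (nmem s) (val vK s) {z. 0 < nmem s aSel z}" by simp
  qed simp
qed

definition solve :: com where
  "solve = Seq reduce (Seq select_loop unwind_loop)"

lemma runs_solve:
  assumes red: "reduced n m\<^sub>0 c\<^sub>0 A s" and sel: "\<And>z. nmem s aSel z = 0"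
  shows "runs solve s ((n * (reduce_time n + 1) + 1) + (steps select_loop + (n * (steps unwind_body + 1) + 1)))
    (\<lambda>s'. selection {..<n} m\<^sub>0 c\<^sub>0 {z. 0 < nmem s' aSel z})"
  unfolding solve_def
proof (rule runs_Seq, rule runs_weaken[OF runs_frame[OF runs_reduce[OF red]] order_refl])
  fix s1 :: state
  assume *: "reduced n m\<^sub>0 c\<^sub>0 {0} s1 \<and>
    (\<forall>a. a \<notin> nwritten reduce \<longrightarrow> nmem s1 a = nmem s a) \<and> (\<forall>a. a \<notin> rwritten reduce \<longrightarrow> rmem s1 a = rmem s a)"
  have "aSel \<notin> nwritten reduce"
    by (simp add: reduce_def reduce_body_def find_darts_def other_dart_def choose_pairing_def order_pairing_def
        split_vertex_def max_flow_def flow_round_def search_def search_init_def search_body_def scan_def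
        augment_def augment_body_def reset_flow_def reset_body_def)
  then have sel1: "\<And>z. nmem s1 aSel z = 0" using * sel by simp
  let ?s = "result select_loop s1"
  have lf: "loop_free select_loop" by (simp add: select_loop_def)
  have fr: "nmem ?s a = nmem s1 a" if "a \<notin> {vZ, aSel}" for a
    using that unfolding select_loop_def by simp
  have S: "selection {0} (nmem s1 aMate) (rmem s1 rCost) {z. 0 < nmem ?s aSel z}"
    by (rule select_loop_result) (use * sel1 in auto)
  then have "selection {..<n} m\<^sub>0 c\<^sub>0 (unwind (nmem s1) (val vK s1) {z. 0 < nmem ?s aSel z})"
    using * unfolding reduced_def by blast
  moreover have "unwind (nmem s1) k X = unwind (nmem ?s) k X" for k X
    by (rule unwind_cong) (auto simp: fr)
  ultimately have fin: "selection {..<n} m\<^sub>0 c\<^sub>0 (unwind (nmem ?s) (val vK ?s) {z. 0 < nmem ?s aSel z})"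
    by (simp add: fr)
  have "val vK ?s \<le> n" using * by (simp add: fr reduced_def)
  show "runs (Seq select_loop unwind_loop) s1 (steps select_loop + (n * (steps unwind_body + 1) + 1))
    (\<lambda>s'. selection {..<n} m\<^sub>0 c\<^sub>0 {z. 0 < nmem s' aSel z})"
  proof (rule runs_Seq, rule runs_result[OF lf])
    show "runs unwind_loop ?s (n * (steps unwind_body + 1) + 1)
      (\<lambda>s'. selection {..<n} m\<^sub>0 c\<^sub>0 {z. 0 < nmem s' aSel z})"
    proof (rule runs_weaken[OF runs_unwind_loop])
      show "val vK ?s * (steps unwind_body + 1) + 1 \<le> n * (steps unwind_body + 1) + 1"
        using \<open>val vK ?s \<le> n\<close> by (intro add_mono mult_right_mono) auto
    qed (use fin in simp)
  qed
qed

section \<open>Edges, cuts and pairs of vertices\<close>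

lemma doubleton_in_edges: "{a, b} \<in> edges n \<longleftrightarrow> a < n \<and> b < n \<and> a \<noteq> b"
  by (auto simp: edges_def card_2_iff doubleton_eq_iff)

lemma edgesE:
  assumes "e \<in> edges n"
  obtains a b where "e = {a, b}" "a < b" "b < n"
proof -
  obtain a b where "e = {a, b}" "a \<noteq> b" using assms by (auto simp: edges_def card_2_iff)
  then show ?thesis using assms that[of a b] that[of b a]
    by (cases "a < b") (auto simp: edges_def insert_commute)
qed

lemma cut_eq_image:
  assumes "S \<subseteq> {..<n}"
  shows "cut n S = (\<lambda>(a, b). {a, b}) ` (S \<times> ({..<n} - S))"
proof (intro equalityI subsetI)
  fix e assume e: "e \<in> cut n S"
  then obtain a b where ab: "e = {a, b}" "a < b" "b < n" by (auto simp: cut_def elim: edgesE)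
  have "card ({a, b} \<inter> S) = 1" using e ab by (auto simp: cut_def)
  then have "(a \<in> S \<and> b \<notin> S) \<or> (b \<in> S \<and> a \<notin> S)"
    using ab by (cases "a \<in> S"; cases "b \<in> S") (auto simp: Int_insert_left)
  then show "e \<in> (\<lambda>(a, b). {a, b}) ` (S \<times> ({..<n} - S))"
  proof
    assume "a \<in> S \<and> b \<notin> S"
    then show ?thesis using ab by (intro image_eqI[of _ _ "(a, b)"]) auto
  next
    assume "b \<in> S \<and> a \<notin> S"
    then show ?thesis using ab by (intro image_eqI[of _ _ "(b, a)"]) auto
  qed
next
  fix e assume "e \<in> (\<lambda>(a, b). {a, b}) ` (S \<times> ({..<n} - S))"
  then obtain a b where ab: "e = {a, b}" "a \<in> S" "b \<in> {..<n} - S" by auto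
  then have "{a, b} \<inter> S = {a}" by auto
  then show "e \<in> cut n S" using ab assms by (auto simp: cut_def doubleton_in_edges)
qed

lemma sum_cut:
  assumes "S \<subseteq> {..<n}"
  shows "(\<Sum>e\<in>cut n S. f e) = (\<Sum>(a, b)\<in>S \<times> ({..<n} - S). f {a, b})"
proof -
  have "inj_on (\<lambda>(a, b). {a, b}) (S \<times> ({..<n} - S))"
    by (auto simp: inj_on_def doubleton_eq_iff)
  then show ?thesis unfolding cut_eq_image[OF assms] by (simp add: sum.reindex case_prod_unfold)
qed

lemma sum_pairs_edges:
  fixes f :: "nat set \<Rightarrow> real"
  shows "(\<Sum>(a, b)\<in>{..<n} \<times> {..<n}. if a = b then 0 else f {a, b}) = 2 * (\<Sum>e\<in>edges n. f e)"
proof -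
  let ?O = "{(a, b). a < n \<and> b < n \<and> a \<noteq> b}"
  let ?g = "\<lambda>(a, b). {a, b} :: nat set"
  have fin: "finite ?O" by (rule finite_subset[of _ "{..<n} \<times> {..<n}"]) auto
  have "(\<Sum>(a, b)\<in>{..<n} \<times> {..<n}. if a = b then 0 else f {a, b}) = (\<Sum>p\<in>?O. f (?g p))"
    by (rule sum.mono_neutral_cong_right) (auto split: if_splits)
  also have "\<dots> = (\<Sum>e\<in>edges n. \<Sum>p\<in>{p \<in> ?O. ?g p = e}. f (?g p))"
    by (rule sum.group[symmetric]) (auto simp: fin finite_edges doubleton_in_edges)
  also have "\<dots> = (\<Sum>e\<in>edges n. 2 * f e)"
  proof (rule sum.cong)
    fix e assume "e \<in> edges n"
    then obtain a b where ab: "e = {a, b}" "a < b" "b < n" by (rule edgesE)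
    have "{p \<in> ?O. ?g p = e} = {(a, b), (b, a)}" using ab by (auto simp: doubleton_eq_iff)
    then show "(\<Sum>p\<in>{p \<in> ?O. ?g p = e}. f (?g p)) = 2 * f e" using ab by (simp add: insert_commute)
  qed simp
  finally show ?thesis by (simp add: sum_distrib_left)
qed

text \<open>Otherwise the vertices reachable from some \<open>u\<close> would form a proper nonempty
  set that no edge leaves.\<close>

lemma mg_connectedI:
  assumes "\<And>S. S \<noteq> {} \<Longrightarrow> S \<subset> {..<n} \<Longrightarrow> \<exists>e\<in>#H. e \<in> cut n S"
  shows "mg_connected {..<n} H"
  unfolding mg_connected_def
proof (intro ballI)
  fix u v assume u: "u \<in> {..<n}" and v: "v \<in> {..<n}"
  let ?R = "{(a, b). {a, b} \<in># H}"
  define S where "S = {w \<in> {..<n}. (u, w) \<in> ?R\<^sup>*}"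
  have "S = {..<n}"
  proof (rule ccontr)
    assume "S \<noteq> {..<n}"
    then have "S \<subset> {..<n}" "S \<noteq> {}" using u by (auto simp: S_def)
    then obtain e where e: "e \<in># H" "e \<in> cut n S" using assms by blast
    have "S \<subseteq> {..<n}" by (auto simp: S_def)
    then have "e \<in> (\<lambda>(a, b). {a, b}) ` (S \<times> ({..<n} - S))" using e(2) cut_eq_image by simp
    then obtain a b where "e = {a, b}" "a \<in> S" "b \<in> {..<n} - S" by (elim imageE SigmaE) simp
    moreover from this have "(a, b) \<in> ?R" using e by auto
    ultimately show False unfolding S_def by (auto intro: rtrancl_into_rtrancl)
  qed
  then show "(u, v) \<in> ?R\<^sup>*" using v unfolding S_def by auto
qed

text \<open>Deleting one copy of an edge lowers the size of a cut, counted with multiplicity, by at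
  most one.\<close>

lemma two_edge_connectedI:
  assumes cuts: "\<And>S. S \<noteq> {} \<Longrightarrow> S \<subset> {..<n} \<Longrightarrow> 2 \<le> (\<Sum>e\<in>cut n S. count H e)"
  shows "two_edge_connected {..<n} H"
proof -
  have fin: "finite (cut n S)" for S using finite_edges by (simp add: cut_def)
  have ex: "\<exists>e\<in>#H'. e \<in> cut n S" if "0 < (\<Sum>e\<in>cut n S. count H' e)" for H' S
  proof (rule ccontr)
    assume "\<not> ?thesis"
    then have "\<forall>e\<in>cut n S. count H' e = 0" by (metis not_in_iff)
    then show False using that by simp
  qed
  have "mg_connected {..<n} H"
  proof (intro mg_connectedI ex)
    fix S assume "S \<noteq> {}" "S \<subset> {..<n}"
    from cuts[OF this] show "0 < (\<Sum>e\<in>cut n S. count H e)" by simp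
  qed
  moreover have "mg_connected {..<n} (H - {#f#})" for f
  proof (intro mg_connectedI ex)
    fix S assume S: "S \<noteq> {}" "S \<subset> {..<n}"
    have "2 \<le> (\<Sum>e\<in>cut n S. count H e)" using cuts S by blast
    also have "\<dots> \<le> (\<Sum>e\<in>cut n S. count (H - {#f#}) e + (if e = f then 1 else 0))"
      by (rule sum_mono) auto
    also have "\<dots> \<le> (\<Sum>e\<in>cut n S. count (H - {#f#}) e) + 1"
      using fin by (simp add: sum.distrib)
    finally show "0 < (\<Sum>e\<in>cut n S. count (H - {#f#}) e)" by simp
  qed
  ultimately show ?thesis by (simp add: two_edge_connected_def)
qed

text \<open>This connects darts with multiplicities: for \<open>a\<close> and \<open>b\<close>
  distinct and \<open>X\<close> closed under mates, its size is the number of copies of the edge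
  \<open>{a, b}\<close> in \<open>X\<close>.\<close>

definition darts_between :: "(nat \<Rightarrow> nat) \<Rightarrow> nat set \<Rightarrow> nat \<Rightarrow> nat \<Rightarrow> nat set" where
  "darts_between m X a b = {z \<in> X. owner z = a \<and> owner (m z) = b}"

lemma sum_darts_between:
  fixes g :: "nat \<Rightarrow> nat \<Rightarrow> 'a :: comm_semiring_1"
  assumes "finite X" "\<And>z. z \<in> X \<Longrightarrow> owner z < n \<and> owner (m z) < n"
  shows "(\<Sum>z\<in>X. g (owner z) (owner (m z))) =
    (\<Sum>(a, b)\<in>{..<n} \<times> {..<n}. of_nat (card (darts_between m X a b)) * g a b)"
proof -
  have "(\<Sum>z\<in>X. g (owner z) (owner (m z))) = (\<Sum>p\<in>{..<n} \<times> {..<n}.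
     \<Sum>z\<in>{z \<in> X. (owner z, owner (m z)) = p}. g (owner z) (owner (m z)))"
    by (rule sum.group[symmetric]) (use assms in auto)
  also have "\<dots> = (\<Sum>(a, b)\<in>{..<n} \<times> {..<n}. of_nat (card (darts_between m X a b)) * g a b)"
    by (rule sum.cong) (auto simp: darts_between_def)
  finally show ?thesis .
qed

lemma card_crossing_eq_sum:
  assumes "finite X" "\<And>z. z \<in> X \<Longrightarrow> owner z < n \<and> owner (m z) < n" and S: "S \<subseteq> {..<n}"
  shows "card (crossing {..<n} m S \<inter> X) =
    (\<Sum>(a, b)\<in>S \<times> ({..<n} - S). card (darts_between m X a b))"
proof -
  let ?g = "\<lambda>a b. of_bool (a \<in> S \<and> b \<in> {..<n} - S) :: nat"
  have "card (crossing {..<n} m S \<inter> X) = (\<Sum>z\<in>X. ?g (owner z) (owner (m z)))"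
    using assms(1) by (simp add: of_bool_def sum.If_cases crossing_def Int_def conj_commute)
  also have "\<dots> = (\<Sum>(a, b)\<in>{..<n} \<times> {..<n}. card (darts_between m X a b) * ?g a b)"
    using sum_darts_between[OF assms(1,2), where g = ?g] by simp
  also have "\<dots> = (\<Sum>(a, b)\<in>S \<times> ({..<n} - S). card (darts_between m X a b))"
    by (rule sum.mono_neutral_cong_right) (use S in \<open>auto split: if_splits\<close>)
  finally show ?thesis .
qed

section \<open>Building the dart graph\<close>

text \<open>The first \<open>deg u\<close> of the four dart slots of each vertex \<open>u\<close>
  are in use.\<close>

definition placed :: "nat \<Rightarrow> (nat \<Rightarrow> nat) \<Rightarrow> nat set" where
  "placed n deg = {z. owner z < n \<and> z < 4 * owner z + deg (owner z)}"

text \<open>\<open>w\<close> gives the multiplicities inserted so far. The cell in which an edge is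
  to be counted in the output is attached to the dart at its smaller end. The other dart gets 0, a
  diagonal cell that is not part of the output, so an edge is not counted twice.\<close>

definition partial_graph :: "nat \<Rightarrow> (nat set \<Rightarrow> real) \<Rightarrow> (nat \<Rightarrow> nat \<Rightarrow> nat) \<Rightarrow>
    (nat \<Rightarrow> nat) \<Rightarrow> (nat \<Rightarrow> nat) \<Rightarrow> (nat \<Rightarrow> nat) \<Rightarrow> (nat \<Rightarrow> nat) \<Rightarrow> (nat \<Rightarrow> real) \<Rightarrow> bool" where
  "partial_graph n c w deg m own pos cost \<longleftrightarrow>
     (\<forall>u<n. deg u = (\<Sum>y<n. w u y)) \<and>
     (\<forall>z\<in>placed n deg. m z \<in> placed n deg \<and> m (m z) = z \<and> owner (m z) \<noteq> owner z \<and> own z = owner z \<and>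
        cost z = c {owner z, owner (m z)} \<and>
        pos z = (if owner z < owner (m z) then owner z * n + owner (m z) else 0)) \<and>
     (\<forall>z. z \<notin> placed n deg \<longrightarrow> pos z = 0) \<and>
     (\<forall>a<n. \<forall>b<n. card (darts_between m (placed n deg) a b) = w a b)"

lemma finite_placed: "finite (placed n deg)"
  by (rule finite_subset[of _ "darts {..<n}"]) (auto simp: placed_def)

lemma partial_graph_add_edge:
  assumes pg: "partial_graph n c w deg m own pos cost" and ij: "i < j" "j < n" and room: "deg i < 4" "deg j < 4"
    and p: "p = 4 * i + deg i" and q: "q = 4 * j + deg j"
    and w': "\<And>a b. a < n \<Longrightarrow> b < n \<Longrightarrow> w' a b = w a b + of_bool (a = i \<and> b = j \<or> a = j \<and> b = i)"
  shows "partial_graph n c w' (deg(i := deg i + 1, j := deg j + 1)) (m(p := q, q := p)) (own(p := i, q := j))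
    (pos(p := i * n + j)) (cost(p := c {i, j}, q := c {i, j}))"
proof -
  let ?deg = "deg(i := deg i + 1, j := deg j + 1)"
  let ?m = "m(p := q, q := p)"
  let ?P = "placed n deg" and ?P' = "placed n ?deg"
  have i: "i < n" "i \<noteq> j" using ij by auto
  have op: "owner p = i" "owner q = j" using room p q by auto
  have pq: "p \<noteq> q" using op i by auto
  have new: "p \<notin> ?P" "q \<notin> ?P" using op p q by (auto simp: placed_def)
  have P': "?P' = insert p (insert q ?P)"
  proof (rule set_eqI)
    fix z
    show "z \<in> ?P' \<longleftrightarrow> z \<in> insert p (insert q ?P)"
    proof (cases "z = p \<or> z = q")
      case True
      then show ?thesis using op i ij p q by (auto simp: placed_def)
    next
      case False
      have "4 * owner z \<le> z" by (simp add: owner_def)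
      then show ?thesis using False op i ij p q by (auto simp: placed_def)
    qed
  qed
  have old: "m z \<in> ?P" "m (m z) = z" "owner (m z) \<noteq> owner z" "own z = owner z"
     "cost z = c {owner z, owner (m z)}" "pos z = (if owner z < owner (m z) then owner z * n + owner (m z) else 0)"
    if "z \<in> ?P" for z using pg that by (auto simp: partial_graph_def)
  have sum: "?deg u = (\<Sum>y<n. w' u y)" if "u < n" for u
  proof -
    have "(\<Sum>y<n. w' u y) = (\<Sum>y<n. w u y) + (\<Sum>y<n. of_bool (u = i \<and> y = j \<or> u = j \<and> y = i))"
      using w' that by (simp add: sum.distrib)
    also have "(\<Sum>y<n. of_bool (u = i \<and> y = j \<or> u = j \<and> y = i)) = (of_bool (u = i \<or> u = j) :: nat)"
    proof -
      have "(\<Sum>y<n. of_bool (u = i \<and> y = j \<or> u = j \<and> y = i)) =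
         (\<Sum>y<n. if y = (if u = i then j else i) then of_bool (u = i \<or> u = j) else (0 :: nat))"
        by (rule sum.cong) (use i in auto)
      also have "\<dots> = of_bool (u = i \<or> u = j)" using i ij by simp
      finally show ?thesis .
    qed
    finally show ?thesis using pg that i by (auto simp: partial_graph_def)
  qed
  have zP: "z \<noteq> p" "z \<noteq> q" "m z \<noteq> p" "m z \<noteq> q" if "z \<in> ?P" for z
    using that old(1)[OF that] new by auto
  have struct: "?m z \<in> ?P' \<and> ?m (?m z) = z \<and> owner (?m z) \<noteq> owner z \<and> (own(p := i, q := j)) z = owner z \<and>
        (cost(p := c {i, j}, q := c {i, j})) z = c {owner z, owner (?m z)} \<and>
        (pos(p := i * n + j)) z = (if owner z < owner (?m z) then owner z * n + owner (?m z) else 0)"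
    if zP': "z \<in> ?P'" for z
  proof -
    consider "z = p" | "z = q" | "z \<in> ?P" using zP' unfolding P' by blast
    then show ?thesis
    proof cases
      case 1
      then show ?thesis unfolding P' using pq op i ij by auto
    next
      case 2
      \<comment> \<open>Nothing is written to \<open>pos\<close> for the dart at the larger end; the
        required 0 is the initial content.\<close>
      have "pos q = 0" using pg new by (simp add: partial_graph_def)
      then show ?thesis unfolding P' using 2 pq op i ij by (auto simp: insert_commute)
    next
      case 3
      then show ?thesis unfolding P' using old[OF 3] zP[OF 3] by simp
    qed
  qed
  have "card (darts_between ?m ?P' a b) = w' a b" if ab: "a < n" "b < n" for a b
  proof -
    have "darts_between ?m ?P' a b = darts_between m ?P a b \<union>
       ((if a = i \<and> b = j then {p} else {}) \<union> (if a = j \<and> b = i then {q} else {}))"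
      (is "?L = ?R")
    proof (rule set_eqI)
      fix z
      consider "z = p" | "z = q" | "z \<noteq> p" "z \<noteq> q" by blast
      then show "z \<in> ?L \<longleftrightarrow> z \<in> ?R"
      proof cases
        case 1
        show ?thesis unfolding P' darts_between_def 1 using i pq new by (auto simp: op)
      next
        case 2
        show ?thesis unfolding P' darts_between_def 2 using i pq new by (auto simp: op)
      next
        case 3
        have nz: "z \<notin> (if a = i \<and> b = j then {p} else {}) \<union> (if a = j \<and> b = i then {q} else {})"
          using 3 i by simp
        have mz: "?m z = m z" using 3 by simp
        have "z \<in> ?L \<longleftrightarrow> z \<in> ?P \<and> owner z = a \<and> owner (m z) = b"
          unfolding P' darts_between_def mem_Collect_eq mz insert_iff using 3 by (simp only: simp_thms)
        moreover have "z \<in> ?R \<longleftrightarrow> z \<in> ?P \<and> owner z = a \<and> owner (m z) = b"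
          unfolding darts_between_def Un_iff[of z "{z \<in> ?P. owner z = a \<and> owner (m z) = b}"] using nz by blast
        ultimately show ?thesis by (rule trans[OF _ sym])
      qed
    qed
    moreover have "finite (darts_between m ?P a b)" unfolding darts_between_def using finite_placed by simp
    moreover have "darts_between m ?P a b \<inter>
        ((if a = i \<and> b = j then {p} else {}) \<union> (if a = j \<and> b = i then {q} else {})) = {}"
    proof -
      have "(if a = i \<and> b = j then {p} else {}) \<subseteq> {p}" "(if a = j \<and> b = i then {q} else {}) \<subseteq> {q}" by simp_all
      then show ?thesis using new unfolding darts_between_def by blast
    qed
    moreover have "finite ((if a = i \<and> b = j then {p} else {}) \<union> (if a = j \<and> b = i then {q} else {}))"
      by (intro finite_UnI) simp_all
    ultimately have "card (darts_between ?m ?P' a b) = card (darts_between m ?P a b) +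
        card ((if a = i \<and> b = j then {p} else {}) \<union> (if a = j \<and> b = i then {q} else {}))"
      by (simp only: card_Un_disjoint)
    moreover have "card ((if a = i \<and> b = j then {p} else {}) \<union> (if a = j \<and> b = i then {q} else {})) =
        of_bool (a = i \<and> b = j \<or> a = j \<and> b = i)"
    proof -
      consider "a = i" "b = j" | "a = j" "b = i" | "\<not> (a = i \<and> b = j)" "\<not> (a = j \<and> b = i)" by blast
      then show ?thesis
      proof cases
        case 1
        show ?thesis unfolding 1 using i by simp
      next
        case 2
        show ?thesis unfolding 2 using i by simp
      next
        case 3
        then show ?thesis by (simp only: if_False simp_thms of_bool_eq card.empty Un_empty_left)
      qed
    qed
    moreover have "card (darts_between m ?P a b) = w a b" using pg ab unfolding partial_graph_def by blast
    ultimately show ?thesis using w'[OF ab] by (simp only:)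
  qed
  moreover have "(pos(p := i * n + j)) z = 0" if "z \<notin> ?P'" for z
    using pg that unfolding P' by (auto simp: partial_graph_def)
  ultimately show ?thesis unfolding partial_graph_def using sum struct by blast
qed

text \<open>The machine cannot convert a real to a natural number, so the multiplicity
  \<open>2 * x\<close> is read off by the comparisons \<open>k < 2 * x\<close> for
  \<open>k = 0, 1, 2, 3\<close>, each adding at most one copy.\<close>

definition add_edge :: "nat \<Rightarrow> com" where
  "add_edge k = Cond (RLess (RLit (int k)) (RAdd (RRead 1 (var vIdx)) (RRead 1 (var vIdx))))
     (block [
        assign vX (NAdd (quad (var vI)) (NRead aDeg (var vI))),
        assign vY (NAdd (quad (var vJ)) (NRead aDeg (var vJ))),
        NWrite aMate (var vX) (var vY), NWrite aMate (var vY) (var vX),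
        NWrite aOwn (var vX) (var vI), NWrite aOwn (var vY) (var vJ),
        NWrite aPos (var vX) (var vIdx),
        RWrite rCost (var vX) (RRead 0 (var vIdx)), RWrite rCost (var vY) (RRead 0 (var vIdx)),
        NWrite aDeg (var vI) (NAdd (NRead aDeg (var vI)) (NLit 1)),
        NWrite aDeg (var vJ) (NAdd (NRead aDeg (var vJ)) (NLit 1))])
     Skip"

text \<open>In the absence of multiplication of naturals, the index \<open>i * n + j\<close> is
  maintained as a counter, which is why the scan visits all of the matrix and not only the part
  above the diagonal.\<close>

definition advance :: com where
  "advance = block [
     assign vJ (NAdd (var vJ) (NLit 1)), assign vIdx (NAdd (var vIdx) (NLit 1)),
     Cond (NLess (var vJ) (var vN)) Skip
       (block [assign vJ (NLit 0), assign vI (NAdd (var vI) (NLit 1))])]"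

definition build_body :: com where
  "build_body =
     Seq (Cond (NLess (var vI) (var vJ))
           (Seq (add_edge 0) (Seq (add_edge 1) (Seq (add_edge 2) (add_edge 3)))) Skip)
       advance"

definition build :: com where
  "build = While (NLess (var vI) (var vN)) build_body"

definition output_body :: com where
  "output_body = block [
     Cond (NLess (NLit 0) (NRead aSel (var vZ)))
       (NWrite aOut (NRead aPos (var vZ)) (NAdd (NRead aOut (NRead aPos (var vZ))) (NLit 1)))
       Skip,
     assign vZ (NAdd (var vZ) (NLit 1))]"

definition write_output :: com where
  "write_output = Seq (assign vZ (NLit 0)) (While (NLess (var vZ) (quad (var vN))) output_body)"

text \<open>The reduction relies on vertex \<open>0\<close>, which the test guarantees to
  exist.\<close>

definition program :: com where
  "program = Cond (NLess (NLit 0) (var vN)) (Seq build (Seq solve write_output)) Skip"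

lemma runs_output:
  assumes N: "val vN s = n" and zero: "\<And>y. nmem s aOut y = 0"
  shows "runs write_output s (1 + (4 * n * (steps output_body + 1) + 1))
    (\<lambda>s'. \<forall>y. nmem s' aOut y = card {z. z < 4 * n \<and> 0 < nmem s aSel z \<and> nmem s aPos z = y})"
proof -
  let ?b = "NLess (var vZ) (quad (var vN))"
  let ?s = "nwrite vZ 0 0 s"
  let ?D = "\<lambda>l y. {z. z < l \<and> 0 < nmem s aSel z \<and> nmem s aPos z = y}"
  let ?I = "\<lambda>s'. nmem s' aSel = nmem s aSel \<and> nmem s' aPos = nmem s aPos \<and> val vN s' = n \<and> val vZ s' \<le> 4 * n \<and>
     (\<forall>y. nmem s' aOut y = card (?D (val vZ s') y))"
  have "runs (While ?b output_body) ?s ((4 * n - val vZ ?s) * (steps output_body + 1) + 1) (\<lambda>s'. ?I s' \<and> \<not> bval ?b s')"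
  proof (rule runs_While[where \<mu> = "\<lambda>s. 4 * n - val vZ s"])
    show "?I ?s" using N zero by simp
    fix s1 assume I: "?I s1" and "bval ?b s1"
    then have lt: "val vZ s1 < 4 * n" by simp
    let ?l = "val vZ s1" and ?s1 = "result output_body s1"
    have D: "?D (Suc ?l) y = (if 0 < nmem s aSel ?l \<and> nmem s aPos ?l = y then insert ?l (?D ?l y) else ?D ?l y)" for y
      by (auto simp: less_Suc_eq)
    have fin: "finite (?D ?l y)" "?l \<notin> ?D ?l y" for y by auto
    have cD: "card (?D (Suc ?l) y) = card (?D ?l y) + of_bool (0 < nmem s aSel ?l \<and> nmem s aPos ?l = y)" for y
      unfolding D using fin by simp
    have "nmem ?s1 aOut y = nmem s1 aOut y + of_bool (0 < nmem s aSel ?l \<and> nmem s aPos ?l = y)" for y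
      using I unfolding output_body_def by simp
    then have "\<forall>y. nmem ?s1 aOut y = card (?D (Suc ?l) y)" unfolding cD using I by simp
    moreover have "val vZ ?s1 = Suc ?l" "nmem ?s1 aSel = nmem s aSel" "nmem ?s1 aPos = nmem s aPos" "val vN ?s1 = n"
      using I unfolding output_body_def by simp_all
    ultimately have "?I ?s1 \<and> 4 * n - val vZ ?s1 < 4 * n - val vZ s1" using lt by simp
    then show "runs output_body s1 (steps output_body) (\<lambda>s'. ?I s' \<and> 4 * n - val vZ s' < 4 * n - val vZ s1)"
      by (intro runs_result) (simp_all add: output_body_def)
  qed
  then have loop: "runs (While ?b output_body) ?s (4 * n * (steps output_body + 1) + 1)
     (\<lambda>s'. \<forall>y. nmem s' aOut y = card (?D (4 * n) y))"
  proof (rule runs_weaken)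
    fix s' assume "?I s' \<and> \<not> bval ?b s'"
    then have "?I s'" "val vZ s' = 4 * n" by auto
    then show "\<forall>y. nmem s' aOut y = card (?D (4 * n) y)" by simp
  qed simp
  have "runs (assign vZ (NLit 0)) s (steps (assign vZ (NLit 0)))
     (\<lambda>s'. runs (While ?b output_body) s' (4 * n * (steps output_body + 1) + 1)
        (\<lambda>s'. \<forall>y. nmem s' aOut y = card (?D (4 * n) y)))"
    by (rule runs_result) (use loop in simp_all)
  then show ?thesis unfolding write_output_def by (intro runs_Seq) simp
qed

lemma mg_cost_eq_sum:
  assumes "finite E" "set_mset H \<subseteq> E"
  shows "mg_cost c H = (\<Sum>e\<in>E. real (count H e) * c e)"
  using assms(2)
proof (induction H)
  case (add f H)
  have "(\<Sum>e\<in>E. real (count (add_mset f H) e) * c e) =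
      (\<Sum>e\<in>E. real (count H e) * c e + (if e = f then c f else 0))"
    by (rule sum.cong) (auto simp: algebra_simps)
  also have "\<dots> = mg_cost c H + c f"
    using add assms(1) by (simp add: sum.distrib)
  finally show ?case by (simp add: mg_cost_def)
qed (simp add: mg_cost_def)

lemma row_major_inj:
  fixes n :: nat
  assumes "a * n + b = i * n + j" "b < n" "j < n"
  shows "a = i \<and> b = j"
proof -
  have "a = (a * n + b) div n" using assms(2) by simp
  also have "\<dots> = (i * n + j) div n" by (simp only: assms(1))
  also have "\<dots> = i" using assms(3) by simp
  finally have "a = i" .
  then show ?thesis using assms by simp
qed

lemma matrix_entry: "i < n \<Longrightarrow> j < n \<Longrightarrow> i \<noteq> j \<Longrightarrow> matrix n f (i * n + j) = f {i, j}"
proof -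
  assume ij: "i < n" "j < n" "i \<noteq> j"
  have "i * n + j < (i + 1) * n" using ij by simp
  also have "\<dots> \<le> n * n" using ij by (intro mult_right_mono) auto
  finally show ?thesis using ij by (simp add: matrix_def)
qed

definition time_bound :: "nat \<Rightarrow> nat" where
  "time_bound n = (n * n * (steps build_body + 1) + 1) +
     (((n * (reduce_time n + 1) + 1) + (steps select_loop + (n * (steps unwind_body + 1) + 1))) +
      (1 + (4 * n * (steps output_body + 1) + 1))) + 1"

section \<open>From the half-integral solution to the dart graph, and from selected darts to the
  output\<close>

locale half_integral_instance =
  fixes n :: nat and c x :: "nat set \<Rightarrow> real"
  assumes nonneg: "\<And>e. e \<in> edges n \<Longrightarrow> 0 \<le> c e"
    and feasible: "subtour_feasible n x" and half: "half_integral n x" and pos: "0 < n"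
begin

definition mult :: "nat \<Rightarrow> nat \<Rightarrow> nat" where
  "mult a b = (if a = b then 0 else nat \<lfloor>2 * x {a, b}\<rfloor>)"

lemma mult_commute: "mult a b = mult b a"
  by (auto simp: mult_def insert_commute)

lemma real_mult: "a < n \<Longrightarrow> b < n \<Longrightarrow> a \<noteq> b \<Longrightarrow> real (mult a b) = 2 * x {a, b}"
proof -
  assume ab: "a < n" "b < n" "a \<noteq> b"
  then have "2 * x {a, b} \<in> \<nat>" using half by (simp add: half_integral_def doubleton_in_edges)
  then obtain k where "2 * x {a, b} = real k" by (auto simp: Nats_def)
  then show ?thesis using ab by (simp add: mult_def)
qed

lemma sum_mult_cut:
  assumes "S \<subseteq> {..<n}"
  shows "real (\<Sum>(a, b)\<in>S \<times> ({..<n} - S). mult a b) = 2 * (\<Sum>e\<in>cut n S. x e)"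
proof -
  have "real (\<Sum>(a, b)\<in>S \<times> ({..<n} - S). mult a b) = (\<Sum>(a, b)\<in>S \<times> ({..<n} - S). 2 * x {a, b})"
    unfolding of_nat_sum
  proof (rule sum.cong)
    fix p assume "p \<in> S \<times> ({..<n} - S)"
    then obtain a b where p: "p = (a, b)" "a \<in> S" "b \<in> {..<n} - S" by auto
    then have "a < n" "b < n" "a \<noteq> b" using assms by auto
    then show "real (case p of (a, b) \<Rightarrow> mult a b) = (case p of (a, b) \<Rightarrow> 2 * x {a, b})"
      using real_mult p by simp
  qed simp
  also have "\<dots> = 2 * (\<Sum>e\<in>cut n S. x e)"
    unfolding sum_cut[OF assms] by (simp add: sum_distrib_left case_prod_unfold)
  finally show ?thesis .
qed

text \<open>The degree constraint of the linear program, doubled.\<close>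

lemma sum_mult: "u < n \<Longrightarrow> (\<Sum>y<n. mult u y) = 4"
proof -
  assume u: "u < n"
  have "(\<Sum>y<n. mult u y) = (\<Sum>y\<in>{..<n} - {u}. mult u y)"
    by (rule sum.mono_neutral_right) (auto simp: mult_def)
  also have "\<dots> = (\<Sum>(a, b)\<in>{u} \<times> ({..<n} - {u}). mult a b)"
    by (simp add: sum.cartesian_product[symmetric])
  finally have "real (\<Sum>y<n. mult u y) = 2 * (\<Sum>e\<in>cut n {u}. x e)"
    using sum_mult_cut[of "{u}"] u by simp
  also have "\<dots> = 4" using feasible u by (simp add: subtour_feasible_def)
  finally show ?thesis by linarith
qed

lemma mult_le: "a < n \<Longrightarrow> b < n \<Longrightarrow> mult a b \<le> 4"
  using sum_mult[of a] member_le_sum[of b "{..<n}" "mult a"] by simp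

text \<open>The row-major index of the matrix cell above the diagonal that belongs to the edge
  \<open>{a, b}\<close>.\<close>

definition key :: "nat \<Rightarrow> nat \<Rightarrow> nat" where
  "key a b = min a b * n + max a b"

text \<open>The multiplicities of the edges that are present when all edges of index less than \<open>l\<close> and
  the first \<open>h\<close> copies of the edge of index \<open>l\<close> have been added.\<close>

definition added :: "nat \<Rightarrow> nat \<Rightarrow> nat \<Rightarrow> nat \<Rightarrow> nat" where
  "added l h a b = (if key a b < l then mult a b else if key a b = l then min h (mult a b) else 0)"

lemma added_le: "added l h a b \<le> mult a b"
  by (simp add: added_def)

lemma key_eq:
  assumes "i < j" "j < n" "a < n" "b < n"
  shows "key a b = i * n + j \<longleftrightarrow> a = i \<and> b = j \<or> a = j \<and> b = i"
proof
  assume "key a b = i * n + j"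
  then have "min a b = i \<and> max a b = j" using assms by (intro row_major_inj) (auto simp: key_def)
  then show "a = i \<and> b = j \<or> a = j \<and> b = i" by (auto simp: min_def max_def split: if_splits)
next
  assume "a = i \<and> b = j \<or> a = j \<and> b = i"
  then show "key a b = i * n + j"
  proof
    assume "a = i \<and> b = j" then show ?thesis using assms by (simp add: key_def)
  next
    assume "a = j \<and> b = i" then show ?thesis using assms by (simp add: key_def)
  qed
qed

text \<open>A cell on or below the diagonal is the key of no pair of distinct vertices, and loops
  have multiplicity 0.\<close>

lemma added_skip:
  assumes "j \<le> i" "j < n" "a < n" "b < n"
  shows "added (i * n + j) 0 a b = added (Suc (i * n + j)) 0 a b"
proof -
  have "mult a b = 0" if "key a b = i * n + j"
  proof -
    have "min a b = i \<and> max a b = j" using that assms by (intro row_major_inj) (auto simp: key_def)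
    then have "a = b" using assms by (auto simp: min_def max_def split: if_splits)
    then show ?thesis by (simp add: mult_def)
  qed
  then show ?thesis by (auto simp: added_def less_Suc_eq)
qed

text \<open>No multiplicity exceeds the degree 4, so four rounds insert all copies.\<close>

lemma added_next: "a < n \<Longrightarrow> b < n \<Longrightarrow> added l 4 a b = added (Suc l) 0 a b"
  using mult_le by (auto simp: added_def less_Suc_eq)

abbreviation graph_part :: "(nat \<Rightarrow> nat \<Rightarrow> nat) \<Rightarrow> state \<Rightarrow> bool" where
  "graph_part w s \<equiv> partial_graph n c w (nmem s aDeg) (nmem s aMate) (nmem s aOwn) (nmem s aPos) (rmem s rCost)"

lemma graph_part_cong:
  assumes "graph_part w s" "\<And>a b. a < n \<Longrightarrow> b < n \<Longrightarrow> w a b = w' a b"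
  shows "graph_part w' s"
  using assms by (simp add: partial_graph_def)

definition loaded :: "nat \<Rightarrow> nat \<Rightarrow> state \<Rightarrow> bool" where
  "loaded i j s \<longleftrightarrow> val vN s = n \<and> val vI s = i \<and> val vJ s = j \<and> val vIdx s = i * n + j \<and>
     rmem s 0 = matrix n c \<and> rmem s 1 = matrix n x"

lemma add_edge_result:
  assumes s: "loaded i j s" "graph_part (added (i * n + j) k) s" and ij: "i < j" "j < n"
  shows "loaded i j (result (add_edge k) s) \<and> graph_part (added (i * n + j) (Suc k)) (result (add_edge k) s)"
proof (cases "k < mult i j")
  case False
  have ne: "i \<noteq> j" "i < n" using ij by auto
  have "real (mult i j) = 2 * x {i, j}" using real_mult ne ij by simp
  moreover have "rmem s 1 (val vIdx s) = x {i, j}" using s(1) ne ij by (simp add: loaded_def matrix_entry)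
  ultimately have r: "result (add_edge k) s = s" unfolding add_edge_def using False by simp
  have "added (i * n + j) k a b = added (i * n + j) (Suc k) a b" if "a < n" "b < n" for a b
  proof -
    have "mult a b \<le> k" if "key a b = i * n + j"
      using that key_eq[OF ij \<open>a < n\<close> \<open>b < n\<close>] False mult_commute by auto
    then show ?thesis by (auto simp: added_def)
  qed
  then show ?thesis unfolding r using graph_part_cong[OF s(2)] s(1) by blast
next
  case True
  let ?w = "added (i * n + j) k" and ?w' = "added (i * n + j) (Suc k)" and ?s = "result (add_edge k) s"
  have ne: "i \<noteq> j" "i < n" using ij by auto
  have x: "real (mult i j) = 2 * x {i, j}" using real_mult ne ij by simp
  have m: "rmem s 1 (val vIdx s) = x {i, j}" "rmem s 0 (val vIdx s) = c {i, j}"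
    using s(1) ne ij by (simp_all add: loaded_def matrix_entry)
  have v: "val vI s = i" "val vJ s = j" "val vIdx s = i * n + j" using s(1) by (auto simp: loaded_def)
  let ?p = "4 * i + nmem s aDeg i" and ?q = "4 * j + nmem s aDeg j"
  have k: "key i j = i * n + j" "key j i = i * n + j" using ij by (auto simp: key_def)
  \<comment> \<open>While a copy is still missing, the current degree is strictly below the final
    degree 4, which leaves a free slot.\<close>
  have room: "nmem s aDeg u < 4" if u: "u < n" "y < n" and k': "key u y = i * n + j" and lt: "k < mult u y" for u y
  proof -
    have "nmem s aDeg u = (\<Sum>y<n. ?w u y)" using s(2) u by (simp add: partial_graph_def)
    also have "\<dots> < (\<Sum>y<n. mult u y)"
    proof (rule sum_strict_mono_ex1)
      show "\<exists>y\<in>{..<n}. ?w u y < mult u y"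
        using u lt k' by (intro bexI[of _ y]) (auto simp: added_def)
    qed (auto simp: added_le)
    finally show ?thesis using sum_mult u by simp
  qed
  have room_i: "nmem s aDeg i < 4" using room[of i j] k ne ij True by simp
  have room_j: "nmem s aDeg j < 4" using room[of j i] k ne ij True mult_commute[of i j] by simp
  have w': "?w' a b = ?w a b + of_bool (a = i \<and> b = j \<or> a = j \<and> b = i)" if "a < n" "b < n" for a b
  proof (cases "a = i \<and> b = j \<or> a = j \<and> b = i")
    case T: True
    then have "k < mult a b" using True mult_commute by auto
    moreover have "key a b = i * n + j" using T key_eq[OF ij that] by blast
    ultimately show ?thesis using T by (simp add: added_def)
  next
    case F: False
    then have "key a b \<noteq> i * n + j" using key_eq[OF ij that] by blast
    then have "?w' a b = ?w a b" by (simp add: added_def)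
    then show ?thesis using F by (simp only: of_bool_eq add_0_right)
  qed
  have g: "graph_part ?w' ?s"
    using partial_graph_add_edge[OF s(2) ij room_i room_j refl refl w'] ne True x m v
    unfolding add_edge_def by simp
  have "loaded i j ?s" using s(1) True x m unfolding add_edge_def loaded_def by simp
  then show ?thesis using g by blast
qed

definition build_state :: "state \<Rightarrow> bool" where
  "build_state s \<longleftrightarrow> (\<exists>i j. loaded i j s \<and> j < n \<and> i \<le> n \<and> (i = n \<longrightarrow> j = 0) \<and> graph_part (added (i * n + j) 0) s)"

lemma loop_free_build_body: "loop_free build_body"
  by (simp add: build_body_def add_edge_def advance_def)

lemma build_body_result:
  assumes s: "build_state s" "val vI s < n"
  shows "build_state (result build_body s) \<and> val vIdx (result build_body s) = Suc (val vIdx s) \<and> val vIdx s < n * n"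
proof -
  obtain i j where l: "loaded i j s" and j: "j < n" and g: "graph_part (added (i * n + j) 0) s"
    using s(1) by (auto simp: build_state_def)
  have i: "i < n" using s(2) l by (simp add: loaded_def)
  define s1 where "s1 = result (Cond (NLess (var vI) (var vJ))
           (Seq (add_edge 0) (Seq (add_edge 1) (Seq (add_edge 2) (add_edge 3)))) Skip) s"
  have s1: "loaded i j s1 \<and> graph_part (added (Suc (i * n + j)) 0) s1"
  proof (cases "i < j")
    case True
    let ?l = "i * n + j"
    define t1 where "t1 = result (add_edge 0) s"
    define t2 where "t2 = result (add_edge 1) t1"
    define t3 where "t3 = result (add_edge 2) t2"
    have 1: "loaded i j t1" "graph_part (added ?l 1) t1"
      using add_edge_result[OF l g True j] by (auto simp: t1_def)
    have 2: "loaded i j t2" "graph_part (added ?l 2) t2"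
      using add_edge_result[OF 1 True j] by (auto simp: t2_def numeral_2_eq_2)
    have 3: "loaded i j t3" "graph_part (added ?l 3) t3"
      using add_edge_result[OF 2 True j] by (auto simp: t3_def eval_nat_numeral)
    have 4: "loaded i j (result (add_edge 3) t3)" "graph_part (added ?l 4) (result (add_edge 3) t3)"
      using add_edge_result[OF 3 True j] by (auto simp: eval_nat_numeral)
    have "s1 = result (add_edge 3) t3"
      using True l unfolding s1_def t3_def t2_def t1_def by (simp add: loaded_def)
    then show ?thesis using 4 graph_part_cong[OF 4(2) added_next] by simp
  next
    case False
    then have "s1 = s" using l unfolding s1_def by (simp add: loaded_def)
    then show ?thesis using l graph_part_cong[OF g added_skip] False j by simp
  qed
  define s2 where "s2 = result advance s1"
  have body: "result build_body s = s2" unfolding s2_def s1_def build_body_def by simp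
  have gs: "graph_part (added (Suc (i * n + j)) 0) s2"
    using s1 unfolding s2_def advance_def by simp
  have idx: "val vIdx s2 = Suc (val vIdx s)"
    using s1 l unfolding s2_def advance_def loaded_def by simp
  have "i * n + j < (i + 1) * n" using j by simp
  also have "\<dots> \<le> n * n" using i by (intro mult_right_mono) auto
  finally have bound: "val vIdx s < n * n" using l by (simp add: loaded_def)
  have "build_state s2"
  proof (cases "Suc j < n")
    case True
    have "loaded i (Suc j) s2" using s1 True unfolding s2_def advance_def loaded_def by simp
    then show ?thesis unfolding build_state_def using gs True i by (intro exI[of _ i] exI[of _ "Suc j"]) simp
  next
    case False
    then have n: "n = Suc j" using j by simp
    have "loaded (Suc i) 0 s2" using s1 n unfolding s2_def advance_def loaded_def by simp
    moreover have "Suc (i * n + j) = Suc i * n + 0" using n by simp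
    ultimately have "loaded (Suc i) 0 s2 \<and> 0 < n \<and> Suc i \<le> n \<and> (Suc i = n \<longrightarrow> 0 = (0 :: nat)) \<and>
        graph_part (added (Suc i * n + 0) 0) s2" using gs i pos by (simp only:) simp
    then show ?thesis unfolding build_state_def by blast
  qed
  then show ?thesis using body idx bound by simp
qed

lemma runs_build:
  assumes "build_state s"
  shows "runs build s (n * n * (steps build_body + 1) + 1) (\<lambda>s'. val vN s' = n \<and> graph_part mult s')"
proof -
  let ?b = "NLess (var vI) (var vN)"
  have N: "val vN s' = n" if "build_state s'" for s' using that by (auto simp: build_state_def loaded_def)
  have "runs build s ((n * n - val vIdx s) * (steps build_body + 1) + 1) (\<lambda>s'. build_state s' \<and> \<not> bval ?b s')"
    unfolding build_def
  proof (rule runs_While[where \<mu> = "\<lambda>s. n * n - val vIdx s"])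
    show "build_state s" by (rule assms)
    fix s1 assume I: "build_state s1" "bval ?b s1"
    then have "val vI s1 < n" using N by simp
    from build_body_result[OF I(1) this]
    show "runs build_body s1 (steps build_body) (\<lambda>s'. build_state s' \<and> n * n - val vIdx s' < n * n - val vIdx s1)"
      by (intro runs_result[OF loop_free_build_body]) auto
  qed
  then show ?thesis
  proof (rule runs_weaken)
    fix s' assume *: "build_state s' \<and> \<not> bval ?b s'"
    then obtain i j where l: "loaded i j s'" "i \<le> n" "i = n \<longrightarrow> j = 0" "graph_part (added (i * n + j) 0) s'"
      by (auto simp: build_state_def)
    have "i = n" "j = 0" using * l N by (auto simp: loaded_def)
    then have g: "graph_part (added (n * n) 0) s'" using l by simp
    have "graph_part mult s'"
    proof (rule graph_part_cong[OF g])
      fix a b assume ab: "a < n" "b < n"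
      have "key a b < (min a b + 1) * n" using ab by (auto simp: key_def)
      also have "\<dots> \<le> n * n" using ab by (intro mult_right_mono) auto
      finally show "added (n * n) 0 a b = mult a b" by (simp add: added_def)
    qed
    then show "val vN s' = n \<and> graph_part mult s'" using * N by simp
  qed (intro add_mono mult_right_mono, auto)
qed

lemma initial_build_state: "build_state (input_state n c x)"
proof -
  let ?s = "input_state n c x"
  have "loaded 0 0 ?s" by (simp add: loaded_def input_state_def)
  moreover have "graph_part (added 0 0) ?s"
  proof -
    have "added 0 0 a b = 0" for a b by (simp add: added_def)
    moreover have "placed n (nmem ?s aDeg) = {}" by (auto simp: placed_def input_state_def owner_def)
    ultimately show ?thesis unfolding partial_graph_def
      by (auto simp: input_state_def darts_between_def)
  qed
  ultimately show ?thesis unfolding build_state_def using pos by (intro exI[of _ 0]) simp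
qed

context
  fixes deg m own ps :: "nat \<Rightarrow> nat" and cost :: "nat \<Rightarrow> real"
  assumes complete: "partial_graph n c mult deg m own ps cost"
begin

lemma placed_complete: "placed n deg = darts {..<n}"
proof -
  have "deg u = 4" if "u < n" for u using complete that sum_mult by (simp add: partial_graph_def)
  moreover have "z < 4 * owner z + 4" for z unfolding owner_def by presburger
  ultimately show ?thesis by (auto simp: placed_def)
qed

lemma complete_dart:
  assumes "owner z < n"
  shows "owner (m z) < n" "m (m z) = z" "owner (m z) \<noteq> owner z" "own z = owner z"
    "cost z = c {owner z, owner (m z)}"
    "ps z = (if owner z < owner (m z) then owner z * n + owner (m z) else 0)"
proof -
  have "z \<in> placed n deg" unfolding placed_complete using assms by simp
  then have "m z \<in> placed n deg \<and> m (m z) = z \<and> owner (m z) \<noteq> owner z \<and> own z = owner z \<and>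
        cost z = c {owner z, owner (m z)} \<and>
        ps z = (if owner z < owner (m z) then owner z * n + owner (m z) else 0)"
    using complete unfolding partial_graph_def by blast
  then show "owner (m z) < n" "m (m z) = z" "owner (m z) \<noteq> owner z" "own z = owner z"
    "cost z = c {owner z, owner (m z)}"
    "ps z = (if owner z < owner (m z) then owner z * n + owner (m z) else 0)"
    unfolding placed_complete by simp_all
qed

lemma card_darts_between: "a < n \<Longrightarrow> b < n \<Longrightarrow> card (darts_between m (darts {..<n}) a b) = mult a b"
  using complete unfolding partial_graph_def placed_complete by blast

lemma complete_dart_graph: "dart_graph {..<n} m"
  unfolding dart_graph_def using complete_dart(1-3) by fastforce

text \<open>By construction the number of crossing darts is twice \<open>x(cut n S)\<close>, and the
  cut constraints bound this by 4 from below.\<close>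

lemma complete_four_edge_connected: "four_edge_connected {..<n} m"
  unfolding four_edge_connected_def
proof (intro conjI allI impI complete_dart_graph)
  fix S assume S: "S \<noteq> {} \<and> S \<subset> {..<n}"
  have "crossing {..<n} m S \<inter> darts {..<n} = crossing {..<n} m S" using S by (auto simp: crossing_def)
  then have "card (crossing {..<n} m S) =
      (\<Sum>(a, b)\<in>S \<times> ({..<n} - S). card (darts_between m (darts {..<n}) a b))"
    using card_crossing_eq_sum[of "darts {..<n}" n m S] complete_dart(1) psubset_imp_subset[OF conjunct2[OF S]] by simp
  also have "\<dots> = (\<Sum>(a, b)\<in>S \<times> ({..<n} - S). mult a b)"
    by (rule sum.cong) (use S card_darts_between in auto)
  finally have "real (card (crossing {..<n} m S)) = 2 * (\<Sum>e\<in>cut n S. x e)"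
    using sum_mult_cut[OF psubset_imp_subset[OF conjunct2[OF S]]] by simp
  moreover have "2 \<le> (\<Sum>e\<in>cut n S. x e)" using feasible S by (auto simp: subtour_feasible_def)
  ultimately show "4 \<le> card (crossing {..<n} m S)" by linarith
qed

lemma complete_symmetric_cost: "symmetric_cost {..<n} m cost"
  unfolding symmetric_cost_def using complete_dart by (auto simp: insert_commute)

context
  fixes X :: "nat set" and s :: state
  assumes sel: "selection {..<n} m cost X"
    and out: "\<And>y. nmem s aOut y = card {z. z < 4 * n \<and> z \<in> X \<and> ps z = y}"
begin

lemma selected_darts: "X \<subseteq> darts {..<n}" "finite X" "\<And>z. z \<in> X \<Longrightarrow> owner z < n \<and> owner (m z) < n"
  "\<And>z. z \<in> X \<Longrightarrow> m z \<in> X"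
proof -
  show X: "X \<subseteq> darts {..<n}" "\<And>z. z \<in> X \<Longrightarrow> m z \<in> X" using sel by (auto simp: selection_def)
  then show "finite X" using finite_subset by (metis finite_darts finite_lessThan)
  show "\<And>z. z \<in> X \<Longrightarrow> owner z < n \<and> owner (m z) < n" using X complete_dart(1) by auto
qed

lemma count_output:
  assumes "a < n" "b < n" "a \<noteq> b"
  shows "count (output_multigraph n s) {a, b} = card (darts_between m X a b)"
proof -
  have less: "count (output_multigraph n s) {a, b} = card (darts_between m X a b)" if ab: "a < b" "b < n" for a b
  proof -
    have "{z. z < 4 * n \<and> z \<in> X \<and> ps z = a * n + b} = darts_between m X a b"
    proof (intro equalityI subsetI)
      fix z assume "z \<in> {z. z < 4 * n \<and> z \<in> X \<and> ps z = a * n + b}"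
      then have z: "z \<in> X" "ps z = a * n + b" by auto
      have o: "owner z < n" "owner (m z) < n" using selected_darts(3)[OF z(1)] by auto
      \<comment> \<open>As \<open>a * n + b\<close> is positive, the default position 0 is excluded,
        so \<open>z\<close> is the dart at the smaller end.\<close>
      have "owner z < owner (m z)" "owner z * n + owner (m z) = a * n + b"
        using complete_dart(6)[OF o(1)] z(2) ab by (auto split: if_splits)
      then have "owner z = a \<and> owner (m z) = b" using row_major_inj[OF _ o(2) ab(2)] by blast
      then show "z \<in> darts_between m X a b" using z by (simp add: darts_between_def)
    next
      fix z assume "z \<in> darts_between m X a b"
      then have z: "z \<in> X" "owner z = a" "owner (m z) = b" by (auto simp: darts_between_def)
      have "owner z < n" using selected_darts(3)[OF z(1)] by simp
      then show "z \<in> {z. z < 4 * n \<and> z \<in> X \<and> ps z = a * n + b}"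
        using complete_dart(6)[of z] z ab by (auto simp: owner_def)
    qed
    then show ?thesis using count_output_multigraph[OF ab] out by simp
  qed
  show ?thesis
  proof (cases "a < b")
    case True
    then show ?thesis using less assms by simp
  next
    case False
    have "bij_betw m (darts_between m X b a) (darts_between m X a b)"
      by (rule bij_betw_byWitness[where f' = m])
        (use selected_darts(3,4) complete_dart(2) in \<open>auto simp: darts_between_def\<close>)
    then have "card (darts_between m X b a) = card (darts_between m X a b)" by (rule bij_betw_same_card)
    then show ?thesis using less[of b a] False assms by (simp add: insert_commute)
  qed
qed

lemma output_spanning: "spanning_multisubgraph n (output_multigraph n s)"
  unfolding spanning_multisubgraph_def output_multigraph_def
  by (auto simp: set_mset_sum finite_edges split: if_splits)

lemma output_two_edge_connected: "two_edge_connected {..<n} (output_multigraph n s)"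
proof (rule two_edge_connectedI)
  fix S :: "nat set" assume S: "S \<noteq> {}" "S \<subset> {..<n}"
  have "2 \<le> card (crossing {..<n} m S \<inter> X)" using sel S by (auto simp: selection_def)
  also have "\<dots> = (\<Sum>(a, b)\<in>S \<times> ({..<n} - S). card (darts_between m X a b))"
    by (rule card_crossing_eq_sum) (use selected_darts S in auto)
  also have "\<dots> = (\<Sum>(a, b)\<in>S \<times> ({..<n} - S). count (output_multigraph n s) {a, b})"
  proof (rule sum.cong)
    fix p assume "p \<in> S \<times> ({..<n} - S)"
    then obtain a b where p: "p = (a, b)" "a \<in> S" "b \<in> {..<n} - S" by auto
    then have "a < n" "b < n" "a \<noteq> b" using S by auto
    then show "(case p of (a, b) \<Rightarrow> card (darts_between m X a b)) =
        (case p of (a, b) \<Rightarrow> count (output_multigraph n s) {a, b})"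
      using count_output p by simp
  qed simp
  also have "\<dots> = (\<Sum>e\<in>cut n S. count (output_multigraph n s) e)"
    using S by (intro sum_cut[symmetric]) auto
  finally show "2 \<le> (\<Sum>e\<in>cut n S. count (output_multigraph n s) e)" .
qed

lemma sum_cost_pairs:
  assumes "Y \<subseteq> darts {..<n}" "\<And>a b. a < n \<Longrightarrow> b < n \<Longrightarrow> a \<noteq> b \<Longrightarrow> real (card (darts_between m Y a b)) = h {a, b}"
  shows "sum cost Y = 2 * (\<Sum>e\<in>edges n. h e * c e)"
proof -
  have Y: "finite Y" "\<And>z. z \<in> Y \<Longrightarrow> owner z < n \<and> owner (m z) < n"
    using assms(1) finite_subset[OF assms(1)] complete_dart(1) by auto
  have "sum cost Y = (\<Sum>z\<in>Y. c {owner z, owner (m z)})"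
    by (rule sum.cong) (use Y complete_dart(5) in auto)
  also have "\<dots> = (\<Sum>(a, b)\<in>{..<n} \<times> {..<n}. real (card (darts_between m Y a b)) * c {a, b})"
    by (rule sum_darts_between[OF Y])
  also have "\<dots> = (\<Sum>(a, b)\<in>{..<n} \<times> {..<n}. if a = b then 0 else h {a, b} * c {a, b})"
  proof (rule sum.cong)
    fix p assume "p \<in> {..<n} \<times> {..<n}"
    then obtain a b where p: "p = (a, b)" "a < n" "b < n" by auto
    have "darts_between m Y a a = {}" using Y complete_dart(3) by (auto simp: darts_between_def)
    then show "(case p of (a, b) \<Rightarrow> real (card (darts_between m Y a b)) * c {a, b}) =
      (case p of (a, b) \<Rightarrow> if a = b then 0 else h {a, b} * c {a, b})"
      using p assms(2)[of a b] by auto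
  qed simp
  also have "\<dots> = 2 * (\<Sum>e\<in>edges n. h e * c e)" by (rule sum_pairs_edges)
  finally show ?thesis .
qed

text \<open>Every edge has two darts and \<open>2 * x\<close> copies, so all darts together cost 4
  times the value of the linear program. The selected darts cost at most 2/3 of this and twice as
  much as the output, which leaves 4/3.\<close>

lemma output_cost: "mg_cost c (output_multigraph n s) \<le> 4 / 3 * lp_cost n c x"
proof -
  let ?H = "output_multigraph n s"
  have "mg_cost c ?H = (\<Sum>e\<in>edges n. real (count ?H e) * c e)"
    by (rule mg_cost_eq_sum) (use output_spanning finite_edges in \<open>auto simp: spanning_multisubgraph_def\<close>)
  then have "2 * mg_cost c ?H = sum cost X"
    using sum_cost_pairs[OF selected_darts(1), of "\<lambda>e. real (count ?H e)"] count_output by simp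
  also have "\<dots> \<le> 2 / 3 * sum cost (darts {..<n} - {0, m 0})" using sel by (simp add: selection_def)
  \<comment> \<open>The root edge is added back; its cost is nonnegative.\<close>
  also have "\<dots> \<le> 2 / 3 * sum cost (darts {..<n})"
  proof -
    have "0 \<le> cost z" if "z \<in> darts {..<n}" for z
      using complete_dart[of z] that nonneg doubleton_in_edges by auto
    then have "sum cost (darts {..<n} - {0, m 0}) \<le> sum cost (darts {..<n})"
      by (intro sum_mono2) auto
    then show ?thesis by simp
  qed
  also have "sum cost (darts {..<n}) = 2 * (\<Sum>e\<in>edges n. 2 * x e * c e)"
    by (rule sum_cost_pairs) (use card_darts_between real_mult in auto)
  also have "\<dots> = 4 * lp_cost n c x"
    by (simp add: lp_cost_def sum_distrib_left mult_ac)
  finally show ?thesis by simp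
qed

end

end

lemma runs_program:
  "runs program (input_state n c x) (time_bound n) (\<lambda>s. spanning_multisubgraph n (output_multigraph n s) \<and>
     two_edge_connected {..<n} (output_multigraph n s) \<and>
     mg_cost c (output_multigraph n s) \<le> 4 / 3 * lp_cost n c x)"
  (is "runs _ ?s0 _ ?Q")
proof -
  have wb: "nwritten build \<subseteq> {aMate, aOwn, aPos, aDeg, vX, vY, vI, vJ, vIdx}"
    by (simp add: build_def build_body_def add_edge_def advance_def)
  have ws: "aOut \<notin> nwritten solve" "aPos \<notin> nwritten solve" "vN \<notin> nwritten solve"
    by (simp_all add: solve_def select_loop_def unwind_loop_def unwind_body_def reduce_def reduce_body_def
        find_darts_def other_dart_def choose_pairing_def order_pairing_def
        split_vertex_def max_flow_def flow_round_def search_def search_init_def search_body_def scan_def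
        augment_def augment_body_def reset_flow_def reset_body_def)
  have zero: "nmem ?s0 a i = 0" if "a \<noteq> 0" for a i using that by (simp add: input_state_def)
  have "runs (Seq build (Seq solve write_output)) ?s0 (time_bound n - 1) ?Q"
    unfolding time_bound_def add_diff_cancel_right'
  proof (rule runs_Seq, rule runs_weaken[OF runs_frame[OF runs_build[OF initial_build_state]] order_refl])
    fix s1 :: state
    assume *: "(val vN s1 = n \<and> graph_part mult s1) \<and>
      (\<forall>a. a \<notin> nwritten build \<longrightarrow> nmem s1 a = nmem ?s0 a) \<and> (\<forall>a. a \<notin> rwritten build \<longrightarrow> rmem s1 a = rmem ?s0 a)"
    then have g: "graph_part mult s1" and N: "val vN s1 = n" by auto
    have z1: "nmem s1 a i = 0" if "a \<notin> {0, aMate, aOwn, aPos, aDeg, vX, vY, vI, vJ, vIdx}" for a i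
    proof -
      have "a \<notin> nwritten build" "a \<noteq> 0" using that wb by auto
      then show ?thesis using * zero by simp
    qed
    let ?m = "nmem s1 aMate" and ?c = "rmem s1 rCost"
    have "reduced n ?m ?c {..<n} s1"
      unfolding reduced_def
      using N pos complete_four_edge_connected[OF g] complete_symmetric_cost[OF g] complete_dart(4)[OF g] z1
      by simp
    moreover have "\<And>z. nmem s1 aSel z = 0" using z1 by simp
    ultimately have "runs solve s1 ((n * (reduce_time n + 1) + 1) + (steps select_loop + (n * (steps unwind_body + 1) + 1)))
      (\<lambda>s'. selection {..<n} ?m ?c {z. 0 < nmem s' aSel z})" by (rule runs_solve)
    from runs_frame[OF this]
    show "runs (Seq solve write_output) s1 (((n * (reduce_time n + 1) + 1) + (steps select_loop + (n * (steps unwind_body + 1) + 1))) +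
      (1 + (4 * n * (steps output_body + 1) + 1))) ?Q"
    proof (intro runs_Seq, elim runs_weaken)
      fix s2 :: state
      assume "selection {..<n} ?m ?c {z. 0 < nmem s2 aSel z} \<and>
        (\<forall>a. a \<notin> nwritten solve \<longrightarrow> nmem s2 a = nmem s1 a) \<and> (\<forall>a. a \<notin> rwritten solve \<longrightarrow> rmem s2 a = rmem s1 a)"
      then have sel: "selection {..<n} ?m ?c {z. 0 < nmem s2 aSel z}"
        and out: "\<And>y. nmem s2 aOut y = 0" and ps: "nmem s2 aPos = nmem s1 aPos" and N2: "val vN s2 = n"
        using ws z1 N by auto
      show "runs write_output s2 (1 + (4 * n * (steps output_body + 1) + 1)) ?Q"
      proof (rule runs_weaken[OF runs_output[OF N2 out] order_refl])
        fix s3 :: state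
        assume "\<forall>y. nmem s3 aOut y = card {z. z < 4 * n \<and> 0 < nmem s2 aSel z \<and> nmem s2 aPos z = y}"
        then have o: "\<And>y. nmem s3 aOut y = card {z. z < 4 * n \<and> z \<in> {z. 0 < nmem s2 aSel z} \<and> nmem s1 aPos z = y}"
          by (simp add: ps)
        show "?Q s3"
          using output_spanning[OF g sel o] output_two_edge_connected[OF g sel o] output_cost[OF g sel o] by blast
      qed
    qed simp_all
  qed
  then have "runs program ?s0 (time_bound n - 1 + 1) ?Q"
    unfolding program_def by (rule runs_Cond) (use pos in \<open>simp add: input_state_def\<close>)
  then show ?thesis by (simp add: time_bound_def)
qed

end

section \<open>The quadratic time bound\<close>

lemma quadratic_bigo: "(\<lambda>n. real (a * (n * n) + b * n + d)) \<in> O(\<lambda>n. real n ^ 2)"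
proof (rule bigoI[where c = "real (a + b + d)"])
  have "a * (n * n) + b * n + d \<le> (a + b + d) * (n * n)" if "1 \<le> n" for n :: nat
  proof -
    have "a * (n * n) + b * n + d * 1 \<le> a * (n * n) + b * (n * n) + d * (n * n)"
      using that by (intro add_mono mult_left_mono order_refl) auto
    then show ?thesis by (simp only: distrib_right mult_1_right)
  qed
  then have "real (a * (n * n) + b * n + d) \<le> real (a + b + d) * real n ^ 2" if "1 \<le> n" for n :: nat
    using that by (metis of_nat_le_iff of_nat_mult power2_eq_square)
  then show "\<forall>\<^sub>F n in sequentially. norm (real (a * (n * n) + b * n + d)) \<le> real (a + b + d) * norm (real n ^ 2)"
    by (intro eventually_sequentiallyI[of 1]) (simp only: norm_of_nat norm_power)
qed

lemma time_bound_bigo: "(\<lambda>n. real (time_bound n)) \<in> O(\<lambda>n. real n ^ 2)"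
proof -
  \<comment> \<open>The quadratic coefficient collects the scan of the input matrices and at most
    \<open>n\<close> reductions, each with flow rounds that are linear in \<open>n\<close>.\<close>
  have "\<exists>a b d. \<forall>n. time_bound n = a * (n * n) + b * n + d"
  proof (intro exI allI)
    fix n
    let ?r = "steps search_body + 1 + (steps augment_body + 1)"
    let ?q = "steps search_init + 1 + (1 + 1 + 1)"
    let ?f = "4 * (steps reset_body + 1) + 3 * ?r" and ?g = "2 + 3 * ?q"
    let ?h = "steps find_darts + steps choose_pairing + steps order_pairing + steps split_vertex"
    show "time_bound n = (steps build_body + 1 + ?f) * (n * n) +
        (?g + ?h + 1 + (steps unwind_body + 1) + 4 * (steps output_body + 1)) * n +
        (6 + steps select_loop)"
      unfolding time_bound_def reduce_time_def flow_time_def round_time_def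
      by (simp add: algebra_simps)
  qed
  then obtain a b d where "\<forall>n. time_bound n = a * (n * n) + b * n + d" by blast
  then show ?thesis using quadratic_bigo[of a b d] by simp
qed

theorem theorem1:
  "\<exists>(p :: com) (T :: nat \<Rightarrow> nat).
     (\<lambda>n. real (T n)) \<in> O(\<lambda>n. real n ^ 2) \<and>
     (\<forall>(n :: nat) (c :: nat set \<Rightarrow> real) (x :: nat set \<Rightarrow> real).
        metric_cost n c \<and> subtour_optimal n c x \<and> half_integral n x \<longrightarrow>
        (\<exists>t s. exec p (input_state n c x) t s \<and> t \<le> T n \<and>
           spanning_multisubgraph n (output_multigraph n s) \<and>
           two_edge_connected {..<n} (output_multigraph n s) \<and>
           mg_cost c (output_multigraph n s) \<le> 4 / 3 * lp_cost n c x))"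
proof (intro exI[of _ program] exI[of _ time_bound] conjI time_bound_bigo allI impI)
  fix n c x
  assume *: "metric_cost n c \<and> subtour_optimal n c x \<and> half_integral n x"
  let ?Q = "\<lambda>s. spanning_multisubgraph n (output_multigraph n s) \<and>
     two_edge_connected {..<n} (output_multigraph n s) \<and>
     mg_cost c (output_multigraph n s) \<le> 4 / 3 * lp_cost n c x"
  have "runs program (input_state n c x) (time_bound n) ?Q"
  proof (cases "n = 0")
    case True
    have "edges 0 = {}" by (auto simp: edges_def)
    then have "?Q (input_state n c x)" unfolding True
      by (simp add: output_multigraph_def spanning_multisubgraph_def two_edge_connected_def mg_connected_def
          mg_cost_def lp_cost_def)
    then have "runs Skip (input_state n c x) 1 ?Q" using runs_result[of Skip ?Q] by simp
    then have "runs program (input_state n c x) (1 + 1) ?Q"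
      unfolding program_def by (intro runs_Cond) (use True in \<open>simp_all add: input_state_def\<close>)
    then show ?thesis
      by (rule runs_weaken) (simp_all add: time_bound_def)
  next
    case False
    interpret half_integral_instance n c x
      using * False by unfold_locales (auto simp: metric_cost_def subtour_optimal_def)
    show ?thesis by (rule runs_program)
  qed
  then show "\<exists>t s. exec program (input_state n c x) t s \<and> t \<le> time_bound n \<and>
           spanning_multisubgraph n (output_multigraph n s) \<and>
           two_edge_connected {..<n} (output_multigraph n s) \<and>
           mg_cost c (output_multigraph n s) \<le> 4 / 3 * lp_cost n c x"
    unfolding runs_def by blast
qed

end
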